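(* Let $\varphi=P(x)dx^{\otimes 3}$ be a polynomial cubic differential on $\mathbf{P}^1$, with $P$ a polynomial of degree $d$. Then $(\mathbf{P}^1,\varphi)$ has no closed saddle connection and at most one saddle connection between each pair of distinct zeros. In particular, $(\mathbf{P}^1,\varphi)$ has at most $\frac{d(d-1)}{2}$ (unoriented) saddle connections.
   Context: Away from the zeros of $P$ and $\infty$, branches of $\int^z\varphi^{1/3}$ give charts to $\mathbb{C}$ with transition maps $z\mapsto e^{2\pi i r/3}z+c$, hence a flat metric $|\varphi^{1/3}|$; a zero of order $k$ is a conical singularity of angle $\frac{2\pi}{3}(k+3)$ and $\infty$ is a pole of order $d+6$, at infinite distance. A trajectory is an oriented arc that is locally a straight segment (of any slope) in these charts and contains no singularity except possibly at its endpoints. A saddle connection is a trajectory both of whose ends are zeros of $\varphi$; it is closed if the two ends coincide. *)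

theory Defs
  imports "HOL-Complex_Analysis.Complex_Analysis" "HOL-Computational_Algebra.Polynomial"
begin

text \<open>
  A polynomial cubic differential P(x) dx^3 is represented by the polynomial P. Infinity is always
  a pole (of order d + 6), hence a singularity and never a zero, so every saddle connection lies in
  the complex plane, where the zeros of the differential are the roots of P.
\<close>

text \<open>Local branches w of the integral of P(z)^(1/3) dz that are injective, i.e. flat charts.\<close>

definition flat_chart :: "complex poly \<Rightarrow> complex set \<Rightarrow> (complex \<Rightarrow> complex) \<Rightarrow> bool" where
  "flat_chart P U w \<longleftrightarrow> open U \<and> connected U \<and> w holomorphic_on U \<and> inj_on w U \<and>
     (\<forall>z\<in>U. deriv w z ^ 3 = poly P z)"

text \<open>
  The parametrization is arbitrary (no speed is prescribed), and global injectivity is not required.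
  As g is continuous on the unit interval, the bijection with an open segment says that, near the parameter t, the
  chart image of g runs monotonically along a nondegenerate straight segment, of any slope.
\<close>

definition locally_straight_at :: "complex poly \<Rightarrow> (real \<Rightarrow> complex) \<Rightarrow> real \<Rightarrow> bool" where
  "locally_straight_at P g t \<longleftrightarrow>
     (\<exists>U w e a b. flat_chart P U w \<and> e > 0 \<and>
        {t - e<..<t + e} \<subseteq> {0<..<1} \<and> g ` {t - e<..<t + e} \<subseteq> U \<and>
        bij_betw (w \<circ> g) {t - e<..<t + e} (open_segment a b))"

text \<open>
  Only trajectories with both ends in the plane are considered. At an end that is not a root of P,
  straightness up to that end follows from continuity.
\<close>

definition trajectory :: "complex poly \<Rightarrow> (real \<Rightarrow> complex) \<Rightarrow> bool" where
  "trajectory P g \<longleftrightarrow> path g \<and>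
     (\<forall>t\<in>{0<..<1}. poly P (g t) \<noteq> 0 \<and> locally_straight_at P g t)"

definition saddle_connection :: "complex poly \<Rightarrow> (real \<Rightarrow> complex) \<Rightarrow> bool" where
  "saddle_connection P g \<longleftrightarrow>
     trajectory P g \<and> poly P (pathstart g) = 0 \<and> poly P (pathfinish g) = 0"

definition closed_saddle_connection :: "complex poly \<Rightarrow> (real \<Rightarrow> complex) \<Rightarrow> bool" where
  "closed_saddle_connection P g \<longleftrightarrow> saddle_connection P g \<and> pathstart g = pathfinish g"

text \<open>
  The parameter changes h are all homeomorphisms of the unit interval, increasing or decreasing.
  Values of paths outside the unit interval are irrelevant.
\<close>

definition same_unoriented_arc :: "(real \<Rightarrow> complex) \<Rightarrow> (real \<Rightarrow> complex) \<Rightarrow> bool" where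
  "same_unoriented_arc g1 g2 \<longleftrightarrow>
     (\<exists>h k. homeomorphism {0..1} {0..1} h k \<and> (\<forall>t\<in>{0..1}. g2 t = g1 (h t)))"

lemma equiv_same_unoriented_arc: "equiv UNIV {(g1, g2). same_unoriented_arc g1 g2}"
proof (rule equivI)
  show "refl {(g1, g2). same_unoriented_arc g1 g2}"
    unfolding refl_on_def same_unoriented_arc_def
    using homeomorphism_ident by fastforce
  show "sym {(g1, g2). same_unoriented_arc g1 g2}"
  proof (rule symI, clarsimp)
    fix g1 g2 assume "same_unoriented_arc g1 g2"
    then obtain h k where hk: "homeomorphism {0..1} {0..1} h k"
      and g: "\<forall>t\<in>{0..1}. g2 t = g1 (h t)"
      unfolding same_unoriented_arc_def by blast
    have "g1 t = g2 (k t)" if "t \<in> {0..1}" for t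
    proof -
      have "k t \<in> {0..1}" "h (k t) = t"
        using hk that unfolding homeomorphism_def by blast+
      then show ?thesis using g by metis
    qed
    then show "same_unoriented_arc g2 g1"
      unfolding same_unoriented_arc_def using hk homeomorphism_symD by blast
  qed
  show "trans {(g1, g2). same_unoriented_arc g1 g2}"
  proof (rule transI, clarsimp)
    fix g1 g2 g3 assume "same_unoriented_arc g1 g2" "same_unoriented_arc g2 g3"
    then obtain h k h' k' where hk: "homeomorphism {0..1} {0..1} h k"
      and g: "\<forall>t\<in>{0..1}. g2 t = g1 (h t)"
      and hk': "homeomorphism {0..1} {0..1} h' k'"
      and g': "\<forall>t\<in>{0..1}. g3 t = g2 (h' t)"
      unfolding same_unoriented_arc_def by blast
    have "g3 t = g1 ((h \<circ> h') t)" if "t \<in> {0..1}" for t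
    proof -
      have "h' t \<in> {0..1}" using hk' that unfolding homeomorphism_def by blast
      then show ?thesis using g g' that by simp
    qed
    then show "same_unoriented_arc g1 g3"
      unfolding same_unoriented_arc_def
      using homeomorphism_compose[OF hk' hk] by blast
  qed
qed simp

definition unoriented_saddle_connections :: "complex poly \<Rightarrow> (real \<Rightarrow> complex) set set" where
  "unoriented_saddle_connections P =
     {g. saddle_connection P g} // {(g1, g2). saddle_connection P g1 \<and> saddle_connection P g2 \<and>
       same_unoriented_arc g1 g2}"

end

theory Submission
  imports Defs
begin

text \<open>
  A closed saddle connection, or two different ones with the same ends, would produce a Jordan
  domain D whose boundary consists of two straight arcs A1, A2 and two corners. Map D conformally
  to the upper half plane; the map extends analytically across the arcs, and what the
  arcs leave uncovered on the boundary reduces to two points, which are placed at 0 and infinity.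
  The differential becomes G dz^3. Near 0 and infinity a flat coordinate W tends to a constant, and
  reflecting W in the straight sides bounds its derivative, so that G z^3 tends to 0 at both ends. On
  the other hand, |G z^3| obeys the maximum principle up to the boundary, because G dz^3 is, up to a
  constant factor, real on the real axis; hence G = 0, a contradiction. This replaces the Gauss-Bonnet
  theorem, by which the zeros of the differential inside D would contribute negative curvature.
\<close>

section \<open>Reflection\<close>

text \<open>Two corners are exactly what the argument can bear: z d/dz is real on the real axis and
  vanishes only at 0 and infinity, while a holomorphic field on the sphere with three zeros is zero.
  Euclidean triangles show that three straight sides do occur.

  Nothing is known in advance about the angles at the corners or about the Riemann map near them.
  The estimates there therefore use no angle, only that a flat coordinate has a limit, in a form
  invariant under scaling. On the arcs, regularity of the Riemann map f comes from straightness and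
  |f| -> 1.

  Trajectories are not assumed injective and two of them may cross, so the Jordan domain has to be
  cut out: either by a loop that contains no smaller loop, with an ordinary point promoted to second
  corner, or by an excursion of one trajectory away from the other, closed up by a piece of the
  latter. Corners may thus be zeros of P or ordinary points, and the cube root substitution treats
  all orders alike, order 0 included.\<close>

abbreviation half_ball :: "real \<Rightarrow> real \<Rightarrow> complex set" where
  "half_ball x r \<equiv> ball (complex_of_real x) r \<inter> {z. 0 < Im z}"

lemma open_half_ball: "open (half_ball x r)"
  by (intro open_Int open_ball open_halfspace_Im_gt)

lemma convex_half_ball: "convex (half_ball x r)"
  by (intro convex_Int convex_ball convex_halfspace_Im_gt)

lemma cnj_in_ball: "cnj z \<in> ball (complex_of_real x) r \<longleftrightarrow> z \<in> ball (complex_of_real x) r"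
proof -
  have "dist (complex_of_real x) (cnj z) = dist (complex_of_real x) z"
    by (metis complex_cnj_complex_of_real complex_cnj_diff complex_mod_cnj dist_norm)
  then show ?thesis by simp
qed

lemma add_ii_in_half_ball:
  assumes "z \<in> ball (complex_of_real x) r" "Im z = 0"
  shows "\<forall>\<^sub>F h in at_right (0::real). z + \<i> * of_real h \<in> half_ball x r"
proof -
  have "((\<lambda>h. z + \<i> * of_real h) \<longlongrightarrow> z + \<i> * of_real 0) (at_right (0::real))"
    by (intro tendsto_intros)
  then have "\<forall>\<^sub>F h in at_right (0::real). z + \<i> * of_real h \<in> ball (complex_of_real x) r"
    using assms(1) by (auto dest: topological_tendstoD[OF _ open_ball])
  moreover have "\<forall>\<^sub>F h in at_right (0::real). 0 < h"
    by (simp add: eventually_at_right_less)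
  ultimately show ?thesis
    by eventually_elim (use assms(2) in auto)
qed

lemma real_in_closure_half_ball:
  assumes "z \<in> ball (complex_of_real x) r" "Im z = 0"
  shows "z \<in> closure (half_ball x r)"
proof -
  have "((\<lambda>h. z + \<i> * of_real h) \<longlongrightarrow> z + \<i> * of_real 0) (at_right (0::real))"
    by (intro tendsto_intros)
  then have lim: "((\<lambda>h. z + \<i> * of_real h) \<longlongrightarrow> z) (at_right (0::real))" by simp
  have "\<forall>\<^sub>F h in at_right (0::real). z + \<i> * of_real h \<in> closure (half_ball x r)"
    using add_ii_in_half_ball[OF assms]
    by (rule eventually_mono) (rule subsetD[OF closure_subset])
  from Lim_in_closed_set[OF closed_closure this _ lim] show ?thesis by simp
qed

lemma real_islimpt_half_ball:
  assumes "z \<in> ball (complex_of_real x) r" "Im z = 0"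
  shows "at z within half_ball x r \<noteq> bot"
proof -
  have "z \<notin> half_ball x r" using assms(2) by simp
  then show ?thesis
    using real_in_closure_half_ball[OF assms] unfolding trivial_limit_within closure_def by blast
qed

lemma holomorphic_tendsto_within:
  assumes "f holomorphic_on S" "open S" "z \<in> S"
  shows "(f \<longlongrightarrow> f z) (at z within T)"
proof -
  have "isCont f z"
    using assms continuous_on_eq_continuous_at holomorphic_on_imp_continuous_on by blast
  then show ?thesis using continuous_at_imp_continuous_at_within continuous_within by blast
qed

text \<open>The diameter is reached as a limit from the upper half, the lower half by symmetry of
  the modulus. It serves both the reflected flat coordinate and the boundary case of the maximum
  principle.\<close>

lemma reflected_norm_bound:
  assumes k: "k holomorphic_on ball (of_real x) r"
    and sym: "\<And>w. w \<in> ball (of_real x) r \<Longrightarrow> norm (k (cnj w)) = norm (k w)"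
    and up: "\<And>w. w \<in> half_ball x r \<Longrightarrow> norm (k w) \<le> B" and w: "w \<in> ball (of_real x) r"
  shows "norm (k w) \<le> B"
proof -
  consider "Im w > 0" | "Im w = 0" | "Im w < 0" by linarith
  then show ?thesis
  proof cases
    case 1 then show ?thesis using up[of w] w by simp
  next
    case 2
    have "(k \<longlongrightarrow> k w) (at w within half_ball x r)"
      by (rule holomorphic_tendsto_within[OF k open_ball w])
    moreover have "\<forall>\<^sub>F z in at w within half_ball x r. norm (k z) \<le> B"
      unfolding eventually_at using up by (intro exI[of _ 1] conjI ballI impI zero_less_one) blast
    ultimately show ?thesis using Lim_norm_ubound real_islimpt_half_ball[OF w 2] by blast
  next
    case 3
    then have "cnj w \<in> half_ball x r" using w cnj_in_ball[of w x r] by simp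
    then show ?thesis using up sym[OF w] by metis
  qed
qed

text \<open>
  Only the imaginary part is assumed to have boundary values. A primitive of f is Lipschitz, hence
  extends continuously to the real axis, where its imaginary part has derivative zero; so
  Schwarz reflection applies to the primitive.
\<close>

lemma bounded_reflection:
  fixes x0 r :: real
  assumes hol: "f holomorphic_on half_ball x0 r" and r: "r > 0"
    and bd: "\<And>z. z \<in> half_ball x0 r \<Longrightarrow> norm (f z) \<le> M"
    and lim: "\<And>x. x \<in> ball (complex_of_real x0) r \<Longrightarrow> Im x = 0 \<Longrightarrow>
                ((\<lambda>z. Im (f z)) \<longlongrightarrow> 0) (at x within half_ball x0 r)"
  obtains F where "F holomorphic_on ball (of_real x0) r"
    "\<And>z. z \<in> half_ball x0 r \<Longrightarrow> F z = f z"
    "\<And>z. z \<in> ball (of_real x0) r \<Longrightarrow> F (cnj z) = cnj (F z)"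
proof -
  let ?H = "half_ball x0 r" and ?B = "ball (complex_of_real x0) r"
  obtain A where A: "\<And>z. z \<in> ?H \<Longrightarrow> (A has_field_derivative f z) (at z within ?H)"
    using holomorphic_convex_primitive'[OF convex_half_ball open_half_ball hol] by blast
  have A': "(A has_field_derivative f z) (at z)" if "z \<in> ?H" for z
    using A[OF that] at_within_open[OF that open_half_ball] by simp
  have M0: "0 \<le> M"
  proof -
    obtain h where "of_real x0 + \<i> * of_real h \<in> ?H"
      using eventually_happens[OF add_ii_in_half_ball[of "of_real x0" x0 r]] r by auto
    then show ?thesis using bd norm_ge_zero order_trans by blast
  qed
  have "M-lipschitz_on ?H A"
    using field_differentiable_bound[OF convex_half_ball A bd] M0
    by (auto simp: lipschitz_on_def dist_norm)
  then obtain A2 where A2: "M-lipschitz_on (closure ?H) A2" "\<And>z. z \<in> ?H \<Longrightarrow> A2 z = A z"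
    using lipschitz_extend_closure by blast
  have sub: "?B \<inter> {z. 0 \<le> Im z} \<subseteq> closure ?H"
  proof
    fix z assume z: "z \<in> ?B \<inter> {z. 0 \<le> Im z}"
    show "z \<in> closure ?H"
    proof (cases "Im z = 0")
      case True
      then show ?thesis using real_in_closure_half_ball[of z x0 r] z by blast
    next
      case False
      then have "z \<in> ?H" using z by auto
      then show ?thesis by (rule subsetD[OF closure_subset])
    qed
  qed
  have cont: "continuous_on (?B \<inter> {z. 0 \<le> Im z}) A2"
    using A2(1) sub lipschitz_on_continuous_on continuous_on_subset by blast
  have vert: "((\<lambda>h. A2 (z + \<i> * of_real h)) \<longlongrightarrow> A2 z) (at_right (0::real))"
    if "z \<in> ?B" "Im z = 0" for z
  proof -
    have c: "(A2 \<longlongrightarrow> A2 z) (at z within closure ?H)"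
      using A2(1) lipschitz_on_continuous_on real_in_closure_half_ball[OF that]
      by (auto simp: continuous_on_def)
    have "((\<lambda>h. z + \<i> * of_real h) \<longlongrightarrow> z + \<i> * of_real 0) (at_right (0::real))"
      by (intro tendsto_intros)
    moreover have "\<forall>\<^sub>F h in at_right (0::real). z + \<i> * of_real h \<in> closure ?H \<and> z + \<i> * of_real h \<noteq> z"
      using add_ii_in_half_ball[OF that] eventually_at_right_less[of "0::real"]
    proof eventually_elim
      case (elim h)
      have "z + \<i> * of_real h \<in> closure ?H" by (rule subsetD[OF closure_subset]) (rule elim)
      then show ?case using elim by auto
    qed
    ultimately have "filterlim (\<lambda>h. z + \<i> * of_real h) (at z within closure ?H) (at_right (0::real))"
      by (auto simp: filterlim_at)
    then show ?thesis using c by (rule filterlim_compose[rotated])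
  qed
  define v where "v t = Im (A2 (of_real t))" for t :: real
  define I where "I = {x0 - r<..<x0 + r}"
  have I: "t \<in> I \<longleftrightarrow> complex_of_real t \<in> ?B" for t
  proof -
    have "dist (complex_of_real x0) (complex_of_real t) = \<bar>x0 - t\<bar>"
      by (metis dist_of_real dist_real_def)
    then show ?thesis by (auto simp: I_def abs_less_iff)
  qed
  have v0: "(v has_real_derivative 0) (at t)" if t: "t \<in> I" for t
  proof -
    have tB: "complex_of_real t \<in> ?B" using t I by simp
    have "((\<lambda>s. (v s - v t) / (s - t)) \<longlongrightarrow> 0) (at t)"
    proof (rule tendstoI)
      fix e :: real assume "e > 0"
      have "\<forall>\<^sub>F z in at (complex_of_real t) within ?H. \<bar>Im (f z)\<bar> < e / 2"
        using tendstoD[OF lim[OF tB], of "e/2"] \<open>e > 0\<close> by (simp add: dist_norm)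
      then obtain d where "d > 0" and d1: "\<forall>z\<in>?H. z \<noteq> of_real t \<and> dist z (of_real t) < d \<longrightarrow> \<bar>Im (f z)\<bar> < e/2"
        unfolding eventually_at by blast
      have d: "d > 0" "\<And>z. z \<in> ?H \<Longrightarrow> dist z (of_real t) < d \<Longrightarrow> \<bar>Im (f z)\<bar> < e/2"
      proof -
        fix z assume z: "z \<in> ?H" "dist z (of_real t) < d"
        then have "z \<noteq> of_real t" by auto
        then show "\<bar>Im (f z)\<bar> < e/2" using d1 z by blast
      qed fact
      have "\<bar>v s - v t\<bar> \<le> e/2 * \<bar>s - t\<bar>" if s: "s \<in> I" "\<bar>s - t\<bar> < d" for s
      proof -
        have sB: "complex_of_real s \<in> ?B" using s I by simp
        \<comment> \<open>The two boundary points are compared at height \<open>h\<close>, where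
          \<open>A\<close> is differentiable: along a horizontal line the derivative of
          \<open>Im A\<close> is \<open>Im f\<close>, at most \<open>e / 2\<close> near
          \<open>t\<close>. Letting \<open>h\<close> tend to 0 keeps only a weak inequality; hence
          \<open>e / 2\<close> instead of \<open>e\<close>.\<close>
        have ev: "\<forall>\<^sub>F h in at_right (0::real).
           \<bar>Im (A2 (of_real s + \<i> * of_real h)) - Im (A2 (of_real t + \<i> * of_real h))\<bar> \<le> e/2 * \<bar>s - t\<bar>"
        proof -
          have 1: "\<forall>\<^sub>F h in at_right (0::real). of_real s + \<i> * of_real h \<in> ?H"
            using add_ii_in_half_ball[OF sB] by simp
          have 2: "\<forall>\<^sub>F h in at_right (0::real). of_real t + \<i> * of_real h \<in> ?H"
            using add_ii_in_half_ball[OF tB] by simp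
          have l1: "((\<lambda>h. of_real s + \<i> * of_real h) \<longlongrightarrow> of_real s + \<i> * of_real 0) (at_right (0::real))"
            by (intro tendsto_intros)
          have l2: "((\<lambda>h. of_real t + \<i> * of_real h) \<longlongrightarrow> of_real t + \<i> * of_real 0) (at_right (0::real))"
            by (intro tendsto_intros)
          have sd: "complex_of_real s \<in> ball (of_real t) d"
            using s by (metis abs_minus_commute dist_of_real dist_real_def mem_ball)
          have 3: "\<forall>\<^sub>F h in at_right (0::real). of_real s + \<i> * of_real h \<in> ball (complex_of_real t) d"
            using topological_tendstoD[OF l1 open_ball, of "of_real t" d] sd by simp
          have 4: "\<forall>\<^sub>F h in at_right (0::real). of_real t + \<i> * of_real h \<in> ball (complex_of_real t) d"
            using topological_tendstoD[OF l2 open_ball, of "of_real t" d] d by simp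
          show ?thesis using 1 2 3 4
          proof eventually_elim
            case (elim h)
            define a where "a = complex_of_real t + \<i> * of_real h"
            define b where "b = complex_of_real s + \<i> * of_real h"
            have seg: "closed_segment a b \<subseteq> ?H \<inter> ball (of_real t) d"
              using elim unfolding a_def b_def
              by (intro closed_segment_subset convex_Int convex_ball convex_half_ball) auto
            \<comment> \<open>\<open>s\<close> may lie on either side of \<open>t\<close>, so the
              parameter interval is written with \<open>min\<close> and \<open>max\<close>.\<close>
            have on: "a + of_real u \<in> closed_segment a b"
              if u: "u \<in> {min 0 (s-t)..max 0 (s-t)}" for u
            proof (cases "s = t")
              case True then show ?thesis using u by auto
            next
              case False
              define p where "p = u / (s - t)"
              have p: "u = p * (s - t)" using False by (simp add: p_def)
              have b: "b = a + of_real (s - t)" by (simp add: a_def b_def)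
              have "a + of_real u = (1 - p) *\<^sub>R a + p *\<^sub>R b"
                unfolding b p by (simp add: scaleR_conv_of_real algebra_simps)
              moreover have "0 \<le> p" "p \<le> 1"
                using u False by (auto simp: p_def field_simps min_def max_def split: if_splits)
              ultimately show ?thesis unfolding closed_segment_def by blast
            qed
            have der: "((\<lambda>u. Im (A (a + of_real u))) has_real_derivative Im (f (a + of_real u)))
                 (at u within {min 0 (s-t)..max 0 (s-t)})"
              if "u \<in> {min 0 (s-t)..max 0 (s-t)}" for u
            proof -
              have "a + of_real u \<in> closed_segment a b" using on that .
              then have "a + of_real u \<in> ?H" using seg by blast
              note A'[OF this]
              moreover have "((\<lambda>u. a + of_real u) has_vector_derivative 1) (at u)"
                unfolding has_vector_derivative_def
                by (auto intro!: derivative_eq_intros simp: scaleR_conv_of_real)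
              ultimately have "((\<lambda>u. A (a + of_real u)) has_vector_derivative f (a + of_real u)) (at u)"
                using field_vector_diff_chain_at[of "\<lambda>u. a + of_real u" 1 u A "f (a + of_real u)"]
                by (simp add: o_def)
              then have "((\<lambda>u. Im (A (a + of_real u))) has_vector_derivative Im (f (a + of_real u))) (at u)"
                by (intro bounded_linear.has_vector_derivative[OF bounded_linear_Im])
              then show ?thesis
                using has_real_derivative_iff_has_vector_derivative has_field_derivative_at_within by blast
            qed
            have "\<bar>Im (f (a + of_real u))\<bar> \<le> e/2" if "u \<in> {min 0 (s-t)..max 0 (s-t)}" for u
            proof -
              have "a + of_real u \<in> closed_segment a b" using on that .
              then have "a + of_real u \<in> ?H" "dist (a + of_real u) (of_real t) < d"
                using seg by (auto simp: dist_commute)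
              then show ?thesis using d(2) by force
            qed
            then have "norm (Im (A (a + of_real (s-t))) - Im (A (a + of_real 0))) \<le> e/2 * norm ((s-t) - 0)"
              by (intro field_differentiable_bound[OF _ der]) auto
            moreover have "a + of_real (s-t) = b" by (simp add: a_def b_def)
            moreover have "A2 a = A a" "A2 b = A b" using elim A2(2) by (auto simp: a_def b_def)
            ultimately have "\<bar>Im (A2 b) - Im (A2 a)\<bar> \<le> e/2 * \<bar>s - t\<bar>" by simp
            then show ?case by (simp only: a_def b_def)
          qed
        qed
        have lim2: "((\<lambda>h. \<bar>Im (A2 (of_real s + \<i> * of_real h)) - Im (A2 (of_real t + \<i> * of_real h))\<bar>)
            \<longlongrightarrow> \<bar>v s - v t\<bar>) (at_right (0::real))"
          unfolding v_def using vert[OF sB] vert[OF tB] by (intro tendsto_intros) auto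
        show ?thesis by (rule tendsto_upperbound[OF lim2 ev]) simp
      qed
      note le = this
      have *: "dist ((v s - v t) / (s - t)) 0 < e" if "s \<in> I" "\<bar>s - t\<bar> < d" "s \<noteq> t" for s
      proof -
        have "\<bar>v s - v t\<bar> \<le> e/2 * \<bar>s - t\<bar>" using le that by blast
        also have "\<dots> < e * \<bar>s - t\<bar>" using that \<open>e > 0\<close> by simp
        finally show ?thesis using that by (simp add: dist_norm abs_divide pos_divide_less_eq)
      qed
      have "\<forall>\<^sub>F s in at t. s \<in> I"
        using t eventually_at_in_open'[of I t] by (simp add: I_def)
      moreover have "\<forall>\<^sub>F s in at t. \<bar>s - t\<bar> < d \<and> s \<noteq> t"
        using d(1) unfolding eventually_at by (auto simp: dist_real_def)
      ultimately show "\<forall>\<^sub>F s in at t. dist ((v s - v t) / (s - t)) 0 < e"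
        by eventually_elim (use * in auto)
    qed
    then show ?thesis by (simp add: has_field_derivative_iff)
  qed
  have vc: "v t = v x0" if "t \<in> I" for t
  proof -
    have "x0 \<in> I" using r by (simp add: I_def)
    moreover have "convex I" by (simp add: I_def)
    moreover have "\<exists>c. \<forall>t\<in>I. v t = c"
      by (rule has_field_derivative_zero_constant)
         (use \<open>convex I\<close> v0 in \<open>auto intro: has_field_derivative_at_within\<close>)
    ultimately show ?thesis using that by auto
  qed
  \<comment> \<open>\<open>Im A2\<close> is constant on the diameter; subtracting that constant
    makes the primitive real there, as Schwarz reflection requires.\<close>
  define B where "B z = A2 z - \<i> * of_real (v x0)" for z
  have real_B: "B z \<in> \<real>" if z: "z \<in> ?B" "z \<in> \<real>" for z
  proof -
    obtain t where t: "z = of_real t" using z(2) Reals_cases by blast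
    then have "v t = v x0" using vc I z(1) by blast
    then show ?thesis by (simp add: B_def t v_def complex_is_Real_iff)
  qed
  have "A holomorphic_on ?H"
    using A field_differentiable_def holomorphic_on_def by blast
  then have "A2 holomorphic_on ?H"
    using A2(2) holomorphic_transform by metis
  then have holB: "B holomorphic_on ?H" unfolding B_def by (intro holomorphic_intros)
  define E where "E = (\<lambda>z. if 0 \<le> Im z then B z else cnj (B (cnj z)))"
  have E: "E holomorphic_on ?B"
    unfolding E_def
  proof (rule Schwarz_reflection)
    show "cnj ` ?B \<subseteq> ?B" using cnj_in_ball by blast
    show "continuous_on (?B \<inter> {z. 0 \<le> Im z}) B" unfolding B_def by (intro continuous_intros cont)
  qed (use holB real_B in auto)
  have Esym: "E (cnj z) = cnj (E z)" if "z \<in> ?B" for z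
  proof (cases "Im z = 0")
    case True
    then have "B z \<in> \<real>" using real_B that complex_is_Real_iff by blast
    moreover have "cnj z = z" using True by (simp add: complex_eq_iff)
    ultimately show ?thesis using True
      by (simp add: E_def Reals_cnj_iff)
  next
    case False then show ?thesis by (auto simp: E_def)
  qed
  show ?thesis
  proof (rule that[of "deriv E"])
    show "deriv E holomorphic_on ?B" using E by (simp add: holomorphic_deriv)
    show "deriv E z = f z" if z: "z \<in> ?H" for z
    proof -
      have "(B has_field_derivative f z) (at z)"
      proof (rule has_field_derivative_transform_within_open[OF _ open_half_ball z])
        show "((\<lambda>z. A z - \<i> * of_real (v x0)) has_field_derivative f z) (at z)"
          using A'[OF z] by (auto intro!: derivative_eq_intros)
      qed (auto simp: B_def A2(2))
      then have "(E has_field_derivative f z) (at z)"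
        by (rule has_field_derivative_transform_within_open[OF _ open_half_ball z]) (auto simp: E_def)
      then show ?thesis by (rule DERIV_imp_deriv)
    qed
    show "deriv E (cnj z) = cnj (deriv E z)" if z: "z \<in> ?B" for z
    proof -
      have "(E has_field_derivative deriv E z) (at z)"
        using E z holomorphic_derivI open_ball by blast
      then have "(cnj \<circ> E \<circ> cnj has_field_derivative cnj (deriv E z)) (at (cnj z))"
        by (rule has_field_derivative_cnj_cnj[of E "deriv E z" "cnj z", simplified])
      then have "(E has_field_derivative cnj (deriv E z)) (at (cnj z))"
        by (rule has_field_derivative_transform_within_open[OF _ open_ball])
           (use z cnj_in_ball Esym in \<open>fastforce+\<close>)
      then show ?thesis by (rule DERIV_imp_deriv)
    qed
  qed
qed

lemma half_ball_nonempty: "r > 0 \<Longrightarrow> half_ball x r \<noteq> {}"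
  using eventually_happens[OF add_ii_in_half_ball[of "of_real x" x r]] by auto

lemma eventually_in_half_ball_shrink:
  assumes "\<forall>\<^sub>F z in at (of_real x) within half_ball x r. Q z" "r > 0"
  obtains s where "0 < s" "s \<le> r" "\<And>z. z \<in> half_ball x s \<Longrightarrow> Q z"
proof -
  obtain d where d: "d > 0"
    "\<forall>z\<in>half_ball x r. z \<noteq> of_real x \<and> dist z (of_real x) < d \<longrightarrow> Q z"
    using assms(1) unfolding eventually_at by blast
  have "Q z" if z: "z \<in> half_ball x (min d r)" for z
  proof -
    have "z \<noteq> of_real x" using z by auto
    then show ?thesis using d(2) z by (auto simp: dist_commute)
  qed
  then show ?thesis using that[of "min d r"] d(1) assms(2) by auto
qed

lemma half_ball_mono: "s \<le> r \<Longrightarrow> half_ball x s \<subseteq> half_ball x r"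
  by auto

text \<open>
  Reflection in the unit circle reduces to reflection in the real axis: on the unit circle both
  T + 1/T and i (T - 1/T) are real.
\<close>

lemma circle_reflection:
  fixes r :: real
  assumes hol: "T holomorphic_on half_ball 0 r" and r: "r > 0"
    and lt1: "\<And>z. z \<in> half_ball 0 r \<Longrightarrow> norm (T z) < 1"
    and lim: "\<And>x. x \<in> ball 0 r \<Longrightarrow> Im x = 0 \<Longrightarrow>
                ((\<lambda>z. norm (T z)) \<longlongrightarrow> 1) (at x within half_ball 0 r)"
  obtains s F where "0 < s" "s \<le> r" "F holomorphic_on ball 0 s"
    "\<And>z. z \<in> half_ball 0 s \<Longrightarrow> F z = T z"
    "\<And>z. z \<in> ball 0 s \<Longrightarrow> F z \<noteq> 0"
    "\<And>z. z \<in> ball 0 s \<Longrightarrow> F (cnj z) = 1 / cnj (F z)"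
proof -
  have "((\<lambda>z. norm (T z)) \<longlongrightarrow> 1) (at (of_real 0) within half_ball 0 r)"
    using lim[of 0] r by simp
  \<comment> \<open>Staying above 1/2 keeps \<open>1 / T\<close> bounded by 2, so that
    \<open>f1\<close> and \<open>f2\<close> are bounded by 1 + 2 = 3.\<close>
  then have "\<forall>\<^sub>F z in at (of_real 0) within half_ball 0 r. norm (T z) > 1/2"
    by (rule order_tendstoD) simp
  then obtain s where s: "0 < s" "s \<le> r" "\<And>z. z \<in> half_ball 0 s \<Longrightarrow> norm (T z) > 1/2"
    using eventually_in_half_ball_shrink r by blast
  let ?H = "half_ball 0 s"
  have HH: "?H \<subseteq> half_ball 0 r" using half_ball_mono[OF s(2)] .
  have holT: "T holomorphic_on ?H" using holomorphic_on_subset[OF hol HH] .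
  have T0: "T z \<noteq> 0" if "z \<in> ?H" for z using s(3)[OF that] by auto
  have T1: "norm (T z) < 1" if "z \<in> ?H" for z using lt1 HH that by blast
  have lims: "((\<lambda>z. 1 - 1 / (norm (T z))^2) \<longlongrightarrow> 0) (at x within ?H)"
    if x: "x \<in> ball 0 s" "Im x = 0" for x
  proof -
    have "((\<lambda>z. norm (T z)) \<longlongrightarrow> 1) (at x within ?H)"
      using tendsto_within_subset[OF lim HH] x s(2) by auto
    then have "((\<lambda>z. 1 - 1 / (norm (T z))^2) \<longlongrightarrow> 1 - 1 / 1^2) (at x within ?H)"
      by (intro tendsto_intros) auto
    then show ?thesis by simp
  qed
  define f1 where "f1 z = T z + 1 / T z" for z
  define f2 where "f2 z = \<i> * (T z - 1 / T z)" for z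
  have h1: "f1 holomorphic_on ?H" and h2: "f2 holomorphic_on ?H"
    unfolding f1_def f2_def by (intro holomorphic_intros holT T0; assumption)+
  have inv2: "norm (1 / T z) \<le> 2" if "z \<in> ?H" for z
  proof -
    have "0 < norm (T z)" using s(3)[OF that] by linarith
    then show ?thesis using s(3)[OF that] by (simp add: norm_divide pos_divide_le_eq)
  qed
  have b1: "norm (f1 z) \<le> 3" if z: "z \<in> ?H" for z
    using norm_triangle_ineq[of "T z" "1 / T z"] inv2[OF z] T1[OF z] unfolding f1_def by linarith
  have b2: "norm (f2 z) \<le> 3" if z: "z \<in> ?H" for z
    using norm_triangle_ineq4[of "T z" "1 / T z"] inv2[OF z] T1[OF z]
    unfolding f2_def norm_mult norm_ii by linarith
  \<comment> \<open>Both imaginary parts contain the factor 1 - 1/|T|^2, which tends to 0 while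
    \<open>T\<close> stays bounded; no limit of \<open>T\<close> itself is required.\<close>
  have i1: "Im (f1 z) = Im (T z) * (1 - 1 / (norm (T z))^2)" for z
    unfolding f1_def by (simp add: Im_divide cmod_power2 algebra_simps)
  have i2: "Im (f2 z) = Re (T z) * (1 - 1 / (norm (T z))^2)" for z
    unfolding f2_def by (simp add: Re_divide Im_divide cmod_power2 algebra_simps)
  have null: "((\<lambda>z. g (T z) * (1 - 1 / (norm (T z))^2)) \<longlongrightarrow> 0) (at x within ?H)"
    if x: "x \<in> ball 0 s" "Im x = 0" and g: "\<And>w. \<bar>g w\<bar> \<le> norm w" for x and g :: "complex \<Rightarrow> real"
  proof (rule Lim_null_comparison)
    have "\<bar>g (T z)\<bar> \<le> 1" if "z \<in> ?H" for z using g[of "T z"] T1[OF that] by linarith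
    then have "norm (g (T z) * (1 - 1 / (norm (T z))^2)) \<le> norm (1 - 1 / (norm (T z))^2)" if "z \<in> ?H" for z
      using that by (simp add: abs_mult mult_left_le_one_le)
    then show "\<forall>\<^sub>F z in at x within ?H. norm (g (T z) * (1 - 1 / (norm (T z))^2)) \<le> norm (1 - 1 / (norm (T z))^2)"
      unfolding eventually_at by (auto intro: exI[of _ 1])
    show "((\<lambda>z. norm (1 - 1 / (norm (T z))^2)) \<longlongrightarrow> 0) (at x within ?H)"
      using tendsto_norm_zero[OF lims[OF x]] .
  qed
  have l1: "((\<lambda>z. Im (f1 z)) \<longlongrightarrow> 0) (at x within ?H)" if "x \<in> ball (of_real 0) s" "Im x = 0" for x
    unfolding i1 using that by (intro null) (auto intro: abs_Im_le_cmod)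
  have l2: "((\<lambda>z. Im (f2 z)) \<longlongrightarrow> 0) (at x within ?H)" if "x \<in> ball (of_real 0) s" "Im x = 0" for x
    unfolding i2 using that by (intro null) (auto intro: abs_Re_le_cmod)
  obtain F1 where F1: "F1 holomorphic_on ball (of_real 0) s" "\<And>z. z \<in> ?H \<Longrightarrow> F1 z = f1 z"
    "\<And>z. z \<in> ball (of_real 0) s \<Longrightarrow> F1 (cnj z) = cnj (F1 z)"
    using bounded_reflection[OF h1 s(1) b1 l1] by blast
  obtain F2 where F2: "F2 holomorphic_on ball (of_real 0) s" "\<And>z. z \<in> ?H \<Longrightarrow> F2 z = f2 z"
    "\<And>z. z \<in> ball (of_real 0) s \<Longrightarrow> F2 (cnj z) = cnj (F2 z)"
    using bounded_reflection[OF h2 s(1) b2 l2] by blast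
  \<comment> \<open>These combinations undo \<open>f1\<close> and \<open>f2\<close>: on the half
    ball they equal \<open>T\<close> and \<open>1 / T\<close>. Reflection exchanges them up to
    conjugation, because conjugating flips the sign of the i in front of \<open>F2\<close>.\<close>
  define F where "F z = (F1 z - \<i> * F2 z) / 2" for z
  define K where "K z = (F1 z + \<i> * F2 z) / 2" for z
  have hF: "F holomorphic_on ball 0 s" and hK: "K holomorphic_on ball 0 s"
    unfolding F_def K_def using F1(1) F2(1) by (auto intro!: holomorphic_intros)
  have FT: "F z = T z" and KT: "K z = 1 / T z" if "z \<in> ?H" for z
    unfolding F_def K_def F1(2)[OF that] F2(2)[OF that] f1_def f2_def
    by simp_all
  have FK: "F z * K z = 1" if z: "z \<in> ball 0 s" for z
  proof -
    have "F z * K z - 1 = 0"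
    proof (rule analytic_continuation_open[where s = ?H and s' = "ball 0 s" and f = "\<lambda>z. F z * K z - 1" and g = "\<lambda>z. 0"])
      show "?H \<noteq> {}" using half_ball_nonempty s(1) by blast
      show "(\<lambda>z. F z * K z - 1) holomorphic_on ball 0 s" by (intro holomorphic_intros hF hK)
      show "F z * K z - 1 = 0" if "z \<in> ?H" for z using FT KT T0 that by simp
    qed (use z open_half_ball[of 0 s] in auto)
    then show ?thesis by simp
  qed
  have sym: "F (cnj z) = cnj (K z)" if "z \<in> ball 0 s" for z
    using F1(3) F2(3) that by (simp add: F_def K_def)
  have sym2: "F (cnj z) = 1 / cnj (F z)" if "z \<in> ball 0 s" for z
  proof -
    have "cnj (F z) * cnj (K z) = 1" using FK[OF that] by (metis complex_cnj_mult complex_cnj_one)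
    then show ?thesis using sym[OF that] by (metis nonzero_eq_divide_eq mult.commute mult_zero_left zero_neq_one)
  qed
  show ?thesis
    by (rule that[of s F]) (use s hF FT FK sym2 in fastforce)+
qed

section \<open>Cubic differentials on the upper half plane\<close>

text \<open>
  The boundary condition at x on a cubic differential G dz^3 of the upper half plane: up to a
  constant factor, G dz^3 is the cube of a one-form that is real on the real axis. Equivalently,
  the real axis near x is a straight segment of the flat metric.
\<close>

definition real_cube_at :: "(complex \<Rightarrow> complex) \<Rightarrow> real \<Rightarrow> bool" where
  "real_cube_at G x \<longleftrightarrow> (\<exists>\<rho>>0. \<exists>c e. c \<noteq> 0 \<and> e holomorphic_on ball (of_real x) \<rho> \<and>
     (\<forall>z\<in>ball (of_real x) \<rho>. e z \<noteq> 0 \<and> e (cnj z) = cnj (e z)) \<and>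
     (\<forall>z\<in>half_ball x \<rho>. G z = c * e z ^ 3))"

text \<open>The quotient of \<open>W'\<close> by \<open>e\<close> is continuous and takes only cube
  roots of \<open>c\<close> as values, so it is a constant \<open>u\<close>. Hence \<open>W\<close>
  is an affine image of a primitive \<open>E\<close> of \<open>e\<close>, and the axis goes to a
  segment of direction \<open>u\<close>.\<close>

lemma real_cube_primitive:
  assumes G: "real_cube_at G x" and x: "\<bar>x - x0\<bar> < r"
    and W: "\<And>z. z \<in> half_ball x0 r \<Longrightarrow> (W has_field_derivative W' z) (at z)"
    and W': "W' holomorphic_on half_ball x0 r"
    and cube: "\<And>z. z \<in> half_ball x0 r \<Longrightarrow> W' z ^ 3 = G z"
  obtains \<rho> u k E e where "\<rho> > 0" "ball (of_real x) \<rho> \<subseteq> ball (complex_of_real x0) r" "u \<noteq> 0"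
    "\<And>z. z \<in> ball (of_real x) \<rho> \<Longrightarrow> (E has_field_derivative e z) (at z) \<and> e z \<noteq> 0"
    "\<And>z. z \<in> ball (of_real x) \<rho> \<Longrightarrow> Im z = 0 \<Longrightarrow> Im (E z) = 0"
    "\<And>z. z \<in> half_ball x \<rho> \<Longrightarrow> W z = u * E z + k"
proof -
  obtain \<rho>0 c e where \<rho>0: "\<rho>0 > 0" "c \<noteq> 0" "e holomorphic_on ball (of_real x) \<rho>0"
    "\<And>z. z \<in> ball (of_real x) \<rho>0 \<Longrightarrow> e z \<noteq> 0 \<and> e (cnj z) = cnj (e z)"
    "\<And>z. z \<in> half_ball x \<rho>0 \<Longrightarrow> G z = c * e z ^ 3"
    using G unfolding real_cube_at_def by blast
  define \<rho> where "\<rho> = min \<rho>0 (r - \<bar>x - x0\<bar>)"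
  have \<rho>: "\<rho> > 0" "\<rho> \<le> \<rho>0" using \<rho>0(1) x by (auto simp: \<rho>_def)
  have sub0: "ball (complex_of_real x) \<rho> \<subseteq> ball (of_real x) \<rho>0" using \<rho>(2) by auto
  have sub: "ball (complex_of_real x) \<rho> \<subseteq> ball (of_real x0) r"
  proof
    fix z assume "z \<in> ball (complex_of_real x) \<rho>"
    moreover have "dist (complex_of_real x0) (of_real x) = \<bar>x - x0\<bar>"
      by (metis abs_minus_commute dist_of_real dist_real_def)
    moreover have "dist (complex_of_real x0) z \<le> dist (of_real x0) (complex_of_real x) + dist (of_real x) z"
      by (rule dist_triangle)
    ultimately show "z \<in> ball (of_real x0) r" by (auto simp: \<rho>_def)
  qed
  then have subh: "half_ball x \<rho> \<subseteq> half_ball x0 r" by auto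
  have ehol: "e holomorphic_on ball (of_real x) \<rho>" using holomorphic_on_subset[OF \<rho>0(3) sub0] .
  have e0: "e z \<noteq> 0" "e (cnj z) = cnj (e z)" if "z \<in> ball (of_real x) \<rho>" for z
    using \<rho>0(4) sub0 that by auto
  have q3: "(W' z / e z) ^ 3 = c" if z: "z \<in> half_ball x \<rho>" for z
  proof -
    have "z \<in> half_ball x0 r" "z \<in> half_ball x \<rho>0" using subh sub0 z by blast+
    then have "W' z ^ 3 = c * e z ^ 3" using cube \<rho>0(5) by metis
    moreover have "e z \<noteq> 0" using e0(1)[of z] z by blast
    ultimately show ?thesis by (simp add: power_divide)
  qed
  have "(\<lambda>z. W' z / e z) constant_on half_ball x \<rho>"
  proof (rule continuous_finite_range_constant)
    show "connected (half_ball x \<rho>)" by (intro convex_connected convex_half_ball)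
    have "W' holomorphic_on half_ball x \<rho>" "e holomorphic_on half_ball x \<rho>"
      using holomorphic_on_subset[OF W' subh] holomorphic_on_subset[OF ehol] by auto
    then have "(\<lambda>z. W' z / e z) holomorphic_on half_ball x \<rho>"
      by (rule holomorphic_on_divide) (use e0(1) in blast)
    then show "continuous_on (half_ball x \<rho>) (\<lambda>z. W' z / e z)"
      by (rule holomorphic_on_imp_continuous_on)
    have "(\<lambda>z. W' z / e z) ` half_ball x \<rho> \<subseteq> {z. z ^ 3 = c}" using q3 by blast
    then show "finite ((\<lambda>z. W' z / e z) ` half_ball x \<rho>)"
      by (rule finite_subset) (rule finite_nth_roots, simp)
  qed
  then obtain u where u: "\<And>z. z \<in> half_ball x \<rho> \<Longrightarrow> W' z / e z = u"
    unfolding constant_on_def by blast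
  have W'u: "W' z = u * e z" if "z \<in> half_ball x \<rho>" for z
    using u[OF that] e0(1)[of z] that by (auto simp: field_simps)
  obtain z0 where "z0 \<in> half_ball x \<rho>" using half_ball_nonempty[OF \<rho>(1)] by blast
  then have u0: "u \<noteq> 0" using q3 u \<rho>0(2) by force
  obtain E0 where E0: "\<And>z. z \<in> ball (of_real x) \<rho> \<Longrightarrow> (E0 has_field_derivative e z) (at z)"
    using holomorphic_convex_primitive'[OF convex_ball open_ball ehol] at_within_open[OF _ open_ball] by metis
  \<comment> \<open>Averaging a primitive with its reflection keeps the derivative \<open>e\<close>,
    which is symmetric, and makes the result real on the axis.\<close>
  define E where "E z = (E0 z + cnj (E0 (cnj z))) / 2" for z
  have E: "(E has_field_derivative e z) (at z)" if z: "z \<in> ball (of_real x) \<rho>" for z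
  proof -
    have z': "cnj z \<in> ball (of_real x) \<rho>" using z cnj_in_ball by blast
    have "(cnj \<circ> E0 \<circ> cnj has_field_derivative cnj (e (cnj z))) (at z)"
      using has_field_derivative_cnj_cnj[OF E0[OF z']] by simp
    then have "((\<lambda>z. cnj (E0 (cnj z))) has_field_derivative e z) (at z)"
      using e0(2)[OF z] by (simp add: o_def)
    then show ?thesis unfolding E_def
      using DERIV_cdivide[OF DERIV_add[OF E0[OF z]], of _ _ 2] by force
  qed
  have "\<exists>k. \<forall>z\<in>half_ball x \<rho>. W z - u * E z = k"
  proof (rule has_field_derivative_zero_constant[OF convex_half_ball])
    fix z assume z: "z \<in> half_ball x \<rho>"
    have "((\<lambda>z. W z - u * E z) has_field_derivative W' z - u * e z) (at z)"
      using W[of z] E[of z] subh z by (auto intro!: derivative_eq_intros)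
    then show "((\<lambda>z. W z - u * E z) has_field_derivative 0) (at z within half_ball x \<rho>)"
      using W'u[OF z] has_field_derivative_at_within by fastforce
  qed
  then obtain k where k: "\<And>z. z \<in> half_ball x \<rho> \<Longrightarrow> W z - u * E z = k" by blast
  show ?thesis
  proof (rule that[of \<rho> u E e k])
    show "Im (E z) = 0" if "z \<in> ball (complex_of_real x) \<rho>" "Im z = 0" for z
    proof -
      have "cnj z = z" using that(2) by (simp add: complex_eq_iff)
      then show ?thesis by (simp add: E_def)
    qed
    show "W z = u * E z + k" if "z \<in> half_ball x \<rho>" for z
      using k[OF that] by (simp add: algebra_simps)
  qed (use \<rho> sub u0 E e0 in auto)
qed

text \<open>
  The direction of the image of the real axis under W is locally constant, by the previous lemma,
  hence constant along the diameter of the half ball.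
\<close>

lemma half_ball_straight:
  assumes r: "r > 0" and G: "\<And>x. \<bar>x - x0\<bar> < r \<Longrightarrow> real_cube_at G x"
    and W: "\<And>z. z \<in> half_ball x0 r \<Longrightarrow> (W has_field_derivative W' z) (at z)"
    and W': "W' holomorphic_on half_ball x0 r"
    and cube: "\<And>z. z \<in> half_ball x0 r \<Longrightarrow> W' z ^ 3 = G z"
  obtains u d where "norm u = 1"
    "\<And>x. \<bar>x - x0\<bar> < r \<Longrightarrow> ((\<lambda>z. Im (W z / u)) \<longlongrightarrow> d) (at (of_real x) within half_ball x0 r)"
proof -
  let ?H = "half_ball x0 r"
  define I where "I = {x0 - r<..<x0 + r}"
  have I: "x \<in> I \<longleftrightarrow> \<bar>x - x0\<bar> < r" for x by (auto simp: I_def abs_less_iff)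
  have IB: "complex_of_real x \<in> ball (of_real y) s \<longleftrightarrow> \<bar>x - y\<bar> < s" for x y s
  proof -
    have "dist (complex_of_real y) (of_real x) = \<bar>x - y\<bar>"
      by (metis abs_minus_commute dist_of_real dist_real_def)
    then show ?thesis by simp
  qed
  \<comment> \<open>\<open>Ev x u d\<close>: near \<open>x\<close> the boundary image lies on the
    line of direction \<open>u\<close> and offset \<open>d\<close>. It is a relation, since (u, d)
    and (-u, -d) give the same line; one fixed pair is carried along the diameter.\<close>
  define Ev where "Ev x u d \<longleftrightarrow> (\<exists>\<rho>>0. \<forall>y. \<bar>y - x\<bar> < \<rho> \<longrightarrow> y \<in> I \<longrightarrow>
      ((\<lambda>z. Im (W z / u)) \<longlongrightarrow> d) (at (of_real y) within ?H))" for x :: real and u d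
  have loc: "\<exists>\<rho>>0. {x-\<rho><..<x+\<rho>} \<subseteq> I \<and> (\<exists>u d. norm u = 1 \<and> Ev x u d) \<and>
     (\<forall>y1 y2 u d. norm u = 1 \<longrightarrow> \<bar>y1 - x\<bar> < \<rho> \<longrightarrow> \<bar>y2 - x\<bar> < \<rho> \<longrightarrow> Ev y1 u d \<longrightarrow> Ev y2 u d)"
    if x: "x \<in> I" for x
  proof -
    have xr: "\<bar>x - x0\<bar> < r" using x I by blast
    obtain \<rho> u k E e where *: "\<rho> > 0" "ball (of_real x) \<rho> \<subseteq> ball (complex_of_real x0) r" "u \<noteq> 0"
      and E: "\<And>z. z \<in> ball (of_real x) \<rho> \<Longrightarrow> (E has_field_derivative e z) (at z) \<and> e z \<noteq> 0"
      and Er: "\<And>z. z \<in> ball (of_real x) \<rho> \<Longrightarrow> Im z = 0 \<Longrightarrow> Im (E z) = 0"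
      and WE: "\<And>z. z \<in> half_ball x \<rho> \<Longrightarrow> W z = u * E z + k"
      by (rule real_cube_primitive[OF G[OF xr] xr W W' cube]; (assumption | (rule that; assumption)))
    have \<rho>I: "y \<in> I" if "\<bar>y - x\<bar> < \<rho>" for y
      using *(2) that IB I by blast
    have limW: "((\<lambda>z. Im (W z / v)) \<longlongrightarrow> Im ((u * E (of_real y) + k) / v)) (at (of_real y) within ?H)"
      if y: "\<bar>y - x\<bar> < \<rho>" and v: "norm v = 1" for y v
    proof -
      have yB: "complex_of_real y \<in> ball (of_real x) \<rho>" using y IB by blast
      have "isCont E (of_real y)" using E[OF yB] DERIV_isCont by blast
      then have "(E \<longlongrightarrow> E (of_real y)) (at (of_real y) within ?H)"
        using continuous_at_imp_continuous_at_within continuous_within by blast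
      then have "((\<lambda>z. Im ((u * E z + k) / v)) \<longlongrightarrow> Im ((u * E (of_real y) + k) / v)) (at (of_real y) within ?H)"
        using v by (intro tendsto_intros) auto
      moreover have "\<forall>\<^sub>F z in at (of_real y) within ?H. Im ((u * E z + k) / v) = Im (W z / v)"
        unfolding eventually_at_topological
        by (rule exI[of _ "ball (of_real x) \<rho>"]) (use yB WE in auto)
      ultimately show ?thesis by (rule Lim_transform_eventually)
    qed
    have uniq: "Im ((u * E (of_real y) + k) / v) = d"
      if y: "\<bar>y - x\<bar> < \<rho>" and v: "norm v = 1" and ev: "((\<lambda>z. Im (W z / v)) \<longlongrightarrow> d) (at (of_real y) within ?H)" for y v d
    proof -
      have "at (complex_of_real y) within ?H \<noteq> bot"
        using y \<rho>I I IB by (intro real_islimpt_half_ball) auto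
      then show ?thesis using tendsto_unique limW[OF y v] ev by blast
    qed
    have formula: "Im ((u * E (of_real y) + k) / v) = Im (u / v) * Re (E (of_real y)) + Im (k / v)"
      if y: "\<bar>y - x\<bar> < \<rho>" for y v
    proof -
      have "Im (E (of_real y)) = 0" using Er y IB by simp
      then have "E (of_real y) = of_real (Re (E (of_real y)))" by (simp add: complex_eq_iff)
      then have "(u * E (of_real y) + k) / v = of_real (Re (E (of_real y))) * (u / v) + k / v"
        by (metis add_divide_distrib mult.commute times_divide_eq_right)
      then have "Im ((u * E (of_real y) + k) / v) = Im (of_real (Re (E (of_real y))) * (u / v)) + Im (k / v)"
        by (simp only: plus_complex.simps)
      moreover have "Im (of_real a * w) = Im w * a" for a :: real and w by simp
      ultimately show ?thesis by metis
    qed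
    \<comment> \<open>If \<open>u / v\<close> were not real, \<open>Re E\<close> would be constant
      on the axis near \<open>y\<close>; as \<open>Im E\<close> is 0 there, the derivative
      \<open>e\<close> would vanish at \<open>y\<close>.\<close>
    have real_dir: "Im (u / v) = 0" if y: "\<bar>y - x\<bar> < \<rho>" and v: "norm v = 1" and ev: "Ev y v d" for y v d
    proof (rule ccontr)
      assume n0: "Im (u / v) \<noteq> 0"
      obtain s where s: "s > 0" "\<And>y'. \<bar>y' - y\<bar> < s \<Longrightarrow> y' \<in> I \<Longrightarrow>
          ((\<lambda>z. Im (W z / v)) \<longlongrightarrow> d) (at (of_real y') within ?H)"
        using ev unfolding Ev_def by blast
      define t where "t = min s (\<rho> - \<bar>y - x\<bar>)"
      have t: "t > 0" "t \<le> s" "t \<le> \<rho> - \<bar>y - x\<bar>" using s y by (auto simp: t_def)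
      have const: "Re (E (of_real y')) = (d - Im (k / v)) / Im (u / v)" if y': "\<bar>y' - y\<bar> < t" for y'
      proof -
        have y'': "\<bar>y' - x\<bar> < \<rho>" using y' t by linarith
        have "Im (u / v) * Re (E (of_real y')) + Im (k / v) = d"
          using uniq[OF y'' v s(2)] formula[OF y''] \<rho>I[OF y''] y' t by simp
        then show ?thesis using n0 by (simp add: field_simps)
      qed
      have yB: "complex_of_real y \<in> ball (of_real x) \<rho>" using y IB by blast
      have "(complex_of_real has_vector_derivative 1) (at y)"
        unfolding has_vector_derivative_def
        by (auto intro!: derivative_eq_intros simp: scaleR_conv_of_real)
      then have "((\<lambda>t. E (of_real t)) has_vector_derivative e (of_real y)) (at y)"
        using field_vector_diff_chain_at[of of_real 1 y E "e (of_real y)"] E[OF yB]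
        by (simp add: o_def)
      moreover have "((\<lambda>t. E (of_real t)) has_vector_derivative 0) (at y)"
      proof (rule has_vector_derivative_transform_within_open[of "\<lambda>_. E (of_real y)" 0 y "{y - t<..<y + t}"])
        fix y' assume "y' \<in> {y - t<..<y + t}"
        then have y': "\<bar>y' - y\<bar> < t" by (auto simp: abs_less_iff)
        have "Im (E (of_real y')) = 0" "Im (E (of_real y)) = 0"
          using Er y' t y IB by auto
        then show "E (of_real y) = E (of_real y')"
          using const[OF y'] const[of y] t(1) by (simp add: complex_eq_iff)
      qed (use t in auto)
      ultimately have "e (of_real y) = 0" using vector_derivative_unique_at by blast
      then show False using E[OF yB] by blast
    qed
    have trans: "Ev y2 v d" if v: "norm v = 1" and y1: "\<bar>y1 - x\<bar> < \<rho>" and y2: "\<bar>y2 - x\<bar> < \<rho>" and ev: "Ev y1 v d"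
      for y1 y2 v d
    proof -
      have i0: "Im (u / v) = 0" using real_dir[OF y1 v ev] .
      obtain s where "s > 0" "\<And>y'. \<bar>y' - y1\<bar> < s \<Longrightarrow> y' \<in> I \<Longrightarrow>
          ((\<lambda>z. Im (W z / v)) \<longlongrightarrow> d) (at (of_real y') within ?H)"
        using ev unfolding Ev_def by blast
      then have "Im (k / v) = d"
        using uniq[OF y1 v] formula[OF y1, of v] i0 \<rho>I[OF y1] by simp
      then have "((\<lambda>z. Im (W z / v)) \<longlongrightarrow> d) (at (of_real y) within ?H)" if "\<bar>y - x\<bar> < \<rho>" for y
        using limW[OF that v] formula[OF that, of v] i0 by simp
      then show ?thesis unfolding Ev_def
        by (intro exI[of _ "\<rho> - \<bar>y2 - x\<bar>"]) (use y2 in auto)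
    qed
    have ex: "Ev x (u / of_real (norm u)) (Im (k / (u / of_real (norm u))))"
    proof -
      let ?v = "u / of_real (norm u)"
      have v: "norm ?v = 1" using *(3) by (simp add: norm_divide)
      have "u / ?v = of_real (norm u)" using *(3) by simp
      then have i0: "Im (u / ?v) = 0" by (simp only: Im_complex_of_real)
      show ?thesis unfolding Ev_def
        using limW[OF _ v] formula[of _ ?v] i0 *(1) by (intro exI[of _ \<rho>]) auto
    qed
    have v1: "norm (u / of_real (norm u)) = 1" using *(3) by (simp add: norm_divide)
    have "{x-\<rho><..<x+\<rho>} \<subseteq> I"
    proof
      fix y assume "y \<in> {x-\<rho><..<x+\<rho>}"
      then have "\<bar>y - x\<bar> < \<rho>" by (auto simp: abs_less_iff)
      then show "y \<in> I" by (rule \<rho>I)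
    qed
    then show ?thesis using *(1) ex v1 trans by blast
  qed
  have x0: "x0 \<in> I" using r by (simp add: I_def)
  obtain u d where ud: "norm u = 1" "Ev x0 u d" using loc[OF x0] by blast
  have "Ev x u d" if x: "x \<in> I" for x
  proof -
    have "connected I" by (simp add: I_def)
    then have "Ev x0 u d \<longleftrightarrow> Ev x u d"
    proof (rule connected_equivalence_relation[of I x0 x "\<lambda>x y. Ev x u d \<longleftrightarrow> Ev y u d"])
      fix a assume "a \<in> I"
      then obtain \<rho> where \<rho>: "\<rho> > 0" "{a-\<rho><..<a+\<rho>} \<subseteq> I"
        "\<forall>y1 y2 u d. norm u = 1 \<longrightarrow> \<bar>y1 - a\<bar> < \<rho> \<longrightarrow> \<bar>y2 - a\<bar> < \<rho> \<longrightarrow> Ev y1 u d \<longrightarrow> Ev y2 u d"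
        using loc by metis
      have "(Ev a u d \<longleftrightarrow> Ev y u d)" if "y \<in> {a-\<rho><..<a+\<rho>}" for y
      proof -
        have y: "\<bar>y - a\<bar> < \<rho>" using that by (auto simp: abs_less_iff)
        have a: "\<bar>a - a\<bar> < \<rho>" using \<rho>(1) by simp
        show ?thesis using \<rho>(3)[rule_format, OF ud(1) y a] \<rho>(3)[rule_format, OF ud(1) a y] by blast
      qed
      moreover have "openin (top_of_set I) {a-\<rho><..<a+\<rho>}"
        using \<rho>(2) by (auto intro: open_subset)
      moreover have "a \<in> {a-\<rho><..<a+\<rho>}" using \<rho>(1) by simp
      ultimately show "\<exists>T. openin (top_of_set I) T \<and> a \<in> T \<and> (\<forall>x\<in>T. Ev a u d \<longleftrightarrow> Ev x u d)" by blast
    qed (use x x0 in auto)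
    then show ?thesis using ud by blast
  qed
  then have "((\<lambda>z. Im (W z / u)) \<longlongrightarrow> d) (at (of_real x) within ?H)" if "\<bar>x - x0\<bar> < r" for x
    using that I unfolding Ev_def by force
  then show ?thesis using that ud(1) by blast
qed

section \<open>Decay of the differential at a corner\<close>

lemma norm_deriv_le:
  assumes "f holomorphic_on ball z r" "r > 0" "\<And>w. w \<in> ball z r \<Longrightarrow> norm (f w) \<le> B"
  shows "norm (deriv f z) \<le> 2 * B / r"
proof -
  have "norm ((deriv ^^ 1) f z) \<le> fact 1 * B / (r / 2) ^ 1"
  proof (rule Cauchy_inequality)
    \<comment> \<open>Half the radius, because \<open>f\<close> is known only on the open ball and
      Cauchy's estimate wants a closed one; this doubles the bound.\<close>
    show "f holomorphic_on ball z (r / 2)"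
      by (rule holomorphic_on_subset[OF assms(1)]) (use assms(2) in auto)
    show "continuous_on (cball z (r / 2)) f"
      by (rule continuous_on_subset[OF holomorphic_on_imp_continuous_on[OF assms(1)]]) (use assms(2) in auto)
  qed (use assms in \<open>auto simp: dist_norm\<close>)
  then show ?thesis by (simp add: mult.commute)
qed

text \<open>A Cauchy estimate that is invariant under scaling and valid up to the axis. Near the
  axis \<open>W\<close> is first reflected in its straight side, over a disc that stays away from 0.
  The constant is 16 = 2 * 2 / (1/4): the factor of \<open>norm_deriv_le\<close>, a doubling caused
  by subtracting the offset \<open>d\<close>, and the radius \<rho>/4.\<close>

lemma half_ball_deriv_bound:
  assumes \<rho>: "\<rho> > 0" and z: "norm z = \<rho>" "0 < Im z" and s: "half_ball 0 (2 * \<rho>) \<subseteq> half_ball 0 \<delta>"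
    and G: "\<And>x. x \<noteq> 0 \<Longrightarrow> \<bar>x\<bar> < \<delta> \<Longrightarrow> real_cube_at G x" "2 * \<rho> \<le> \<delta>"
    and W: "\<And>z. z \<in> half_ball 0 \<delta> \<Longrightarrow> (W has_field_derivative W' z) (at z)"
    and W': "W' holomorphic_on half_ball 0 \<delta>"
    and cube: "\<And>z. z \<in> half_ball 0 \<delta> \<Longrightarrow> W' z ^ 3 = G z"
    and bd: "\<And>w. w \<in> half_ball 0 (2 * \<rho>) \<Longrightarrow> norm (W w) \<le> \<epsilon>"
  shows "norm (W' z) * \<rho> \<le> 16 * \<epsilon>"
proof -
  have Whol: "W holomorphic_on half_ball 0 \<delta>"
    using W at_within_open[OF _ open_half_ball]
    by (metis field_differentiable_def holomorphic_on_def)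
  have z2: "z \<in> half_ball 0 (2 * \<rho>)" using z \<rho> by auto
  have \<epsilon>: "0 \<le> \<epsilon>" using bd[OF z2] norm_ge_zero order_trans by blast
  have dW: "deriv W z = W' z" using W s z2 DERIV_imp_deriv by blast
  show ?thesis
  \<comment> \<open>Above height \<rho>/4 the disc of radius \<rho>/4 about \<open>z\<close> lies in
    the half plane. Below it, \<open>z\<close> is within \<rho>/4 of its projection
    \<open>x0\<close>, and |x0| > 3\<rho>/4 keeps 0 out of the disc of radius \<rho>/2 about
    \<open>x0\<close>.\<close>
  proof (cases "Im z \<ge> \<rho> / 4")
    case True
    have sub: "ball z (\<rho>/4) \<subseteq> half_ball 0 (2 * \<rho>)"
    proof
      fix w assume w: "w \<in> ball z (\<rho>/4)"
      have "norm w \<le> norm z + norm (w - z)" by (metis add.commute diff_add_cancel norm_triangle_ineq)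
      moreover have "\<bar>Im (w - z)\<bar> \<le> norm (w - z)" by (rule abs_Im_le_cmod)
      ultimately show "w \<in> half_ball 0 (2 * \<rho>)"
        using w z \<rho> True by (auto simp: dist_norm norm_minus_commute)
    qed
    have "norm (deriv W z) \<le> 2 * \<epsilon> / (\<rho>/4)"
    proof (rule norm_deriv_le)
      show "W holomorphic_on ball z (\<rho>/4)"
        by (rule holomorphic_on_subset[OF Whol order_trans[OF sub s]])
      show "norm (W w) \<le> \<epsilon>" if "w \<in> ball z (\<rho>/4)" for w
        by (rule bd[OF subsetD[OF sub that]])
    qed (use \<rho> in simp)
    then show ?thesis using \<rho> \<epsilon> dW by (simp add: field_simps)
  next
    case False
    define x0 where "x0 = Re z"
    have "\<rho> \<le> \<bar>Re z\<bar> + \<bar>Im z\<bar>" using cmod_le[of z] z by simp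
    then have x0: "\<bar>x0\<bar> > 3 * \<rho> / 4" "\<bar>x0\<bar> \<le> \<rho>"
      using False z abs_Re_le_cmod[of z] by (auto simp: x0_def)
    have sub: "half_ball x0 (\<rho>/2) \<subseteq> half_ball 0 (2 * \<rho>)"
    proof
      fix w assume w: "w \<in> half_ball x0 (\<rho>/2)"
      have "norm w \<le> norm (complex_of_real x0) + norm (w - of_real x0)"
        by (metis add.commute diff_add_cancel norm_triangle_ineq)
      then show "w \<in> half_ball 0 (2 * \<rho>)"
        using w x0 \<rho> by (auto simp: dist_norm norm_minus_commute)
    qed
    then have sub': "half_ball x0 (\<rho>/2) \<subseteq> half_ball 0 \<delta>" using s by blast
    have r2: "\<rho>/2 > 0" using \<rho> by simp
    have G': "real_cube_at G x" if "\<bar>x - x0\<bar> < \<rho>/2" for x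
    proof (rule G(1))
      have "\<bar>x0\<bar> \<le> \<bar>x\<bar> + \<bar>x - x0\<bar>" "\<bar>x\<bar> \<le> \<bar>x - x0\<bar> + \<bar>x0\<bar>" by linarith+
      then show "x \<noteq> 0" "\<bar>x\<bar> < \<delta>" using that x0 G(2) \<rho> by linarith+
    qed
    have WA: "(W has_field_derivative W' z) (at z)" "W' z ^ 3 = G z" if "z \<in> half_ball x0 (\<rho>/2)" for z
      using W cube subsetD[OF sub' that] by auto
    obtain u d where u: "norm u = 1" and d:
      "\<And>x. \<bar>x - x0\<bar> < \<rho>/2 \<Longrightarrow> ((\<lambda>z. Im (W z / u)) \<longlongrightarrow> d) (at (of_real x) within half_ball x0 (\<rho>/2))"
      by (rule half_ball_straight[OF r2 G' WA(1) holomorphic_on_subset[OF W' sub'] WA(2)];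
          (assumption | (rule that; assumption)))
    have bdu: "norm (W w / u) \<le> \<epsilon>" if "w \<in> half_ball x0 (\<rho>/2)" for w
      using bd sub that u by (auto simp: norm_divide)
    have nt: "at (complex_of_real x0) within half_ball x0 (\<rho>/2) \<noteq> bot"
      using r2 by (intro real_islimpt_half_ball) auto
    have d\<epsilon>: "\<bar>d\<bar> \<le> \<epsilon>"
    proof -
      have "((\<lambda>z. \<bar>Im (W z / u)\<bar>) \<longlongrightarrow> \<bar>d\<bar>) (at (of_real x0) within half_ball x0 (\<rho>/2))"
        using d[of x0] r2 by (intro tendsto_rabs) auto
      moreover have "\<forall>\<^sub>F z in at (of_real x0) within half_ball x0 (\<rho>/2). \<bar>Im (W z / u)\<bar> \<le> \<epsilon>"
        unfolding eventually_at using bdu abs_Im_le_cmod order_trans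
        by (intro exI[of _ 1] conjI ballI impI zero_less_one) blast
      ultimately show ?thesis by (rule tendsto_upperbound[OF _ _ nt])
    qed
    \<comment> \<open>Rotated by \<open>u\<close> and shifted by \<open>d\<close>, the side becomes
      real. The shift costs at most \<epsilon>, as \<open>d\<close> is a limit of values of
      \<open>Im (W z / u)\<close>.\<close>
    define f where "f w = W w / u - \<i> * of_real d" for w
    have fh: "f holomorphic_on half_ball x0 (\<rho>/2)"
      unfolding f_def using holomorphic_on_subset[OF Whol sub'] u by (intro holomorphic_intros) auto
    have f2: "norm (f w) \<le> 2 * \<epsilon>" if "w \<in> half_ball x0 (\<rho>/2)" for w
      using norm_triangle_ineq4[of "W w / u" "\<i> * of_real d"] bdu[OF that] d\<epsilon>
      by (simp add: f_def norm_mult)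
    have flim: "((\<lambda>z. Im (f z)) \<longlongrightarrow> 0) (at x within half_ball x0 (\<rho>/2))"
      if "x \<in> ball (complex_of_real x0) (\<rho>/2)" "Im x = 0" for x
    proof -
      have x: "x = of_real (Re x)" using that(2) by (simp add: complex_eq_iff)
      have "\<bar>Re x - x0\<bar> \<le> norm (x - of_real x0)" using abs_Re_le_cmod[of "x - of_real x0"] by simp
      then have "\<bar>Re x - x0\<bar> < \<rho>/2" using that(1) by (simp add: dist_norm norm_minus_commute)
      then have "((\<lambda>z. Im (W z / u)) \<longlongrightarrow> d) (at x within half_ball x0 (\<rho>/2))" using d x by metis
      then have "((\<lambda>z. Im (W z / u) - d) \<longlongrightarrow> d - d) (at x within half_ball x0 (\<rho>/2))"
        by (intro tendsto_intros)
      then show ?thesis by (simp add: f_def)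
    qed
    obtain F where F: "F holomorphic_on ball (of_real x0) (\<rho>/2)"
      "\<And>z. z \<in> half_ball x0 (\<rho>/2) \<Longrightarrow> F z = f z"
      "\<And>z. z \<in> ball (of_real x0) (\<rho>/2) \<Longrightarrow> F (cnj z) = cnj (F z)"
      using bounded_reflection[OF fh r2 f2 flim] by blast
    have FB: "norm (F w) \<le> 2 * \<epsilon>" if w: "w \<in> ball (of_real x0) (\<rho>/2)" for w
      by (rule reflected_norm_bound[OF F(1) _ _ w]) (simp add: F(3), use F(2) f2 in metis)
    have dz: "dist (complex_of_real x0) z < \<rho>/4"
    proof -
      have "complex_of_real x0 - z = - \<i> * of_real (Im z)" by (simp add: complex_eq_iff x0_def)
      then have "norm (complex_of_real x0 - z) = \<bar>Im z\<bar>" by (simp add: norm_mult)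
      then show ?thesis using False z by (simp add: dist_norm)
    qed
    have subz: "ball z (\<rho>/4) \<subseteq> ball (of_real x0) (\<rho>/2)"
    proof
      fix w assume "w \<in> ball z (\<rho>/4)"
      then show "w \<in> ball (of_real x0) (\<rho>/2)"
        using dz dist_triangle[of "complex_of_real x0" w z] by auto
    qed
    have zH: "z \<in> half_ball x0 (\<rho>/2)" using dz z \<rho> by auto
    have "norm (deriv F z) \<le> 2 * (2 * \<epsilon>) / (\<rho>/4)"
    proof (rule norm_deriv_le)
      show "F holomorphic_on ball z (\<rho>/4)"
        by (rule holomorphic_on_subset[OF F(1) subz])
      show "norm (F w) \<le> 2 * \<epsilon>" if "w \<in> ball z (\<rho>/4)" for w
        by (rule FB[OF subsetD[OF subz that]])
    qed (use \<rho> in simp)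
    moreover have "deriv F z = W' z / u"
    proof (rule DERIV_imp_deriv)
      have "(f has_field_derivative W' z / u) (at z)"
        unfolding f_def using W[of z] zH sub' u by (auto intro!: derivative_eq_intros)
      then show "(F has_field_derivative W' z / u) (at z)"
        by (rule has_field_derivative_transform_within_open[OF _ open_half_ball zH]) (use F(2) in simp)
    qed
    ultimately show ?thesis using \<rho> u by (simp add: norm_divide field_simps)
  qed
qed

text \<open>The derivative bound controls |W' z| |z| by the size of \<open>W\<close> at the scale of
  \<open>z\<close>, so this product tends to 0 with \<open>W\<close>, and its cube is |G z * z^3|.
  The angle at the corner never enters.\<close>

lemma cubic_decay:
  assumes \<delta>: "\<delta> > 0"
    and G: "\<And>x. x \<noteq> 0 \<Longrightarrow> \<bar>x\<bar> < \<delta> \<Longrightarrow> real_cube_at G x"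
    and W: "\<And>z. z \<in> half_ball 0 \<delta> \<Longrightarrow> (W has_field_derivative W' z) (at z)"
    and W': "W' holomorphic_on half_ball 0 \<delta>"
    and cube: "\<And>z. z \<in> half_ball 0 \<delta> \<Longrightarrow> W' z ^ 3 = G z"
    and lim: "(W \<longlongrightarrow> 0) (at 0 within half_ball 0 \<delta>)"
  shows "((\<lambda>z. G z * z ^ 3) \<longlongrightarrow> 0) (at 0 within half_ball 0 \<delta>)"
proof -
  have "((\<lambda>z. W' z * z) \<longlongrightarrow> 0) (at 0 within half_ball 0 \<delta>)"
  proof (rule tendstoI)
    fix e :: real assume e: "e > 0"
    have "\<forall>\<^sub>F z in at (of_real 0) within half_ball 0 \<delta>. norm (W z) < e / 32"
      using tendstoD[OF lim, of "e/32"] e by simp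
    then obtain s where s: "0 < s" "s \<le> \<delta>" "\<And>z. z \<in> half_ball 0 s \<Longrightarrow> norm (W z) < e / 32"
      using eventually_in_half_ball_shrink \<delta> by blast
    have "dist (W' z * z) 0 < e" if z: "z \<in> half_ball 0 \<delta>" "norm z < s / 2" for z
    proof -
      have z0: "norm z > 0" "0 < Im z" using z by auto
      have sub: "half_ball 0 (2 * norm z) \<subseteq> half_ball 0 s" using z by auto
      have sub': "half_ball 0 (2 * norm z) \<subseteq> half_ball 0 \<delta>" using z s by auto
      have bdz: "norm (W w) \<le> e / 32" if "w \<in> half_ball 0 (2 * norm z)" for w
        using s(3)[of w] sub that by (meson less_imp_le subsetD)
      have dd: "2 * norm z \<le> \<delta>" using z s by simp
      \<comment> \<open>The 32 was chosen so that the constant 16 leaves \<open>e / 2\<close>, below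
        \<open>e\<close>.\<close>
      have "norm (W' z) * norm z \<le> 16 * (e / 32)"
        by (rule half_ball_deriv_bound[OF z0(1) refl z0(2) sub' G dd W W' cube bdz])
      then show ?thesis using e by (simp add: norm_mult)
    qed
    then show "\<forall>\<^sub>F z in at 0 within half_ball 0 \<delta>. dist (W' z * z) 0 < e"
      unfolding eventually_at by (intro exI[of _ "s/2"]) (use s in \<open>auto simp: dist_norm\<close>)
  qed
  then have "((\<lambda>z. (W' z * z) ^ 3) \<longlongrightarrow> 0 ^ 3) (at 0 within half_ball 0 \<delta>)"
    by (intro tendsto_intros)
  then have "((\<lambda>z. (W' z * z) ^ 3) \<longlongrightarrow> 0) (at 0 within half_ball 0 \<delta>)" by simp
  moreover have "\<forall>\<^sub>F z in at 0 within half_ball 0 \<delta>. (W' z * z) ^ 3 = G z * z ^ 3"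
    unfolding eventually_at by (rule exI[of _ 1]) (use cube in \<open>auto simp: power_mult_distrib\<close>)
  ultimately show ?thesis by (rule Lim_transform_eventually)
qed

section \<open>Inversion and the maximum principle\<close>

lemma Im_minus_inverse_pos: "0 < Im z \<Longrightarrow> 0 < Im (- 1 / z)"
  by (simp add: Im_divide field_simps sum_power2_gt_zero_iff)

text \<open>The map z -> -1/z preserves the upper half plane and the real axis and pulls dz back to
  dz/z^2. So the one-form with coefficient \<open>e\<close> acquires the factor z^-2 and the cubic
  differential the factor z^-6.\<close>

lemma real_cube_at_inversion:
  assumes "real_cube_at G x" "x \<noteq> 0"
  shows "real_cube_at (\<lambda>z. G (- 1 / z) / z ^ 6) (- 1 / x)"
proof -
  obtain \<rho> c e where \<rho>: "\<rho> > 0" "c \<noteq> 0" "e holomorphic_on ball (of_real x) \<rho>"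
    "\<And>z. z \<in> ball (of_real x) \<rho> \<Longrightarrow> e z \<noteq> 0 \<and> e (cnj z) = cnj (e z)"
    "\<And>z. z \<in> half_ball x \<rho> \<Longrightarrow> G z = c * e z ^ 3"
    using assms(1) unfolding real_cube_at_def by blast
  have "open ((- {0}) \<inter> (\<lambda>z::complex. - 1 / z) -` ball (of_real x) \<rho>)"
    by (rule continuous_open_preimage) (auto intro!: continuous_intros)
  moreover have "complex_of_real (- 1 / x) \<in> (- {0}) \<inter> (\<lambda>z::complex. - 1 / z) -` ball (of_real x) \<rho>"
    using assms(2) \<rho>(1) by simp
  ultimately obtain s where s: "s > 0"
    "ball (complex_of_real (- 1 / x)) s \<subseteq> (- {0}) \<inter> (\<lambda>z::complex. - 1 / z) -` ball (of_real x) \<rho>"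
    using openE by blast
  have inB: "- 1 / z \<in> ball (of_real x) \<rho>" "z \<noteq> 0" if "z \<in> ball (complex_of_real (- 1 / x)) s" for z
    using s(2) that by auto
  show ?thesis unfolding real_cube_at_def
  proof (intro exI[of _ s] exI[of _ c] exI[of _ "\<lambda>z. e (- 1 / z) / z ^ 2"] conjI ballI)
    have "(e \<circ> (\<lambda>z. - 1 / z)) holomorphic_on ball (complex_of_real (- 1 / x)) s"
    proof (rule holomorphic_on_compose_gen[OF _ \<rho>(3)])
      show "(\<lambda>z. - 1 / z) holomorphic_on ball (complex_of_real (- 1 / x)) s"
        by (intro holomorphic_intros) (rule inB(2))
    qed (use inB(1) in blast)
    then have "(\<lambda>z. e (- 1 / z)) holomorphic_on ball (complex_of_real (- 1 / x)) s"
      by (simp only: o_def)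
    moreover have "(\<lambda>z. z ^ 2) holomorphic_on ball (complex_of_real (- 1 / x)) s"
      by (intro holomorphic_intros)
    ultimately show "(\<lambda>z. e (- 1 / z) / z ^ 2) holomorphic_on ball (of_real (- 1 / x)) s"
      by (rule holomorphic_on_divide) (use inB(2) in simp)
    show "e (- 1 / cnj z) / (cnj z) ^ 2 = cnj (e (- 1 / z) / z ^ 2)"
      if "z \<in> ball (complex_of_real (- 1 / x)) s" for z
    proof -
      have "e (cnj (- 1 / z)) = cnj (e (- 1 / z))" using \<rho>(4) inB(1)[OF that] by blast
      then show ?thesis by simp
    qed
    show "G (- 1 / z) / z ^ 6 = c * (e (- 1 / z) / z ^ 2) ^ 3" if "z \<in> half_ball (- 1 / x) s" for z
    proof -
      have "- 1 / z \<in> half_ball x \<rho>" using that inB(1)[of z] Im_minus_inverse_pos by blast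
      then show ?thesis using \<rho>(5) by (simp add: power_divide flip: power_mult)
    qed
  qed (use s \<rho> inB in auto)
qed

text \<open>The constant \<open>c\<close> need not be real, so only the modulus of the extension is
  symmetric under reflection; this suffices for a maximum principle.\<close>

lemma real_cube_extension:
  assumes "real_cube_at G x"
  obtains \<rho> k where "\<rho> > 0" "k holomorphic_on ball (of_real x) \<rho>"
    "\<And>w. w \<in> ball (of_real x) \<rho> \<Longrightarrow> norm (k (cnj w)) = norm (k w)"
    "\<And>w. w \<in> half_ball x \<rho> \<Longrightarrow> k w = G w * w ^ 3"
proof -
  obtain \<rho> c e where \<rho>: "\<rho> > 0" "c \<noteq> 0" "e holomorphic_on ball (of_real x) \<rho>"
    "\<And>z. z \<in> ball (of_real x) \<rho> \<Longrightarrow> e z \<noteq> 0 \<and> e (cnj z) = cnj (e z)"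
    "\<And>z. z \<in> half_ball x \<rho> \<Longrightarrow> G z = c * e z ^ 3"
    using assms(1) unfolding real_cube_at_def by blast
  show ?thesis
    by (rule that[of \<rho> "\<lambda>w. c * e w ^ 3 * w ^ 3"])
       (use \<rho> in \<open>auto intro!: holomorphic_intros simp: norm_mult norm_power\<close>)
qed

text \<open>
  The norm of G z^3 is the flat length of the field z d/dz, tangent to the boundary, to the third
  power. It satisfies the maximum principle up to the real axis by reflection, so it cannot
  tend to zero at both ends.
\<close>

lemma no_flat_half_plane:
  assumes G: "G holomorphic_on {z. 0 < Im z}"
    and bdry: "\<And>x. x \<noteq> 0 \<Longrightarrow> real_cube_at G x"
    and zero: "\<And>e. e > 0 \<Longrightarrow> \<exists>d>0. \<forall>z. 0 < Im z \<longrightarrow> norm z < d \<longrightarrow> norm (G z * z ^ 3) < e"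
    and infty: "\<And>e. e > 0 \<Longrightarrow> \<exists>R>0. \<forall>z. 0 < Im z \<longrightarrow> norm z > R \<longrightarrow> norm (G z * z ^ 3) < e"
    and z0: "0 < Im z0" "G z0 \<noteq> 0"
  shows False
proof -
  let ?U = "{z. 0 < Im z}"
  define h where "h z = G z * z ^ 3" for z
  have hhol: "h holomorphic_on ?U" unfolding h_def by (intro holomorphic_intros G)
  have openU: "open ?U" by (rule open_halfspace_Im_gt)
  define \<mu> where "\<mu> = norm (h z0)"
  have \<mu>: "\<mu> > 0" using z0 by (auto simp: \<mu>_def h_def)
  obtain d where d: "d > 0" "\<And>z. 0 < Im z \<Longrightarrow> norm z < d \<Longrightarrow> norm (h z) < \<mu>"
    using zero[OF \<mu>] unfolding h_def by blast
  obtain R where R: "R > 0" "\<And>z. 0 < Im z \<Longrightarrow> norm z > R \<Longrightarrow> norm (h z) < \<mu>"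
    using infty[OF \<mu>] unfolding h_def by blast
  have not_const: False if "\<And>z. 0 < Im z \<Longrightarrow> h z = c" for c
  proof -
    have "norm (h (\<i> * of_real (d / 2))) < \<mu>" using d(1) by (intro d(2)) (auto simp: norm_mult)
    moreover have "h (\<i> * of_real (d / 2)) = h z0" using that[OF z0(1)] that[of "\<i> * of_real (d / 2)"] d(1) by simp
    ultimately show False by (simp add: \<mu>_def)
  qed
  \<comment> \<open>\<open>m\<close> extends |h| to the punctured axis. Defining it as a limit
    avoids a choice among the local extensions \<open>k\<close>.\<close>
  define m where "m z = Lim (at z within ?U) (\<lambda>w. norm (h w))" for z
  have mU: "m z = norm (h z)" if "0 < Im z" for z
  proof -
    have zU: "z \<in> ?U" using that by simp
    have "(h \<longlongrightarrow> h z) (at z within ?U)"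
      by (rule holomorphic_tendsto_within[OF hhol openU zU])
    then have "((\<lambda>w. norm (h w)) \<longlongrightarrow> norm (h z)) (at z within ?U)" by (rule tendsto_norm)
    moreover have "at z within ?U \<noteq> bot" using at_within_open[OF zU openU] by simp
    ultimately show ?thesis unfolding m_def by (intro tendsto_Lim) auto
  qed
  have loc: "\<exists>\<rho>>0. \<exists>k. k holomorphic_on ball (of_real x) \<rho> \<and>
      (\<forall>w\<in>ball (of_real x) \<rho>. norm (k (cnj w)) = norm (k w)) \<and> (\<forall>w\<in>half_ball x \<rho>. k w = h w) \<and>
      (\<forall>w\<in>ball (of_real x) \<rho>. 0 \<le> Im w \<longrightarrow> m w = norm (k w))" if xn: "x \<noteq> 0" for x
  proof -
    obtain \<rho> k where k: "\<rho> > 0" "k holomorphic_on ball (of_real x) \<rho>"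
      "\<And>w. w \<in> ball (of_real x) \<rho> \<Longrightarrow> norm (k (cnj w)) = norm (k w)"
      "\<And>w. w \<in> half_ball x \<rho> \<Longrightarrow> k w = h w"
      unfolding h_def using real_cube_extension[OF bdry[OF xn]] by metis
    have "m w = norm (k w)" if w: "w \<in> ball (of_real x) \<rho>" "0 \<le> Im w" for w
    proof (cases "Im w = 0")
      case True
      have "(k \<longlongrightarrow> k w) (at w within ?U)"
        by (rule holomorphic_tendsto_within[OF k(2) open_ball w(1)])
      then have "((\<lambda>w. norm (k w)) \<longlongrightarrow> norm (k w)) (at w within ?U)" by (rule tendsto_norm)
      moreover have "\<forall>\<^sub>F z in at w within ?U. norm (k z) = norm (h z)"
        unfolding eventually_at_topological
        by (rule exI[of _ "ball (of_real x) \<rho>"]) (use w k(4) in auto)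
      ultimately have "((\<lambda>w. norm (h w)) \<longlongrightarrow> norm (k w)) (at w within ?U)" by (rule Lim_transform_eventually)
      moreover have "at w within ?U \<noteq> bot"
      proof -
        have "at w within half_ball x \<rho> \<le> at w within ?U" by (rule at_le) auto
        then show ?thesis using real_islimpt_half_ball[OF w(1) True] bot_unique by metis
      qed
      ultimately show ?thesis unfolding m_def by (intro tendsto_Lim) auto
    next
      case False then show ?thesis using mU[of w] k(4)[of w] w by auto
    qed
    then show ?thesis using k by blast
  qed
  \<comment> \<open>Off this half annulus |h| is below its value \<mu> at \<open>z0\<close>, which
    lies in \<open>K\<close>; so the maximum of \<open>m\<close> on \<open>K\<close> bounds |h| on
    the whole half plane.\<close>
  define K where "K = {z. 0 \<le> Im z} \<inter> (cball 0 R - ball 0 d)"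
  have cK: "compact K" unfolding K_def
    by (intro closed_Int_compact closed_halfspace_Im_ge compact_diff compact_cball open_ball)
  have z0K: "z0 \<in> K"
  proof -
    have "\<not> norm z0 < d" "\<not> norm z0 > R" using d(2)[OF z0(1)] R(2)[OF z0(1)] by (auto simp: \<mu>_def)
    then show ?thesis using z0(1) by (auto simp: K_def)
  qed
  have "continuous_on K m"
    unfolding continuous_on_eq_continuous_within
  proof
    fix z assume z: "z \<in> K"
    then consider "0 < Im z" | "Im z = 0" "z \<noteq> 0" using d(1) by (force simp: K_def)
    then show "continuous (at z within K) m"
    proof cases
      case 1
      then have zU: "z \<in> ?U" by simp
      have "isCont h z"
        using hhol zU openU continuous_on_eq_continuous_at holomorphic_on_imp_continuous_on by blast
      then have "continuous (at z within K) (\<lambda>w. norm (h w))"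
        by (rule continuous_norm[OF continuous_at_imp_continuous_at_within])
      moreover obtain r where "r > 0" "ball z r \<subseteq> ?U" using openU zU openE by blast
      ultimately show ?thesis
        by (rule_tac continuous_transform_within[of z K "\<lambda>w. norm (h w)" r m]) (use z mU in \<open>auto simp: dist_commute subset_iff\<close>)
    next
      case 2
      then obtain x where x: "z = of_real x" "x \<noteq> 0" by (metis complex_is_Real_iff of_real_0 Reals_cases)
      obtain \<rho> k where k: "\<rho> > 0" "k holomorphic_on ball (of_real x) \<rho>"
        "\<And>w. w \<in> ball (of_real x) \<rho> \<Longrightarrow> 0 \<le> Im w \<Longrightarrow> m w = norm (k w)" using loc[OF x(2)] by blast
      have "z \<in> ball (of_real x) \<rho>" using x k(1) by simp
      then have "isCont k z" using k(2) by (meson continuous_on_eq_continuous_at holomorphic_on_imp_continuous_on open_ball)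
      then have "continuous (at z within K) (\<lambda>w. norm (k w))"
        by (rule continuous_norm[OF continuous_at_imp_continuous_at_within])
      then show ?thesis
        by (rule continuous_transform_within[of z K "\<lambda>w. norm (k w)" \<rho> m]) (use k x z in \<open>auto simp: K_def dist_commute\<close>)
    qed
  qed
  then obtain p where p: "p \<in> K" "\<And>z. z \<in> K \<Longrightarrow> m z \<le> m p"
    using continuous_attains_sup[OF cK] z0K by blast
  have M: "norm (h z) \<le> m p" if "0 < Im z" for z
  proof (cases "z \<in> K")
    case True then show ?thesis using p(2) mU that by metis
  next
    case False
    then have "norm z < d \<or> norm z > R" using that by (auto simp: K_def)
    then have "norm (h z) < \<mu>" using d(2) R(2) that by blast
    also have "\<mu> \<le> m p" using p(2)[OF z0K] mU[OF z0(1)] by (simp add: \<mu>_def)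
    finally show ?thesis by simp
  qed
  have connU: "connected ?U" by (intro convex_connected convex_halfspace_Im_gt)
  consider "0 < Im p" | "Im p = 0" "p \<noteq> 0" using p(1) d(1) by (force simp: K_def)
  then show False
  proof cases
    case 1
    have "h constant_on ?U"
      by (rule maximum_modulus_principle[OF hhol openU connU openU subset_refl, of p])
         (use 1 M mU in auto)
    then show False using not_const unfolding constant_on_def by blast
  next
    case 2
    then obtain x where x: "p = of_real x" "x \<noteq> 0" by (metis complex_is_Real_iff of_real_0 Reals_cases)
    obtain \<rho> k where k: "\<rho> > 0" "k holomorphic_on ball (of_real x) \<rho>"
        "\<And>w. w \<in> ball (of_real x) \<rho> \<Longrightarrow> norm (k (cnj w)) = norm (k w)"
        "\<And>w. w \<in> half_ball x \<rho> \<Longrightarrow> k w = h w"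
        "\<And>w. w \<in> ball (of_real x) \<rho> \<Longrightarrow> 0 \<le> Im w \<Longrightarrow> m w = norm (k w)" using loc[OF x(2)] by blast
    have pB: "p \<in> ball (of_real x) \<rho>" using x k(1) by simp
    have kp: "m p = norm (k p)" using k(5)[OF pB] 2 by simp
    have up: "norm (k w) \<le> m p" if w: "w \<in> half_ball x \<rho>" for w
      using k(4)[OF w] M[of w] w by simp
    \<comment> \<open>After reflection, a maximum on the axis is an interior maximum of |k|.\<close>
    have bound: "norm (k w) \<le> norm (k p)" if w: "w \<in> ball (of_real x) \<rho>" for w
      using reflected_norm_bound[OF k(2,3) up w] kp by simp
    have "k constant_on ball (of_real x) \<rho>"
      by (rule maximum_modulus_principle[OF k(2) open_ball connected_ball open_ball subset_refl pB bound])
    then obtain c where c: "\<And>w. w \<in> ball (of_real x) \<rho> \<Longrightarrow> k w = c" unfolding constant_on_def by blast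
    have "h z = c" if "0 < Im z" for z
    proof (rule analytic_continuation_open[where s = "half_ball x \<rho>" and s' = ?U and f = h and g = "\<lambda>_. c"])
      show "half_ball x \<rho> \<noteq> {}" by (rule half_ball_nonempty[OF k(1)])
      show "h w = c" if "w \<in> half_ball x \<rho>" for w using k(4)[OF that] c that by simp
    qed (use that open_half_ball openU connU hhol in \<open>auto intro: holomorphic_intros\<close>)
    then show False using not_const by blast
  qed
qed

section \<open>Flat coordinates near a corner\<close>

text \<open>
  The substitution z = a + t^3 makes the cube root of P(z) dz^3 single-valued near a zero a of any
  order, with holomorphic primitive V in t.
\<close>

lemma cube_root_primitive:
  fixes P :: "complex poly"
  assumes P: "P \<noteq> 0"
  obtains \<eta> V v where "\<eta> > 0" "V 0 = 0"
    "\<And>t. t \<in> ball 0 \<eta> \<Longrightarrow> (V has_field_derivative v t) (at t)" "v holomorphic_on ball 0 \<eta>"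
    "\<And>t. t \<in> ball 0 \<eta> \<Longrightarrow> v t ^ 3 = poly P (a + t ^ 3) * (3 * t ^ 2) ^ 3"
proof -
  define k where "k = order a P"
  obtain Q where Q: "P = [:- a, 1:] ^ k * Q" "\<not> [:- a, 1:] dvd Q"
    using order_decomp[OF P] unfolding k_def by blast
  have Qa: "poly Q a \<noteq> 0" using Q(2) by (simp add: poly_eq_0_iff_dvd)
  have "isCont (poly Q) a" by (rule poly_isCont)
  then obtain r0 where r0: "r0 > 0" "\<And>z. dist a z < r0 \<Longrightarrow> poly Q z \<noteq> 0"
    using continuous_at_avoid[of a "poly Q" 0] Qa by (auto simp: dist_commute)
  have "(\<lambda>z. poly Q z) holomorphic_on ball a r0" by (intro holomorphic_intros)
  then have Qh: "poly Q holomorphic_on ball a r0" by simp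
  obtain g where g: "g holomorphic_on ball a r0" "\<And>z. z \<in> ball a r0 \<Longrightarrow> exp (g z) = poly Q z"
    using holomorphic_logarithm_exists[OF convex_ball open_ball Qh, of a] r0 by auto
  \<comment> \<open>For |t| < 1 one has |t|^3 \<le> |t|, so a + t^3 stays in the disc where the
    logarithm of \<open>Q\<close> exists.\<close>
  define \<eta> where "\<eta> = min 1 r0"
  have \<eta>: "\<eta> > 0" using r0 by (simp add: \<eta>_def)
  have inB: "a + t ^ 3 \<in> ball a r0" if "t \<in> ball 0 \<eta>" for t
  proof -
    have t: "norm t < 1" "norm t < r0" using that by (auto simp: \<eta>_def)
    have "norm t ^ 3 \<le> norm t ^ 1" using t by (intro power_decreasing) auto
    then show ?thesis using t by (simp add: dist_norm norm_power)
  qed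
  \<comment> \<open>P(a + t^3) (3 t^2)^3 = 27 t^(3k + 6) Q(a + t^3): the exponent is divisible by 3
    whatever the order \<open>k\<close>, and \<open>exp (g z / 3)\<close> is a cube root of
    \<open>poly Q z\<close>.\<close>
  define v where "v t = 3 * t ^ (k + 2) * exp (g (a + t ^ 3) / 3)" for t
  have "(g \<circ> (\<lambda>t. a + t ^ 3)) holomorphic_on ball 0 \<eta>"
    by (rule holomorphic_on_compose_gen[OF _ g(1)]) (use inB in \<open>auto intro!: holomorphic_intros\<close>)
  then have "(\<lambda>t. g (a + t ^ 3)) holomorphic_on ball 0 \<eta>" by (simp only: o_def)
  then have v: "v holomorphic_on ball 0 \<eta>" unfolding v_def by (intro holomorphic_intros) auto
  obtain V0 where V0: "\<And>t. t \<in> ball 0 \<eta> \<Longrightarrow> (V0 has_field_derivative v t) (at t)"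
    using holomorphic_convex_primitive'[OF convex_ball open_ball v] at_within_open[OF _ open_ball] by metis
  show ?thesis
  proof (rule that[of \<eta> "\<lambda>t. V0 t - V0 0" v])
    show "((\<lambda>t. V0 t - V0 0) has_field_derivative v t) (at t)" if "t \<in> ball 0 \<eta>" for t
      using V0[OF that] by (auto intro!: derivative_eq_intros)
    show "v t ^ 3 = poly P (a + t ^ 3) * (3 * t ^ 2) ^ 3" if t: "t \<in> ball 0 \<eta>" for t
    proof -
      have "exp (g (a + t ^ 3) / 3) ^ 3 = exp (g (a + t ^ 3))"
        by (simp flip: exp_of_nat_mult)
      also have "\<dots> = poly Q (a + t ^ 3)" using g(2)[OF inB[OF t]] .
      finally have e: "exp (g (a + t ^ 3) / 3) ^ 3 = poly Q (a + t ^ 3)" .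
      have "poly P (a + t ^ 3) = (t ^ 3) ^ k * poly Q (a + t ^ 3)"
        unfolding Q(1) by (simp add: poly_power)
      then show ?thesis unfolding v_def
        by (simp add: e power_mult_distrib) (simp add: power_add mult.commute flip: power_mult)
    qed
  qed (use \<eta> v in auto)
qed

text \<open>F - a does not vanish on the convex half ball, so it has a holomorphic cube root
  \<open>t\<close> there, and \<open>W\<close> is \<open>V\<close> composed with \<open>t\<close>.
  It tends to \<open>V 0\<close> = 0 together with \<open>t\<close>, however \<open>F\<close>
  approaches \<open>a\<close>.\<close>

lemma cubic_pullback_primitive:
  fixes P :: "complex poly"
  assumes P: "P \<noteq> 0" and r: "r > 0" and F: "F holomorphic_on half_ball 0 r"
    and Fa: "\<And>z. z \<in> half_ball 0 r \<Longrightarrow> F z \<noteq> a"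
    and lim: "(F \<longlongrightarrow> a) (at 0 within half_ball 0 r)"
  obtains \<delta> W W' where "0 < \<delta>" "\<delta> \<le> r"
    "\<And>z. z \<in> half_ball 0 \<delta> \<Longrightarrow> (W has_field_derivative W' z) (at z)"
    "W' holomorphic_on half_ball 0 \<delta>"
    "\<And>z. z \<in> half_ball 0 \<delta> \<Longrightarrow> W' z ^ 3 = poly P (F z) * deriv F z ^ 3"
    "(W \<longlongrightarrow> 0) (at 0 within half_ball 0 \<delta>)"
proof -
  obtain \<eta> V v where V: "\<eta> > 0" "V 0 = 0"
    "\<And>t. t \<in> ball 0 \<eta> \<Longrightarrow> (V has_field_derivative v t) (at t)" "v holomorphic_on ball 0 \<eta>"
    "\<And>t. t \<in> ball 0 \<eta> \<Longrightarrow> v t ^ 3 = poly P (a + t ^ 3) * (3 * t ^ 2) ^ 3"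
    using cube_root_primitive[OF P, of a] by metis
  have "\<forall>\<^sub>F z in at (of_real 0) within half_ball 0 r. dist (F z) a < \<eta> ^ 3"
    using tendstoD[OF lim, of "\<eta> ^ 3"] V(1) by simp
  then obtain \<delta> where \<delta>: "0 < \<delta>" "\<delta> \<le> r" "\<And>z. z \<in> half_ball 0 \<delta> \<Longrightarrow> dist (F z) a < \<eta> ^ 3"
    using eventually_in_half_ball_shrink r by blast
  let ?N = "half_ball 0 \<delta>"
  have sub: "?N \<subseteq> half_ball 0 r" by (rule half_ball_mono[OF \<delta>(2)])
  have FN: "F holomorphic_on ?N" by (rule holomorphic_on_subset[OF F sub])
  have "(\<lambda>z. F z - a) holomorphic_on ?N" by (intro holomorphic_intros FN)
  moreover have "F z - a \<noteq> 0" if "z \<in> ?N" for z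
    using Fa[OF subsetD[OF sub that]] by simp
  moreover obtain z1 where "z1 \<in> ?N" using half_ball_nonempty[OF \<delta>(1)] by blast
  ultimately obtain L where L: "L holomorphic_on ?N" "\<And>z. z \<in> ?N \<Longrightarrow> exp (L z) = F z - a"
    using holomorphic_logarithm_exists[OF convex_half_ball open_half_ball] by blast
  define t where "t z = exp (L z / 3)" for z
  have th: "t holomorphic_on ?N" unfolding t_def by (intro holomorphic_intros L(1)) auto
  have t3: "t z ^ 3 = F z - a" if "z \<in> ?N" for z
  proof -
    have "t z ^ 3 = exp (L z)" unfolding t_def by (simp flip: exp_of_nat_mult)
    then show ?thesis using L(2)[OF that] by simp
  qed
  have small: "norm (t z) < e" if "z \<in> ?N" "dist (F z) a < e ^ 3" "e > 0" for z e
  proof -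
    have "norm (t z) ^ 3 < e ^ 3" using t3[OF that(1)] that(2) by (simp add: dist_norm flip: norm_power)
    then show ?thesis by (rule power_less_imp_less_base) (use that(3) in simp)
  qed
  have tB: "t z \<in> ball 0 \<eta>" if "z \<in> ?N" for z using small[OF that \<delta>(3)[OF that] V(1)] by simp
  have dt: "(t has_field_derivative deriv t z) (at z)" if "z \<in> ?N" for z
    by (rule holomorphic_derivI[OF th open_half_ball that])
  have dF: "deriv F z = 3 * t z ^ 2 * deriv t z" if z: "z \<in> ?N" for z
  proof (rule DERIV_imp_deriv)
    have "((\<lambda>z. a + t z ^ 3) has_field_derivative 3 * t z ^ 2 * deriv t z) (at z)"
      using dt[OF z] by (auto intro!: derivative_eq_intros simp: numeral_eq_Suc)
    then show "(F has_field_derivative 3 * t z ^ 2 * deriv t z) (at z)"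
      by (rule has_field_derivative_transform_within_open[OF _ open_half_ball z]) (use t3 in simp)
  qed
  show ?thesis
  proof (rule that[of \<delta> "\<lambda>z. V (t z)" "\<lambda>z. v (t z) * deriv t z"])
    show "((\<lambda>z. V (t z)) has_field_derivative v (t z) * deriv t z) (at z)" if "z \<in> ?N" for z
      by (rule DERIV_chain2[OF V(3)[OF tB[OF that]] dt[OF that]])
    have "(v \<circ> t) holomorphic_on ?N"
      by (rule holomorphic_on_compose_gen[OF th V(4)]) (use tB in blast)
    then have "(\<lambda>z. v (t z)) holomorphic_on ?N" by (simp only: o_def)
    then show "(\<lambda>z. v (t z) * deriv t z) holomorphic_on ?N"
      by (intro holomorphic_on_mult holomorphic_deriv[OF th open_half_ball])
    show "(v (t z) * deriv t z) ^ 3 = poly P (F z) * deriv F z ^ 3" if z: "z \<in> ?N" for z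
    proof -
      have "v (t z) ^ 3 = poly P (F z) * (3 * t z ^ 2) ^ 3"
        using V(5)[OF tB[OF z]] t3[OF z] by simp
      then show ?thesis unfolding dF[OF z] by (simp add: power_mult_distrib)
    qed
    have "(t \<longlongrightarrow> 0) (at 0 within ?N)"
    proof (rule tendstoI)
      fix e :: real assume e: "e > 0"
      have "(F \<longlongrightarrow> a) (at 0 within ?N)" by (rule tendsto_within_subset[OF lim sub])
      then have "\<forall>\<^sub>F z in at 0 within ?N. dist (F z) a < e ^ 3" by (rule tendstoD) (use e in simp)
      moreover have "\<forall>\<^sub>F z in at 0 within ?N. z \<in> ?N" by (simp add: eventually_at_filter)
      ultimately show "\<forall>\<^sub>F z in at 0 within ?N. dist (t z) 0 < e"
        by eventually_elim (use small e in simp)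
    qed
    moreover have "isCont V 0" using V(3)[of 0] V(1) DERIV_isCont by auto
    ultimately have "((\<lambda>z. V (t z)) \<longlongrightarrow> V 0) (at 0 within ?N)"
      by (rule isCont_tendsto_compose[rotated])
    then show "((\<lambda>z. V (t z)) \<longlongrightarrow> 0) (at 0 within ?N)" using V(2) by simp
  qed (use \<delta> in auto)
qed

lemma pullback_decay:
  fixes P :: "complex poly"
  assumes P: "P \<noteq> 0" and F: "F holomorphic_on {z. 0 < Im z}"
    and Fa: "\<And>z. 0 < Im z \<Longrightarrow> F z \<noteq> a" and lim: "(F \<longlongrightarrow> a) (at 0 within {z. 0 < Im z})"
    and bdry: "\<And>x. x \<noteq> 0 \<Longrightarrow> real_cube_at (\<lambda>z. poly P (F z) * deriv F z ^ 3) x" and e: "e > 0"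
  shows "\<exists>d>0. \<forall>z. 0 < Im z \<longrightarrow> norm z < d \<longrightarrow> norm (poly P (F z) * deriv F z ^ 3 * z ^ 3) < e"
proof -
  have sub: "half_ball 0 1 \<subseteq> {z. 0 < Im z}" by auto
  have F1: "F holomorphic_on half_ball 0 1" by (rule holomorphic_on_subset[OF F sub])
  have lim1: "(F \<longlongrightarrow> a) (at 0 within half_ball 0 1)" by (rule tendsto_within_subset[OF lim sub])
  obtain \<delta> W W' where W: "0 < \<delta>"
    "\<And>z. z \<in> half_ball 0 \<delta> \<Longrightarrow> (W has_field_derivative W' z) (at z)"
    "W' holomorphic_on half_ball 0 \<delta>"
    "\<And>z. z \<in> half_ball 0 \<delta> \<Longrightarrow> W' z ^ 3 = poly P (F z) * deriv F z ^ 3"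
    "(W \<longlongrightarrow> 0) (at 0 within half_ball 0 \<delta>)"
    by (rule cubic_pullback_primitive[OF P _ F1 _ lim1]) (use Fa in auto)
  have "((\<lambda>z. poly P (F z) * deriv F z ^ 3 * z ^ 3) \<longlongrightarrow> 0) (at 0 within half_ball 0 \<delta>)"
    by (rule cubic_decay[OF W(1) _ W(2-5)]) (use bdry in auto)
  then have "\<forall>\<^sub>F z in at (of_real 0) within half_ball 0 \<delta>. norm (poly P (F z) * deriv F z ^ 3 * z ^ 3) < e"
    using tendstoD[OF _ e] by fastforce
  then obtain d where "0 < d" "\<And>z. z \<in> half_ball 0 d \<Longrightarrow> norm (poly P (F z) * deriv F z ^ 3 * z ^ 3) < e"
    using eventually_in_half_ball_shrink W(1) by blast
  then show ?thesis by (intro exI[of _ d]) auto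
qed

section \<open>Conformal maps of domains with straight boundary arcs\<close>

text \<open>
  Here \<open>\<psi>\<close> is the inverse of a flat chart, rescaled and rotated so that the arc A becomes the
  real axis and D lies above it.
\<close>

definition straight_boundary :: "complex poly \<Rightarrow> complex set \<Rightarrow> complex set \<Rightarrow> complex \<Rightarrow> bool" where
  "straight_boundary P D A p \<longleftrightarrow>
     (\<exists>\<psi> r c. r > 0 \<and> \<psi> holomorphic_on ball 0 r \<and> inj_on \<psi> (ball 0 r) \<and> \<psi> 0 = p \<and> c \<noteq> 0 \<and>
        (\<forall>w\<in>ball 0 r. poly P (\<psi> w) * deriv \<psi> w ^ 3 = c \<and> (0 < Im w \<longrightarrow> \<psi> w \<in> D) \<and>
           (Im w = 0 \<longrightarrow> \<psi> w \<in> A) \<and> (Im w < 0 \<longrightarrow> \<psi> w \<notin> closure D)))"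

text \<open>\<open>f\<close> and \<open>g\<close> are a Riemann map of \<open>D\<close> and its
  inverse, with no boundary behaviour assumed. The corners \<open>a\<close> and \<open>b\<close> may
  be zeros of \<open>P\<close> or ordinary points.\<close>

locale straight_domain =
  fixes P :: "complex poly" and D A1 A2 :: "complex set" and a b :: complex
    and f g :: "complex \<Rightarrow> complex"
  assumes P0: "P \<noteq> 0" and openD: "open D" and boundedD: "bounded D"
    and frD: "frontier D = A1 \<union> A2 \<union> {a, b}" and disj: "A1 \<inter> A2 = {}"
    and conn: "connected A1" "connected A2" and ne: "A1 \<noteq> {}" "A2 \<noteq> {}"
    and str1: "\<And>p. p \<in> A1 \<Longrightarrow> straight_boundary P D A1 p"
    and str2: "\<And>p. p \<in> A2 \<Longrightarrow> straight_boundary P D A2 p"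
    and f: "f holomorphic_on D" and g: "g holomorphic_on ball 0 1"
    and fg: "\<And>z. z \<in> D \<Longrightarrow> f z \<in> ball 0 1 \<and> g (f z) = z"
    and gf: "\<And>w. w \<in> ball 0 1 \<Longrightarrow> g w \<in> D \<and> f (g w) = w"
begin

section \<open>Boundary values of the Riemann map on the arcs\<close>

lemma frontier_facts:
  assumes "p \<in> A1 \<union> A2 \<union> {a, b}"
  shows "p \<in> closure D" "p \<notin> D"
  using assms frD openD by (auto simp: frontier_def interior_open)

text \<open>Properness of \<open>f\<close>: the points of \<open>D\<close> with |f| \<le> 1 - e form
  a compact set, the image of a closed disc under \<open>g\<close>, and this set stays away from the
  frontier.\<close>

lemma norm_f_tendsto:
  assumes "p \<in> frontier D"
  shows "((\<lambda>z. norm (f z)) \<longlongrightarrow> 1) (at p within D)"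
proof (rule tendstoI)
  fix e :: real assume e: "e > 0"
  define K where "K = g ` cball 0 (1 - e)"
  have sub: "cball 0 (1 - e) \<subseteq> ball (0::complex) 1" using e by auto
  have "compact K" unfolding K_def
    by (intro compact_continuous_image continuous_on_subset[OF holomorphic_on_imp_continuous_on[OF g] sub]) simp
  then have "open (- K)" by (simp add: compact_imp_closed open_Compl)
  moreover have "p \<in> - K"
  proof -
    have "K \<subseteq> D" unfolding K_def using gf sub by blast
    then show ?thesis using assms frontier_facts(2)[of p] frD by auto
  qed
  moreover have "dist (norm (f z)) 1 < e" if "z \<in> D" "z \<in> - K" for z
  proof -
    have "f z \<notin> cball 0 (1 - e)" using that fg[OF that(1)] unfolding K_def by force
    then show ?thesis using fg[OF that(1)] by (auto simp: dist_norm)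
  qed
  ultimately show "\<forall>\<^sub>F z in at p within D. dist (norm (f z)) 1 < e"
    unfolding eventually_at_topological by blast
qed

text \<open>\<Theta> continues the composite of \<open>f\<close> with \<psi> across the arc. The
  first conjuncts are those of \<open>straight_boundary\<close>, repeated so that \<psi> and
  \<Theta> live on the same disc: reflection may force a smaller radius.\<close>

definition disc_chart where
  "disc_chart A p \<psi> \<Theta> r c \<longleftrightarrow> r > 0 \<and> \<psi> holomorphic_on ball 0 r \<and> inj_on \<psi> (ball 0 r) \<and> \<psi> 0 = p \<and> c \<noteq> 0 \<and>
     (\<forall>w\<in>ball 0 r. poly P (\<psi> w) * deriv \<psi> w ^ 3 = c \<and> (0 < Im w \<longrightarrow> \<psi> w \<in> D) \<and>
        (Im w = 0 \<longrightarrow> \<psi> w \<in> A) \<and> (Im w < 0 \<longrightarrow> \<psi> w \<notin> closure D)) \<and>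
     \<Theta> holomorphic_on ball 0 r \<and>
     (\<forall>w\<in>ball 0 r. (0 < Im w \<longrightarrow> \<Theta> w = f (\<psi> w)) \<and> \<Theta> w \<noteq> 0 \<and> \<Theta> (cnj w) = 1 / cnj (\<Theta> w))"

lemma disc_chart_exists:
  assumes A: "A \<subseteq> A1 \<union> A2" and p: "straight_boundary P D A p"
  obtains \<psi> \<Theta> r c where "disc_chart A p \<psi> \<Theta> r c"
proof -
  obtain \<psi> r c where \<psi>: "r > 0" "\<psi> holomorphic_on ball 0 r" "inj_on \<psi> (ball 0 r)" "\<psi> 0 = p" "c \<noteq> 0"
    "\<And>w. w \<in> ball 0 r \<Longrightarrow> poly P (\<psi> w) * deriv \<psi> w ^ 3 = c \<and> (0 < Im w \<longrightarrow> \<psi> w \<in> D) \<and>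
           (Im w = 0 \<longrightarrow> \<psi> w \<in> A) \<and> (Im w < 0 \<longrightarrow> \<psi> w \<notin> closure D)"
    using p unfolding straight_boundary_def by blast
  define T where "T = (\<lambda>w. f (\<psi> w))"
  have inD: "\<psi> w \<in> D" if "w \<in> half_ball 0 r" for w using \<psi>(6)[of w] that by auto
  have sub: "half_ball 0 r \<subseteq> ball 0 r" by auto
  have "(f \<circ> \<psi>) holomorphic_on half_ball 0 r"
    by (rule holomorphic_on_compose_gen[OF holomorphic_on_subset[OF \<psi>(2) sub] f]) (use inD in blast)
  then have T: "T holomorphic_on half_ball 0 r" by (simp add: T_def o_def)
  have T1: "norm (T w) < 1" if "w \<in> half_ball 0 r" for w using fg[OF inD[OF that]] by (simp add: T_def)
  have Tlim: "((\<lambda>w. norm (T w)) \<longlongrightarrow> 1) (at x within half_ball 0 r)" if x: "x \<in> ball 0 r" "Im x = 0" for x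
  proof -
    have fr: "\<psi> x \<in> frontier D" using \<psi>(6)[OF x(1)] x(2) A frD by blast
    have "(\<psi> \<longlongrightarrow> \<psi> x) (at x within half_ball 0 r)"
      by (rule holomorphic_tendsto_within[OF \<psi>(2) open_ball x(1)])
    moreover have "\<forall>\<^sub>F w in at x within half_ball 0 r. \<psi> w \<in> D \<and> \<psi> w \<noteq> \<psi> x"
    proof -
      have "\<psi> x \<notin> D" using fr frontier_facts(2) frD by blast
      then have "\<psi> w \<in> D \<and> \<psi> w \<noteq> \<psi> x" if "w \<in> half_ball 0 r" for w using inD[OF that] by metis
      then show ?thesis unfolding eventually_at by (intro exI[of _ 1] conjI ballI impI zero_less_one) blast+
    qed
    ultimately have "filterlim \<psi> (at (\<psi> x) within D) (at x within half_ball 0 r)"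
      by (auto simp: filterlim_at)
    then show ?thesis unfolding T_def using norm_f_tendsto[OF fr] by (rule filterlim_compose[rotated])
  qed
  obtain s \<Theta> where \<Theta>: "0 < s" "s \<le> r" "\<Theta> holomorphic_on ball 0 s"
    "\<And>z. z \<in> half_ball 0 s \<Longrightarrow> \<Theta> z = T z"
    "\<And>z. z \<in> ball 0 s \<Longrightarrow> \<Theta> z \<noteq> 0"
    "\<And>z. z \<in> ball 0 s \<Longrightarrow> \<Theta> (cnj z) = 1 / cnj (\<Theta> z)"
    using circle_reflection[OF T \<psi>(1) T1 Tlim] by blast
  have sr: "ball 0 s \<subseteq> ball (0::complex) r" using \<Theta>(2) by auto
  have "disc_chart A p \<psi> \<Theta> s c"
    unfolding disc_chart_def
    using \<psi>(4,5) \<Theta>(1,3) holomorphic_on_subset[OF \<psi>(2) sr] inj_on_subset[OF \<psi>(3) sr]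
  proof (intro conjI ballI)
    fix w assume w: "w \<in> ball (0::complex) s"
    then have wr: "w \<in> ball 0 r" using sr by blast
    show "poly P (\<psi> w) * deriv \<psi> w ^ 3 = c" "0 < Im w \<longrightarrow> \<psi> w \<in> D" "Im w = 0 \<longrightarrow> \<psi> w \<in> A"
      "Im w < 0 \<longrightarrow> \<psi> w \<notin> closure D" using \<psi>(6)[OF wr] by auto
    show "0 < Im w \<longrightarrow> \<Theta> w = f (\<psi> w)" using \<Theta>(4)[of w] w by (simp add: T_def)
    show "\<Theta> w \<noteq> 0" "\<Theta> (cnj w) = 1 / cnj (\<Theta> w)" using \<Theta>(5,6) w by auto
  qed auto
  then show ?thesis by (rule that)
qed

text \<open>The symmetry of \<Theta> exchanges the moduli q and 1/q. Thus the unit circle pulls back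
  exactly to the diameter, and boundary points can be recognised by the modulus of \<Theta>
  alone.\<close>

lemma disc_chart_norm:
  assumes "disc_chart A p \<psi> \<Theta> r c" "w \<in> ball 0 r"
  shows "norm (\<Theta> w) < 1 \<longleftrightarrow> 0 < Im w" "norm (\<Theta> w) = 1 \<longleftrightarrow> Im w = 0"
proof -
  have up: "norm (\<Theta> w) < 1" if "w \<in> ball 0 r" "0 < Im w" for w
  proof -
    have "\<Theta> w = f (\<psi> w)" "\<psi> w \<in> D" using assms(1) that unfolding disc_chart_def by auto
    then show ?thesis using fg by simp
  qed
  have ne0: "\<Theta> w \<noteq> 0" and sym: "\<Theta> (cnj w) = 1 / cnj (\<Theta> w)"
    using assms unfolding disc_chart_def by auto
  have ns: "norm (\<Theta> (cnj w)) * norm (\<Theta> w) = 1" unfolding sym using ne0 by (simp add: norm_divide)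
  have low: "norm (\<Theta> w) > 1" if "Im w < 0"
  proof -
    have "norm (\<Theta> (cnj w)) < 1" using up[of "cnj w"] that assms(2) by simp
    moreover have "norm (\<Theta> (cnj w)) * norm (\<Theta> w) \<le> norm (\<Theta> (cnj w)) * 1" if "norm (\<Theta> w) \<le> 1"
      using that by (intro mult_left_mono) auto
    ultimately show ?thesis using ns by fastforce
  qed
  have real: "norm (\<Theta> w) = 1" if "Im w = 0"
  proof -
    have "cnj w = w" using that by (simp add: complex_eq_iff)
    then have "norm (\<Theta> w) ^ 2 = 1" using ns by (simp add: power2_eq_square)
    then show ?thesis using norm_ge_zero[of "\<Theta> w"] by (simp add: power2_eq_1_iff)
  qed
  show "norm (\<Theta> w) < 1 \<longleftrightarrow> 0 < Im w" "norm (\<Theta> w) = 1 \<longleftrightarrow> Im w = 0"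
    using up[of w] low real assms(2) by (cases "Im w" "0::real" rule: linorder_cases; simp)+
qed

lemma disc_chart_open_image:
  assumes "disc_chart A p \<psi> \<Theta> r c" "0 < s" "s \<le> r"
  shows "open (\<psi> ` ball 0 s)" "open (\<Theta> ` ball 0 s)"
proof -
  have sub: "ball 0 s \<subseteq> ball (0::complex) r" using assms(3) by auto
  have *: "\<psi> holomorphic_on ball 0 s" "\<Theta> holomorphic_on ball 0 s" "inj_on \<psi> (ball 0 s)"
    using assms(1) holomorphic_on_subset[OF _ sub] inj_on_subset[OF _ sub] unfolding disc_chart_def by blast+
  show "open (\<psi> ` ball 0 s)" using *(1,3) open_mapping_thm3 by blast
  \<comment> \<open>\<Theta> is not known to be injective; being nonconstant is enough for the open
    mapping theorem.\<close>
  have "\<not> \<Theta> constant_on ball 0 s"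
  proof
    assume "\<Theta> constant_on ball 0 s"
    then have "\<Theta> 0 = \<Theta> (\<i> * of_real (s / 2))"
      using assms(2) unfolding constant_on_def by (auto simp: norm_mult)
    moreover have "norm (\<Theta> 0) = 1" "norm (\<Theta> (\<i> * of_real (s / 2))) < 1"
      using disc_chart_norm[OF assms(1), of 0] disc_chart_norm[OF assms(1), of "\<i> * of_real (s / 2)"] assms(2,3)
      by (auto simp: norm_mult)
    ultimately show False by simp
  qed
  then show "open (\<Theta> ` ball 0 s)"
    using open_mapping_thm[OF *(2) open_ball connected_ball open_ball subset_refl] by blast
qed

lemma disc_chart_inverse:
  assumes "disc_chart A p \<psi> \<Theta> r c"
  obtains \<phi> where "\<phi> holomorphic_on (\<psi> ` ball 0 r)" "\<And>w. w \<in> ball 0 r \<Longrightarrow> \<phi> (\<psi> w) = w"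
  using assms holomorphic_has_inverse[of \<psi> "ball 0 r"] unfolding disc_chart_def by (metis open_ball)

text \<open>Within the chart, points of \<open>D\<close> come only from the open upper half disc:
  the diameter goes to the frontier and the lower half off the closure. So near the arc
  \<open>f\<close> is \<Theta> in the coordinate \<phi>.\<close>

lemma disc_chart_tendsto:
  assumes ch: "disc_chart A p \<psi> \<Theta> r c" and A: "A \<subseteq> A1 \<union> A2" and w0: "w0 \<in> ball 0 r" "Im w0 = 0"
  shows "(f \<longlongrightarrow> \<Theta> w0) (at (\<psi> w0) within D)"
proof -
  obtain \<phi> where \<phi>: "\<phi> holomorphic_on (\<psi> ` ball 0 r)" "\<And>w. w \<in> ball 0 r \<Longrightarrow> \<phi> (\<psi> w) = w"
    using disc_chart_inverse[OF ch] by blast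
  have r: "r > 0" using ch unfolding disc_chart_def by blast
  have op: "open (\<psi> ` ball 0 r)" using disc_chart_open_image[OF ch r] by simp
  have "isCont \<phi> (\<psi> w0)"
    using \<phi>(1) op w0(1) continuous_on_eq_continuous_at holomorphic_on_imp_continuous_on by blast
  moreover have "isCont \<Theta> w0"
    using ch w0(1) unfolding disc_chart_def
    by (meson continuous_on_eq_continuous_at holomorphic_on_imp_continuous_on open_ball)
  ultimately have "isCont (\<lambda>z. \<Theta> (\<phi> z)) (\<psi> w0)"
    using \<phi>(2)[OF w0(1)] isCont_o2 by fastforce
  then have "((\<lambda>z. \<Theta> (\<phi> z)) \<longlongrightarrow> \<Theta> (\<phi> (\<psi> w0))) (at (\<psi> w0) within D)"
    using continuous_at_imp_continuous_at_within continuous_within by blast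
  then have "((\<lambda>z. \<Theta> (\<phi> z)) \<longlongrightarrow> \<Theta> w0) (at (\<psi> w0) within D)"
    using \<phi>(2)[OF w0(1)] by simp
  moreover have "\<forall>\<^sub>F z in at (\<psi> w0) within D. \<Theta> (\<phi> z) = f z"
    unfolding eventually_at_topological
  proof (intro exI[of _ "\<psi> ` ball 0 r"] conjI ballI impI)
    fix z assume z: "z \<in> \<psi> ` ball 0 r" "z \<in> D"
    then obtain w where w: "w \<in> ball 0 r" "z = \<psi> w" by blast
    have "\<not> Im w = 0" using ch w z(2) A frontier_facts(2) unfolding disc_chart_def by blast
    moreover have "\<not> Im w < 0" using ch w z(2) closure_subset[of D] unfolding disc_chart_def by blast
    ultimately have "0 < Im w" by linarith
    then show "\<Theta> (\<phi> z) = f z" using ch w \<phi>(2) unfolding disc_chart_def by auto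
  qed (use op w0 in auto)
  ultimately show ?thesis by (rule Lim_transform_eventually)
qed

text \<open>The limit is established on \<open>A1\<close> and \<open>A2\<close> only; at the corners
  the value carries no meaning.\<close>

definition bdry where "bdry p = Lim (at p within D) f"

lemma bdry_eqI:
  assumes "(f \<longlongrightarrow> \<zeta>) (at p within D)" "p \<in> A1 \<union> A2"
  shows "bdry p = \<zeta>"
proof -
  have "at p within D \<noteq> bot"
    using frontier_facts[of p] assms(2) unfolding trivial_limit_within closure_def by blast
  then show ?thesis unfolding bdry_def using assms(1) by (intro tendsto_Lim) auto
qed

lemma bdry_chart:
  assumes ch: "disc_chart A p \<psi> \<Theta> r c" and A: "A \<subseteq> A1 \<union> A2" and w: "w \<in> ball 0 r" "Im w = 0"
  shows "\<psi> w \<in> A" "bdry (\<psi> w) = \<Theta> w"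
proof -
  show "\<psi> w \<in> A" using ch w unfolding disc_chart_def by blast
  then show "bdry (\<psi> w) = \<Theta> w" using disc_chart_tendsto[OF ch A w] A bdry_eqI by blast
qed

lemma norm_bdry:
  assumes A: "A \<subseteq> A1 \<union> A2" and "straight_boundary P D A p"
  shows "norm (bdry p) = 1"
proof -
  obtain \<psi> \<Theta> r c where ch: "disc_chart A p \<psi> \<Theta> r c" using disc_chart_exists assms by blast
  then have "0 \<in> ball (0::complex) r" "\<psi> 0 = p" unfolding disc_chart_def by auto
  then show ?thesis using bdry_chart[OF ch A, of 0] disc_chart_norm(2)[OF ch, of 0] by simp
qed

text \<open>\<Theta> is open, and its image meets the circle only in values taken on the diameter,
  which lies over \<open>A\<close>.\<close>

lemma bdry_open:
  assumes A: "A \<subseteq> A1 \<union> A2" and st: "\<And>p. p \<in> A \<Longrightarrow> straight_boundary P D A p"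
  shows "openin (top_of_set (sphere 0 1)) (bdry ` A)"
  unfolding openin_subopen[of _ "bdry ` A"]
proof
  fix \<zeta> assume "\<zeta> \<in> bdry ` A"
  then obtain p where p: "p \<in> A" "\<zeta> = bdry p" by blast
  obtain \<psi> \<Theta> r c where ch: "disc_chart A p \<psi> \<Theta> r c" using disc_chart_exists[OF A st[OF p(1)]] by blast
  then have r: "r > 0" "\<psi> 0 = p" unfolding disc_chart_def by auto
  have "\<zeta> \<in> \<Theta> ` ball 0 r" using bdry_chart[OF ch A, of 0] r p by auto
  moreover have "\<zeta> \<in> sphere 0 1" using norm_bdry[OF A st[OF p(1)]] p by simp
  moreover have "sphere 0 1 \<inter> \<Theta> ` ball 0 r \<subseteq> bdry ` A"
  proof
    fix y assume "y \<in> sphere 0 1 \<inter> \<Theta> ` ball 0 r"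
    then obtain w where w: "w \<in> ball 0 r" "y = \<Theta> w" "norm (\<Theta> w) = 1" by auto
    then have "Im w = 0" using disc_chart_norm(2)[OF ch w(1)] by blast
    then show "y \<in> bdry ` A" using bdry_chart[OF ch A w(1)] w(2) by force
  qed
  ultimately show "\<exists>T. openin (top_of_set (sphere 0 1)) T \<and> \<zeta> \<in> T \<and> T \<subseteq> bdry ` A"
    using disc_chart_open_image(2)[OF ch r(1)] by (intro exI[of _ "sphere 0 1 \<inter> \<Theta> ` ball 0 r"]) auto
qed

lemma bdry_continuous:
  assumes A: "A \<subseteq> A1 \<union> A2" and st: "\<And>p. p \<in> A \<Longrightarrow> straight_boundary P D A p"
  shows "continuous_on A bdry"
  unfolding continuous_on_def
proof
  fix p assume p: "p \<in> A"
  obtain \<psi> \<Theta> r c where ch: "disc_chart A p \<psi> \<Theta> r c" using disc_chart_exists[OF A st[OF p]] by blast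
  then have r: "r > 0" "\<psi> 0 = p" unfolding disc_chart_def by auto
  obtain \<phi> where \<phi>: "\<phi> holomorphic_on (\<psi> ` ball 0 r)" "\<And>w. w \<in> ball 0 r \<Longrightarrow> \<phi> (\<psi> w) = w"
    using disc_chart_inverse[OF ch] by blast
  have op: "open (\<psi> ` ball 0 r)" using disc_chart_open_image[OF ch r(1)] by simp
  have pin: "p \<in> \<psi> ` ball 0 r" using r by force
  have \<phi>p: "\<phi> p = 0" using \<phi>(2)[of 0] r by simp
  have "isCont \<phi> p"
    using \<phi>(1) op pin continuous_on_eq_continuous_at holomorphic_on_imp_continuous_on by blast
  moreover have "isCont \<Theta> 0"
    using ch r(1) unfolding disc_chart_def
    by (metis centre_in_ball continuous_on_eq_continuous_at holomorphic_on_imp_continuous_on open_ball)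
  ultimately have "isCont (\<lambda>z. \<Theta> (\<phi> z)) p" using \<phi>p isCont_o2 by fastforce
  then have "((\<lambda>z. \<Theta> (\<phi> z)) \<longlongrightarrow> \<Theta> (\<phi> p)) (at p within A)"
    using continuous_at_imp_continuous_at_within continuous_within by blast
  moreover have "\<Theta> (\<phi> p) = bdry p" using bdry_chart[OF ch A, of 0] r \<phi>p by simp
  moreover have "\<forall>\<^sub>F z in at p within A. \<Theta> (\<phi> z) = bdry z"
    unfolding eventually_at_topological
  proof (intro exI[of _ "\<psi> ` ball 0 r"] conjI ballI impI)
    fix z assume z: "z \<in> \<psi> ` ball 0 r" "z \<in> A"
    then obtain w where w: "w \<in> ball 0 r" "z = \<psi> w" by blast
    have zc: "z \<in> closure D" "z \<notin> D" using frontier_facts z(2) A by auto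
    then have "\<not> Im w > 0" "\<not> Im w < 0" using ch w unfolding disc_chart_def by blast+
    then have "Im w = 0" by linarith
    then show "\<Theta> (\<phi> z) = bdry z" using bdry_chart[OF ch A w(1)] w \<phi>(2) by simp
  qed (use op pin in auto)
  ultimately show "(bdry \<longlongrightarrow> bdry p) (at p within A)" by (simp add: Lim_transform_eventually)
qed

lemma straight_union:
  assumes "p \<in> A1 \<union> A2" shows "straight_boundary P D (A1 \<union> A2) p"
  using assms str1[of p] str2[of p] unfolding straight_boundary_def by (elim UnE) blast+

lemma disc_chart_shrink:
  assumes ch: "disc_chart A p \<psi> \<Theta> r c" and U: "open U" "p \<in> U"
  obtains s where "0 < s" "s \<le> r" "\<psi> ` ball 0 s \<subseteq> U"
proof -
  have r: "r > 0" "\<psi> 0 = p" "\<psi> holomorphic_on ball 0 r" using ch unfolding disc_chart_def by auto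
  have "open (ball 0 r \<inter> \<psi> -` U)"
    by (rule continuous_open_preimage[OF holomorphic_on_imp_continuous_on[OF r(3)] open_ball U(1)])
  moreover have "0 \<in> ball 0 r \<inter> \<psi> -` U" using r U by simp
  ultimately obtain e where "e > 0" "ball 0 e \<subseteq> ball 0 r \<inter> \<psi> -` U" using openE by blast
  then show ?thesis by (intro that[of "min e r"]) (use r(1) in auto)
qed

text \<open>Disjoint neighbourhoods of \<open>p\<close> and \<open>q\<close> would both be mapped
  over a full neighbourhood of the common value; a point \<open>y\<close> of the open disc near it
  would then come from two points of \<open>D\<close>.\<close>

lemma bdry_inj:
  assumes p: "p \<in> A1 \<union> A2" and q: "q \<in> A1 \<union> A2" and pq: "p \<noteq> q"
  shows "bdry p \<noteq> bdry q"
proof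
  assume eq: "bdry p = bdry q"
  obtain \<psi> \<Theta> r c where ch: "disc_chart (A1 \<union> A2) p \<psi> \<Theta> r c"
    using disc_chart_exists[OF subset_refl straight_union[OF p]] by blast
  obtain \<psi>' \<Theta>' r' c' where ch': "disc_chart (A1 \<union> A2) q \<psi>' \<Theta>' r' c'"
    using disc_chart_exists[OF subset_refl straight_union[OF q]] by blast
  have r: "r > 0" "\<psi> 0 = p" "r' > 0" "\<psi>' 0 = q" using ch ch' unfolding disc_chart_def by auto
  obtain U V where UV: "open U" "open V" "p \<in> U" "q \<in> V" "U \<inter> V = {}" using hausdorff[OF pq] by blast
  obtain s where s: "0 < s" "s \<le> r" "\<psi> ` ball 0 s \<subseteq> U"
    using disc_chart_shrink[OF ch UV(1)] UV(3) by blast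
  obtain s' where s': "0 < s'" "s' \<le> r'" "\<psi>' ` ball 0 s' \<subseteq> V"
    using disc_chart_shrink[OF ch' UV(2)] UV(4) by blast
  define \<zeta> where "\<zeta> = bdry p"
  have \<zeta>: "\<zeta> = \<Theta> 0" "\<zeta> = \<Theta>' 0"
    using bdry_chart[OF ch subset_refl, of 0] bdry_chart[OF ch' subset_refl, of 0] r eq by (auto simp: \<zeta>_def)
  have \<zeta>1: "norm \<zeta> = 1" unfolding \<zeta>_def using norm_bdry[OF subset_refl straight_union[OF p]] .
  have "open (\<Theta> ` ball 0 s \<inter> \<Theta>' ` ball 0 s')"
    using disc_chart_open_image(2)[OF ch s(1,2)] disc_chart_open_image(2)[OF ch' s'(1,2)] by blast
  moreover have "\<zeta> \<in> \<Theta> ` ball 0 s \<inter> \<Theta>' ` ball 0 s'" 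
    using \<zeta> s(1) s'(1) centre_in_ball by blast
  ultimately obtain e where e: "e > 0" "ball \<zeta> e \<subseteq> \<Theta> ` ball 0 s \<inter> \<Theta>' ` ball 0 s'" using openE by blast
  define k where "k = min (e / 2) (1 / 2)"
  have k: "0 < k" "k < e" "k < 1" using e(1) by (auto simp: k_def)
  define y where "y = of_real (1 - k) * \<zeta>"
  have "\<zeta> - y = of_real k * \<zeta>" by (simp add: y_def algebra_simps)
  then have "dist \<zeta> y = k" using k \<zeta>1 by (simp add: dist_norm norm_mult)
  then have yin: "y \<in> \<Theta> ` ball 0 s \<inter> \<Theta>' ` ball 0 s'" using e(2) k by auto
  have "norm y = \<bar>1 - k\<bar>" using \<zeta>1 unfolding y_def norm_mult norm_of_real by simp
  then have y1: "norm y < 1" using k by simp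
  obtain w w' where w: "w \<in> ball 0 s" "y = \<Theta> w" and w': "w' \<in> ball 0 s'" "y = \<Theta>' w'" using yin by blast
  have wr: "w \<in> ball 0 r" "w' \<in> ball 0 r'" using w(1) w'(1) s(2) s'(2) by auto
  have "0 < Im w" "0 < Im w'"
    using disc_chart_norm(1)[OF ch wr(1)] disc_chart_norm(1)[OF ch' wr(2)] y1 w(2) w'(2) by auto
  then have "\<psi> w \<in> D" "\<psi>' w' \<in> D" "f (\<psi> w) = y" "f (\<psi>' w') = y"
    using ch ch' wr w(2) w'(2) unfolding disc_chart_def by auto
  then have "\<psi> w = \<psi>' w'" using fg by metis
  then show False using s(3) s'(3) w(1) w'(1) UV(5) by blast
qed

end

text \<open>At a zero of order n of S - S 0 the map multiplies angles by n, so a half disc would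
  cover an angle n \<pi>; the upper half plane has room for n = 1 only.\<close>

lemma boundary_deriv_nonzero:
  assumes r: "r > 0" and S: "S holomorphic_on ball 0 r" and S0: "Im (S 0) = 0"
    and up: "\<And>w. w \<in> ball 0 r \<Longrightarrow> 0 < Im w \<Longrightarrow> 0 < Im (S w)"
  shows "deriv S 0 \<noteq> 0"
proof -
  define h where "h w = S w - S 0" for w
  have hh: "h holomorphic_on ball 0 r" unfolding h_def by (intro holomorphic_intros S)
  have nc: "\<not> h constant_on ball 0 r"
  proof
    assume "h constant_on ball 0 r"
    then have "h (\<i> * of_real (r / 2)) = h 0"
      using r unfolding constant_on_def by (auto simp: norm_mult)
    moreover have "0 < Im (S (\<i> * of_real (r / 2)))" using r by (intro up) (auto simp: norm_mult)
    ultimately show False using S0 by (simp add: h_def)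
  qed
  have h0: "0 \<in> ball (0::complex) r" "h 0 = 0" using r by (auto simp: h_def)
  obtain g s n where g: "0 < n" "0 < s" "ball 0 s \<subseteq> ball (0::complex) r" "g holomorphic_on ball 0 s"
      "\<And>w. w \<in> ball 0 s \<Longrightarrow> h w = (w - 0) ^ n * g w" "\<And>w. w \<in> ball 0 s \<Longrightarrow> g w \<noteq> 0"
    by (rule holomorphic_factor_zero_nonconstant[OF hh open_ball connected_ball h0 nc]) (rule that; assumption)
  have gc: "isCont g 0" using g(2,4)
    by (metis centre_in_ball continuous_on_eq_continuous_at holomorphic_on_imp_continuous_on open_ball)
  \<comment> \<open>Approach 0 along the ray of angle \<alpha>/n, on which w^n has argument
    \<alpha>; in the limit the strict inequality for \<open>S\<close> becomes a weak one for
    \<open>g 0\<close>.\<close>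
  have nonneg: "0 \<le> Im (cis \<alpha> * g 0)" if \<alpha>: "0 < \<alpha>" "\<alpha> < pi * n" for \<alpha>
  proof -
    define \<theta> where "\<theta> = \<alpha> / n"
    have \<theta>: "0 < \<theta>" "\<theta> < pi" "\<alpha> = n * \<theta>" using \<alpha> g(1) by (auto simp: \<theta>_def field_simps)
    have "((\<lambda>t. of_real t * cis \<theta>) \<longlongrightarrow> of_real 0 * cis \<theta>) (at_right (0::real))"
      by (intro tendsto_intros)
    then have "((\<lambda>t. of_real t * cis \<theta>) \<longlongrightarrow> 0) (at_right (0::real))" by simp
    then have "((\<lambda>t. g (of_real t * cis \<theta>)) \<longlongrightarrow> g 0) (at_right (0::real))"
      by (rule isCont_tendsto_compose[OF gc])
    then have lim: "((\<lambda>t. Im (cis \<alpha> * g (of_real t * cis \<theta>))) \<longlongrightarrow> Im (cis \<alpha> * g 0)) (at_right (0::real))"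
      by (intro tendsto_intros)
    have "\<forall>\<^sub>F t in at_right (0::real). t \<in> {0<..<s}"
      using eventually_at_right_real[OF g(2)] .
    then have "\<forall>\<^sub>F t in at_right (0::real). 0 \<le> Im (cis \<alpha> * g (of_real t * cis \<theta>))"
    proof eventually_elim
      case (elim t)
      define w where "w = of_real t * cis \<theta>"
      have ws: "w \<in> ball 0 s" using elim by (simp add: w_def norm_mult)
      have "0 < Im w" using elim \<theta> sin_gt_zero by (simp add: w_def)
      then have "0 < Im (S w)" using up ws g(3) by blast
      then have "0 < Im (h w)" using S0 by (simp add: h_def)
      moreover have "h w = of_real (t ^ n) * (cis \<alpha> * g w)"
        using g(5)[OF ws] by (simp add: w_def power_mult_distrib Complex.DeMoivre \<theta>(3))
      ultimately have "0 < t ^ n * Im (cis \<alpha> * g w)" by (simp only: Im_complex_of_real times_complex.simps Re_complex_of_real mult_zero_left add_0_right)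
      then have "0 < Im (cis \<alpha> * g w)" using elim by (simp add: zero_less_mult_iff)
      then show ?case by (simp add: w_def)
    qed
    then show ?thesis by (intro tendsto_lowerbound[OF lim]) auto
  qed
  have "n = 1"
  proof (rule ccontr)
    assume "n \<noteq> 1"
    then have n2: "2 \<le> real n" using g(1) by linarith
    have big: "pi * 2 \<le> pi * n" using n2 by (intro mult_left_mono) auto
    \<comment> \<open>For n \<ge> 2 both x and x + \<pi> are admissible angles when 0 < x < \<pi>,
      so \<open>Im (cis x * g 0)\<close> is zero for these x. The perpendicular directions \<pi>/4
      and 3\<pi>/4 then force \<open>g 0\<close> = 0.\<close>
    define u where "u = cis (pi / 4) * g 0"
    have shift: "cis (x + pi) * g 0 = - (cis x * g 0)" for x by (simp flip: cis_mult)
    have zero: "Im (cis x * g 0) = 0" if "0 < x" "x < pi" for x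
      using nonneg[of x] nonneg[of "x + pi"] that big shift[of x] by simp
    have "Im u = 0" unfolding u_def by (rule zero) auto
    moreover have "Im (\<i> * u) = 0"
    proof -
      have "cis (x + pi / 2) * g 0 = \<i> * (cis x * g 0)" for x by (simp flip: cis_mult)
      then have "cis (pi / 4 + pi / 2) * g 0 = \<i> * u" unfolding u_def by blast
      moreover have "Im (cis (pi / 4 + pi / 2) * g 0) = 0" by (rule zero) auto
      ultimately show ?thesis by metis
    qed
    ultimately have "u = 0" by (simp add: complex_eq_iff)
    then show False using g(2,6) by (simp add: u_def)
  qed
  have "(h has_field_derivative g 0) (at 0)"
  proof -
    have "((\<lambda>w. w * g w) has_field_derivative g 0) (at 0)"
      using holomorphic_derivI[OF g(4) open_ball, of 0] g(2) by (auto intro!: derivative_eq_intros)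
    then show ?thesis
      by (rule has_field_derivative_transform_within_open[OF _ open_ball[of 0 s]])
         (use g(2,5) \<open>n = 1\<close> in auto)
  qed
  then have "((\<lambda>w. h w + S 0) has_field_derivative g 0) (at 0)" by (auto intro!: derivative_eq_intros)
  then have "deriv S 0 = g 0" by (simp add: h_def DERIV_imp_deriv)
  then show ?thesis using g(2,6) by simp
qed

text \<open>In the coordinate w the differential is c dw^3, so the one-form asked for by
  \<open>real_cube_at\<close> is the differential of the local inverse \<open>T\<close> of
  \<open>S\<close>, which is real on the axis by symmetry.\<close>

lemma real_cube_at_chart:
  assumes r: "r > 0" and S: "S holomorphic_on ball 0 r" and S0: "S 0 = of_real x" and c: "c \<noteq> 0"
    and sym: "\<And>w. w \<in> ball 0 r \<Longrightarrow> S (cnj w) = cnj (S w)"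
    and up: "\<And>w. w \<in> ball 0 r \<Longrightarrow> 0 < Im w \<Longrightarrow> 0 < Im (S w)"
    and G: "\<And>w. w \<in> ball 0 r \<Longrightarrow> 0 < Im w \<Longrightarrow> G (S w) * deriv S w ^ 3 = c"
  shows "real_cube_at G x"
proof -
  have dS: "deriv S 0 \<noteq> 0" by (rule boundary_deriv_nonzero[OF r S _ up]) (use S0 in auto)
  have zin: "0 \<in> ball (0::complex) r" using r by simp
  obtain s where s: "s > 0" "ball 0 s \<subseteq> ball (0::complex) r" "inj_on S (ball 0 s)"
    by (rule has_complex_derivative_locally_injective[OF S zin open_ball dS]) (rule that; assumption)
  have Ss: "S holomorphic_on ball 0 s" by (rule holomorphic_on_subset[OF S s(2)])
  obtain T where T: "T holomorphic_on (S ` ball 0 s)"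
    "\<And>w. w \<in> ball 0 s \<Longrightarrow> deriv S w * deriv T (S w) = 1" "\<And>w. w \<in> ball 0 s \<Longrightarrow> T (S w) = w"
    using holomorphic_has_inverse[OF Ss open_ball s(3)] by blast
  have "open (S ` ball 0 s)" by (rule open_mapping_thm3[OF Ss open_ball s(3)])
  moreover have "of_real x \<in> S ` ball 0 s" using S0 s(1) by (metis centre_in_ball imageI)
  ultimately obtain \<rho> where \<rho>: "\<rho> > 0" "ball (of_real x) \<rho> \<subseteq> S ` ball 0 s" using openE by blast
  have Th: "T holomorphic_on ball (of_real x) \<rho>" by (rule holomorphic_on_subset[OF T(1) \<rho>(2)])
  have Tsym: "T (cnj z) = cnj (T z)" if zB: "z \<in> ball (of_real x) \<rho>" for z
  proof -
    obtain w where w: "w \<in> ball 0 s" "z = S w" using \<rho>(2) zB by blast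
    have "cnj z = S (cnj w)" using sym[of w] s(2) w by auto
    then show ?thesis using T(3)[of "cnj w"] T(3)[of w] w by simp
  qed
  show ?thesis unfolding real_cube_at_def
  proof (intro exI[of _ \<rho>] exI[of _ c] exI[of _ "deriv T"] conjI ballI)
    fix z assume z: "z \<in> ball (complex_of_real x) \<rho>"
    then obtain w where w: "w \<in> ball 0 s" "z = S w" using \<rho>(2) by blast
    show "deriv T z \<noteq> 0" using T(2)[OF w(1)] w(2) by auto
    have z': "cnj z \<in> ball (complex_of_real x) \<rho>" using z cnj_in_ball by blast
    have "(T has_field_derivative deriv T z) (at z)" by (rule holomorphic_derivI[OF Th open_ball z])
    then have "(cnj \<circ> T \<circ> cnj has_field_derivative cnj (deriv T z)) (at (cnj z))"
      by (rule has_field_derivative_cnj_cnj[of T "deriv T z" "cnj z", simplified])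
    then have "(T has_field_derivative cnj (deriv T z)) (at (cnj z))"
    proof (rule has_field_derivative_transform_within_open[OF _ open_ball z'])
      fix y assume "y \<in> ball (complex_of_real x) \<rho>"
      then have "cnj y \<in> ball (complex_of_real x) \<rho>" using cnj_in_ball by blast
      then show "(cnj \<circ> T \<circ> cnj) y = T y" using Tsym[of "cnj y"] by simp
    qed
    then show "deriv T (cnj z) = cnj (deriv T z)" by (rule DERIV_imp_deriv)
  next
    fix z assume z: "z \<in> half_ball x \<rho>"
    then obtain w where w: "w \<in> ball 0 s" "z = S w" using \<rho>(2) by blast
    have wr: "w \<in> ball 0 r" using w s(2) by blast
    have "Im w > 0"
    proof (rule ccontr)
      assume "\<not> 0 < Im w"
      then consider "Im w = 0" | "Im w < 0" by linarith
      then show False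
      proof cases
        case 1
        then have "cnj w = w" by (simp add: complex_eq_iff)
        then have "S w = cnj (S w)" using sym[OF wr] by simp
        then have "Im (S w) = 0" by (simp add: complex_eq_iff)
        then show False using z w by simp
      next
        case 2
        then have "0 < Im (S (cnj w))" using up[of "cnj w"] wr by simp
        then show False using sym[OF wr] z w by simp
      qed
    qed
    then have "G z * deriv S w ^ 3 = c" using G[OF wr] w by simp
    then have "G z * (deriv S w * deriv T z) ^ 3 = c * deriv T z ^ 3"
      by (simp add: power_mult_distrib mult.assoc[symmetric])
    then show "G z = c * deriv T z ^ 3" using T(2)[OF w(1)] w(2) by simp
  qed (use \<rho> c holomorphic_deriv[OF Th open_ball] in auto)
qed

section \<open>The Cayley transform\<close>

definition cayley :: "complex \<Rightarrow> complex" where "cayley w = \<i> * (1 + w) / (1 - w)"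

definition inv_cayley :: "complex \<Rightarrow> complex" where "inv_cayley z = (z - \<i>) / (z + \<i>)"

lemma Im_cayley: "Im (cayley w) = (1 - norm w ^ 2) / norm (1 - w) ^ 2"
  unfolding cayley_def cmod_power2 by (simp add: Im_divide algebra_simps power2_eq_square)

lemma plus_ii_nonzero: "0 \<le> Im z \<Longrightarrow> z + \<i> \<noteq> 0"
  by (auto simp: complex_eq_iff)

lemma cayley_inv_cayley: "0 \<le> Im z \<Longrightarrow> cayley (inv_cayley z) = z"
proof -
  assume "0 \<le> Im z"
  then have z: "z + \<i> \<noteq> 0" by (rule plus_ii_nonzero)
  then have "1 + inv_cayley z = 2 * z / (z + \<i>)" "1 - inv_cayley z = 2 * \<i> / (z + \<i>)"
    unfolding inv_cayley_def by (auto simp: field_simps)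
  then show ?thesis unfolding cayley_def using z by simp
qed

lemma inv_cayley_cayley: "w \<noteq> 1 \<Longrightarrow> inv_cayley (cayley w) = w"
proof -
  assume w: "w \<noteq> 1"
  then have "cayley w - \<i> = 2 * \<i> * w / (1 - w)" "cayley w + \<i> = 2 * \<i> / (1 - w)"
    unfolding cayley_def by (auto simp: field_simps)
  then show ?thesis unfolding inv_cayley_def using w by simp
qed

lemma norm_inv_cayley_less: "0 < Im z \<Longrightarrow> norm (inv_cayley z) < 1"
proof -
  assume z: "0 < Im z"
  then have "0 < 1 - norm (inv_cayley z) ^ 2"
    using Im_cayley[of "inv_cayley z"] cayley_inv_cayley[of z] zero_less_divide_iff by fastforce
  then show ?thesis using power_less_one_iff[of "norm (inv_cayley z)" 2] by simp
qed

lemma norm_inv_cayley_real: "norm (inv_cayley (of_real x)) = 1"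
proof -
  have "norm (complex_of_real x - \<i>) = norm (complex_of_real x + \<i>)"
    by (simp add: cmod_def)
  moreover have "complex_of_real x + \<i> \<noteq> 0" by (rule plus_ii_nonzero) simp
  ultimately show ?thesis unfolding inv_cayley_def by (simp add: norm_divide)
qed

lemma cayley_reflect:
  assumes "w \<noteq> 0" "w \<noteq> 1" shows "cayley (1 / cnj w) = cnj (cayley w)"
proof -
  have "cnj w \<noteq> 0" "cnj w \<noteq> 1" using assms by auto
  then show ?thesis unfolding cayley_def by (simp add: field_simps)
qed

lemma cayley_holomorphic: "1 \<notin> A \<Longrightarrow> cayley holomorphic_on A"
  unfolding cayley_def by (intro holomorphic_intros) auto

lemma inv_cayley_holomorphic: "A \<subseteq> {z. 0 \<le> Im z} \<Longrightarrow> inv_cayley holomorphic_on A"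
  unfolding inv_cayley_def by (intro holomorphic_intros) (use plus_ii_nonzero in blast)

lemma dist_inv_cayley_1: 
  assumes "0 < Im z" "norm z > 1" shows "dist (inv_cayley z) 1 \<le> 2 / (norm z - 1)"
proof -
  have "inv_cayley z - 1 = - 2 * \<i> / (z + \<i>)"
    using plus_ii_nonzero[of z] assms unfolding inv_cayley_def by (simp add: field_simps)
  then have "dist (inv_cayley z) 1 = 2 / norm (z + \<i>)"
    by (simp add: dist_norm norm_divide norm_mult)
  also have "\<dots> \<le> 2 / (norm z - 1)"
    using norm_triangle_ineq4[of "z + \<i>" \<i>] assms by (intro divide_left_mono mult_pos_pos) auto
  finally show ?thesis .
qed

text \<open>Extended by 0 below the axis, \<open>f\<close> is continuous, hence holomorphic across
  the axis, and it vanishes on an open set. This is what forbids intervals of omitted boundary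
  values.\<close>

lemma zero_boundary_values:
  assumes r: "r > 0" and f: "f holomorphic_on half_ball x r"
    and lim: "\<And>y. y \<in> ball (of_real x) r \<Longrightarrow> Im y = 0 \<Longrightarrow> (f \<longlongrightarrow> 0) (at y within {z. 0 < Im z})"
    and z: "z \<in> half_ball x r"
  shows "f z = 0"
proof -
  define h where "h z = (if 0 < Im z then f z else 0)" for z
  let ?B = "ball (complex_of_real x) r"
  have "isCont h y" if y: "y \<in> ?B" for y
  proof -
    consider "0 < Im y" | "Im y < 0" | "Im y = 0" by linarith
    then show ?thesis
    proof cases
      case 1
      then have yH: "y \<in> half_ball x r" using y by simp
      then have "isCont f y"
        using f open_half_ball continuous_on_eq_continuous_at holomorphic_on_imp_continuous_on by blast
      moreover have "\<forall>\<^sub>F w in nhds y. h w = f w"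
        using eventually_nhds_in_open[OF open_half_ball yH] by (rule eventually_mono) (simp add: h_def)
      ultimately show ?thesis by (simp add: isCont_cong)
    next
      case 2
      have "\<forall>\<^sub>F w in nhds y. h w = 0"
        using eventually_nhds_in_open[OF open_halfspace_Im_lt, of y 0] 2
        by (auto elim!: eventually_mono simp: h_def)
      then show ?thesis by (simp add: isCont_cong)
    next
      case 3
      have "(h \<longlongrightarrow> 0) (at y within {z. 0 < Im z})"
        by (rule Lim_transform_eventually[OF lim[OF y 3]]) (simp add: eventually_at_filter h_def)
      moreover have "(h \<longlongrightarrow> 0) (at y within {z. \<not> 0 < Im z})"
        by (rule Lim_transform_eventually[OF tendsto_const]) (simp add: eventually_at_filter h_def)
      ultimately have "(h \<longlongrightarrow> 0) (at y within {z. 0 < Im z} \<union> {z. \<not> 0 < Im z})"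
        by (simp add: Lim_Un)
      moreover have "{z. 0 < Im z} \<union> {z. \<not> 0 < Im z} = (UNIV :: complex set)" by auto
      ultimately show ?thesis using 3 by (simp add: isCont_def h_def)
    qed
  qed
  then have hc: "continuous_on ?B h" by (simp add: continuous_at_imp_continuous_on)
  have dot: "\<i> \<bullet> z = Im z" for z by (simp add: inner_complex_def)
  have hB: "h holomorphic_on ?B"
  proof (rule holomorphic_on_paste_across_line[of _ \<i> _ 0])
    show "h holomorphic_on ?B \<inter> {z. \<i> \<bullet> z < 0}"
      by (rule holomorphic_transform[of "\<lambda>_. 0"]) (auto simp: h_def dot)
    show "h holomorphic_on ?B \<inter> {z. 0 < \<i> \<bullet> z}"
      by (rule holomorphic_transform[of f]) (use f in \<open>auto simp: h_def dot\<close>)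
  qed (use hc in auto)
  have ne: "?B \<inter> {z. Im z < 0} \<noteq> {}"
  proof -
    have "of_real x - \<i> * of_real (r / 2) \<in> ?B \<inter> {z. Im z < 0}" using r by (simp add: dist_norm norm_mult)
    then show ?thesis by blast
  qed
  have op: "open (?B \<inter> {z. Im z < 0})" by (intro open_Int open_ball open_halfspace_Im_lt)
  have zB: "z \<in> ?B" using z by blast
  have "h z = 0"
    by (rule analytic_continuation_open[OF op open_ball ne connected_ball Int_lower1 hB holomorphic_on_const _ zB])
       (simp add: h_def)
  then show ?thesis using z by (simp add: h_def)
qed

text \<open>The image of a half ball is connected; near 0 and for a \<noteq> b it lies in two
  disjoint balls about \<open>a\<close> and \<open>b\<close>, hence in one of them.\<close>

lemma two_valued_limit:
  fixes F :: "complex \<Rightarrow> complex"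
  assumes F: "continuous_on {z. 0 < Im z} F"
    and near: "\<And>e. e > 0 \<Longrightarrow> \<exists>d>0. \<forall>z. 0 < Im z \<longrightarrow> norm z < d \<longrightarrow> dist (F z) a < e \<or> dist (F z) b < e"
  obtains c where "c = a \<or> c = b" "(F \<longlongrightarrow> c) (at 0 within {z. 0 < Im z})"
proof -
  note result = that
  have main: "(F \<longlongrightarrow> c) (at 0 within {z. 0 < Im z})"
    if d0: "d0 > 0" and near0: "\<And>e. e > 0 \<Longrightarrow> \<exists>d>0. \<forall>z. 0 < Im z \<longrightarrow> norm z < d \<longrightarrow> norm z < d0 \<longrightarrow> dist (F z) c < e" for c d0
  proof (rule tendstoI)
    fix e :: real assume "e > 0"
    then obtain d where "d > 0" "\<forall>z. 0 < Im z \<longrightarrow> norm z < d \<longrightarrow> norm z < d0 \<longrightarrow> dist (F z) c < e"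
      using near0 by blast
    then show "\<forall>\<^sub>F z in at 0 within {z. 0 < Im z}. dist (F z) c < e"
      unfolding eventually_at using d0 by (intro exI[of _ "min d d0"]) (auto simp: dist_norm)
  qed
  show ?thesis
  proof (cases "a = b")
    case True
    then show ?thesis using that[of a] main[of 1 a] near by fastforce
  next
    case False
    define e0 where "e0 = dist a b / 2"
    have e0: "e0 > 0" using False by (simp add: e0_def)
    obtain d0 where d0: "d0 > 0" "\<And>z. 0 < Im z \<Longrightarrow> norm z < d0 \<Longrightarrow> dist (F z) a < e0 \<or> dist (F z) b < e0"
      using near[OF e0] by blast
    have goal: thesis if ab: "{a', b'} = {a, b}" and e: "ball a' e0 \<inter> F ` half_ball 0 d0 = {}" for a' b'
    proof (rule result)
      show "b' = a \<or> b' = b" using ab by auto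
      show "(F \<longlongrightarrow> b') (at 0 within {z. 0 < Im z})"
      proof (rule main[OF d0(1)])
        fix e' :: real assume "e' > 0"
        then obtain d where d: "d > 0"
          "\<And>z. 0 < Im z \<Longrightarrow> norm z < d \<Longrightarrow> dist (F z) a < min e' e0 \<or> dist (F z) b < min e' e0"
          using near[of "min e' e0"] e0 by auto
        have "dist (F z) b' < e'" if "0 < Im z" "norm z < d" "norm z < d0" for z
        proof -
          have "F z \<notin> ball a' e0" using e that by auto
          moreover have "dist (F z) a' < min e' e0 \<or> dist (F z) b' < min e' e0"
            using d(2)[OF that(1,2)] ab by (auto simp: doubleton_eq_iff)
          ultimately show ?thesis by (metis dist_commute mem_ball min_less_iff_conj)
        qed
        then show "\<exists>d>0. \<forall>z. 0 < Im z \<longrightarrow> norm z < d \<longrightarrow> norm z < d0 \<longrightarrow> dist (F z) b' < e'" using d(1) by blast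
      qed
    qed
    have disj: "\<not> (dist w a < e0 \<and> dist w b < e0)" for w
      using dist_triangle2[of a b w] by (auto simp: e0_def dist_commute)
    let ?N = "half_ball 0 d0"
    have "connected (F ` ?N)"
      by (intro connected_continuous_image convex_connected convex_half_ball continuous_on_subset[OF F]) auto
    moreover have "F ` ?N \<subseteq> ball a e0 \<union> ball b e0" 
    proof
      fix w assume "w \<in> F ` ?N"
      then obtain z where "0 < Im z" "norm z < d0" "w = F z" by auto
      then show "w \<in> ball a e0 \<union> ball b e0" using d0(2)[of z] by (metis UnI1 UnI2 dist_commute mem_ball)
    qed
    moreover have "ball a e0 \<inter> ball b e0 \<inter> F ` ?N = {}" using disj by (metis IntE dist_commute equals0I mem_ball)
    ultimately have "ball a e0 \<inter> F ` ?N = {} \<or> ball b e0 \<inter> F ` ?N = {}"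
      by (meson connectedD open_ball)
    then show ?thesis using goal[of a b] goal[of b a] by blast
  qed
qed

text \<open>Density excludes gaps of positive length between the two intervals and beyond them, and
  openness keeps the dividing point \<open>Sup K1\<close> out of both.\<close>

lemma complement_two_intervals:
  fixes K1 K2 :: "real set"
  assumes op: "open K1" "open K2" and conn: "connected K1" "connected K2" and dj: "K1 \<inter> K2 = {}"
    and x: "x1 \<in> K1" "x2 \<in> K2" "x1 < x2"
    and dense: "\<And>u v. u < v \<Longrightarrow> \<exists>y. u < y \<and> y < v \<and> y \<in> K1 \<union> K2"
  shows "\<exists>s. \<forall>y. y \<notin> K1 \<union> K2 \<longleftrightarrow> y = s"
proof -
  have i1: "z \<in> K1" if "u \<in> K1" "v \<in> K1" "u \<le> z" "z \<le> v" for u v z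
    using conn(1) that unfolding connected_iff_interval by blast
  have i2: "z \<in> K2" if "u \<in> K2" "v \<in> K2" "u \<le> z" "z \<le> v" for u v z
    using conn(2) that unfolding connected_iff_interval by blast
  have lt: "z < x2" if "z \<in> K1" for z
  proof (rule ccontr)
    assume "\<not> z < x2"
    then have "x2 \<in> K1" using i1[OF x(1) that, of x2] x(3) by simp
    then show False using x(2) dj by blast
  qed
  have bdd: "bdd_above K1" using lt by (meson bdd_aboveI less_imp_le)
  define s where "s = Sup K1"
  have up: "z \<le> s" if "z \<in> K1" for z unfolding s_def using cSup_upper[OF that bdd] .
  have left: "y \<in> K1" if y: "y < s" for y
  proof (rule ccontr)
    assume yn: "y \<notin> K1"
    obtain u where u: "u \<in> K1" "y < u" using y less_cSup_iff[of K1 y] bdd x(1) unfolding s_def by blast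
    obtain z where z: "y - 1 < z" "z < y" "z \<in> K1 \<union> K2" using dense[of "y - 1" y] by auto
    have "z \<notin> K1" using i1[of z u y] u z yn by auto
    then have "z \<in> K2" using z by blast
    then have "u \<in> K2" using i2[OF _ x(2), of z u] lt[OF u(1)] u z by simp
    then show False using u dj by blast
  qed
  have right: "y \<in> K2" if y: "s < y" for y
  proof (rule ccontr)
    assume yn: "y \<notin> K2"
    have n1: "z \<notin> K1" if "s < z" for z using up that by force
    show False
    proof (cases "y < x2")
      case True
      obtain z where z: "s < z" "z < y" "z \<in> K1 \<union> K2" using dense[OF y] by auto
      then have "z \<in> K2" using n1 by blast
      then show False using i2[OF _ x(2), of z y] z True yn by simp
    next
      case False
      obtain z where z: "y < z" "z < y + 1" "z \<in> K1 \<union> K2" using dense[of y "y + 1"] by auto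
      then have "z \<in> K2" using n1[of z] y by auto
      then show False using i2[OF x(2), of z y] z False yn by simp
    qed
  qed
  have "s \<notin> K1"
  proof
    assume "s \<in> K1"
    then obtain e where e: "e > 0" "ball s e \<subseteq> K1" using op(1) openE by blast
    then have "s + e / 2 \<in> K1" by (auto simp: dist_real_def)
    then show False using up e(1) by force
  qed
  moreover have "s \<notin> K2"
  proof
    assume "s \<in> K2"
    then obtain e where e: "e > 0" "ball s e \<subseteq> K2" using op(2) openE by blast
    then have "s - e / 2 \<in> K2" by (auto simp: dist_real_def)
    then show False using left[of "s - e/2"] e(1) dj by auto
  qed
  ultimately have "\<forall>y. y \<notin> K1 \<union> K2 \<longleftrightarrow> y = s" using left right by (metis UnCI UnE linorder_neqE)
  then show ?thesis by blast
qed

lemma real_cube_at_cong: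
  assumes "real_cube_at G x" "\<And>z. 0 < Im z \<Longrightarrow> G' z = G z"
  shows "real_cube_at G' x"
  using assms unfolding real_cube_at_def by fastforce

lemma real_cube_at_shift:
  assumes "real_cube_at G (x + s)"
  shows "real_cube_at (\<lambda>z. G (z + of_real s)) x"
proof -
  obtain \<rho> c e where \<rho>: "\<rho> > 0" "c \<noteq> 0" "e holomorphic_on ball (of_real (x + s)) \<rho>"
    "\<And>z. z \<in> ball (of_real (x + s)) \<rho> \<Longrightarrow> e z \<noteq> 0 \<and> e (cnj z) = cnj (e z)"
    "\<And>z. z \<in> half_ball (x + s) \<rho> \<Longrightarrow> G z = c * e z ^ 3"
    using assms unfolding real_cube_at_def by blast
  have sh: "z + of_real s \<in> ball (complex_of_real (x + s)) \<rho>" if "z \<in> ball (complex_of_real x) \<rho>" for z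
    using that by (simp add: dist_norm)
  show ?thesis unfolding real_cube_at_def
  proof (intro exI[of _ \<rho>] exI[of _ c] exI[of _ "\<lambda>z. e (z + of_real s)"] conjI ballI)
    have "(e \<circ> (\<lambda>z. z + of_real s)) holomorphic_on ball (complex_of_real x) \<rho>"
      by (rule holomorphic_on_compose_gen[OF _ \<rho>(3)]) (use sh in \<open>auto intro!: holomorphic_intros\<close>)
    then show "(\<lambda>z. e (z + of_real s)) holomorphic_on ball (complex_of_real x) \<rho>" by (simp only: o_def)
    show "e (cnj z + of_real s) = cnj (e (z + of_real s))" if "z \<in> ball (complex_of_real x) \<rho>" for z
      using \<rho>(4)[OF sh[OF that]] by simp
    show "G (z + of_real s) = c * e (z + of_real s) ^ 3" if "z \<in> half_ball x \<rho>" for z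
      using \<rho>(5)[of "z + of_real s"] sh[of z] that by simp
  qed (use \<rho> sh in auto)
qed

section \<open>Corners as omitted boundary values\<close>

context straight_domain
begin

text \<open>Otherwise points of the disc converge to \<zeta> while their images under
  \<open>g\<close> stay away from the corners and accumulate at some \<open>l\<close>. If
  \<open>l\<close> is in \<open>D\<close>, then \<zeta> = f l lies inside the disc; if
  \<open>l\<close> is on an arc, then \<zeta> = bdry l. Both are excluded. This takes the place of
  continuity of \<open>g\<close> at \<zeta>.\<close>

lemma cluster:
  assumes \<zeta>: "norm \<zeta> = 1" "\<zeta> \<notin> bdry ` (A1 \<union> A2)" and e: "e > 0"
  shows "\<exists>d>0. \<forall>w. norm w < 1 \<longrightarrow> dist w \<zeta> < d \<longrightarrow> dist (g w) a < e \<or> dist (g w) b < e"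
proof (rule ccontr)
  assume "\<not> ?thesis"
  then have "\<exists>w. norm w < 1 \<and> dist w \<zeta> < inverse (real (Suc n)) \<and> \<not> dist (g w) a < e \<and> \<not> dist (g w) b < e" for n
    by (meson inverse_positive_iff_positive of_nat_0_less_iff zero_less_Suc)
  then obtain w where w: "\<And>n. norm (w n) < 1" "\<And>n. dist (w n) \<zeta> < inverse (real (Suc n))"
    "\<And>n. \<not> dist (g (w n)) a < e" "\<And>n. \<not> dist (g (w n)) b < e" by metis
  have w\<zeta>: "w \<longlonglongrightarrow> \<zeta>"
    by (rule metric_tendsto_imp_tendsto[OF LIMSEQ_inverse_real_of_nat])
       (use w(2) in \<open>auto simp: less_imp_le\<close>)
  have gD: "g (w n) \<in> D" "f (g (w n)) = w n" for n using gf[of "w n"] w(1)[of n] by auto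
  have "compact (closure D)" using boundedD by (simp add: compact_closure)
  moreover have "g (w n) \<in> closure D" for n by (rule subsetD[OF closure_subset gD(1)])
  ultimately obtain l r where l: "l \<in> closure D" and r: "strict_mono r" and lim: "((\<lambda>n. g (w n)) \<circ> r) \<longlonglongrightarrow> l"
    unfolding compact_def by metis
  have lim': "(\<lambda>n. g (w (r n))) \<longlonglongrightarrow> l" using lim by (simp add: o_def)
  have wr: "(\<lambda>n. w (r n)) \<longlonglongrightarrow> \<zeta>" using LIMSEQ_subseq_LIMSEQ[OF w\<zeta> r] by (simp add: o_def)
  have far: "l \<noteq> c" if c: "\<And>n. \<not> dist (g (w n)) c < e" for c
  proof
    assume "l = c"
    then have "\<forall>\<^sub>F n in sequentially. dist (g (w (r n))) c < e" using tendstoD[OF lim' e] by simp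
    then show False using c by (auto simp: eventually_sequentially)
  qed
  have lab: "l \<noteq> a" "l \<noteq> b" using far w(3,4) by blast+
  consider "l \<in> D" | "l \<in> A1 \<union> A2" using l lab frD closure_Un_frontier[of D] by auto
  then show False
  proof cases
    case 1
    then have "isCont f l" using f openD continuous_on_eq_continuous_at holomorphic_on_imp_continuous_on by blast
    then have "(\<lambda>n. f (g (w (r n)))) \<longlonglongrightarrow> f l" by (rule isCont_tendsto_compose[OF _ lim'])
    then have "(\<lambda>n. w (r n)) \<longlonglongrightarrow> f l" by (simp add: gD)
    then have "\<zeta> = f l" using wr LIMSEQ_unique by blast
    then show False using fg[OF 1] \<zeta>(1) by simp
  next
    case 2
    obtain \<psi> \<Theta> \<rho> c where ch: "disc_chart (A1 \<union> A2) l \<psi> \<Theta> \<rho> c"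
      using disc_chart_exists[OF subset_refl straight_union[OF 2]] by blast
    then have \<rho>: "0 \<in> ball (0::complex) \<rho>" "\<psi> 0 = l" unfolding disc_chart_def by auto
    have "(f \<longlongrightarrow> bdry l) (at l within D)"
      using disc_chart_tendsto[OF ch subset_refl \<rho>(1)] bdry_chart(2)[OF ch subset_refl \<rho>(1)] \<rho>(2) by simp
    moreover have "l \<notin> D" using frontier_facts 2 by blast
    then have "g (w n) \<noteq> l" for n using gD(1)[of n] by auto
    then have "filterlim (\<lambda>n. g (w (r n))) (at l within D) sequentially"
      using lim' gD(1) by (simp add: filterlim_at)
    ultimately have "(\<lambda>n. f (g (w (r n)))) \<longlonglongrightarrow> bdry l" by (rule filterlim_compose)
    then have "(\<lambda>n. w (r n)) \<longlonglongrightarrow> bdry l" by (simp add: gD)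
    then have "\<zeta> = bdry l" using wr LIMSEQ_unique by blast
    then show False using \<zeta>(2) 2 by blast
  qed
qed

text \<open>The circle is connected, so two disjoint nonempty open sets of boundary values cannot
  exhaust it.\<close>

lemma omitted_point:
  obtains \<zeta> where "norm \<zeta> = 1" "\<zeta> \<notin> bdry ` (A1 \<union> A2)"
proof -
  have o1: "openin (top_of_set (sphere 0 1)) (bdry ` A1)" by (rule bdry_open) (use str1 in auto)
  have o2: "openin (top_of_set (sphere 0 1)) (bdry ` A2)" by (rule bdry_open) (use str2 in auto)
  have "bdry ` A1 \<inter> bdry ` A2 = {}"
  proof -
    have "bdry p \<noteq> bdry q" if "p \<in> A1" "q \<in> A2" for p q
      using bdry_inj[of p q] that disj by blast
    then show ?thesis by blast
  qed
  moreover have "connected (sphere (0::complex) 1)" by (rule connected_sphere) simp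
  ultimately have "\<not> sphere 0 1 \<subseteq> bdry ` A1 \<union> bdry ` A2"
    using o1 o2 ne unfolding connected_openin by blast
  then obtain \<zeta> where "\<zeta> \<in> sphere 0 1" "\<zeta> \<notin> bdry ` A1 \<union> bdry ` A2" by blast
  then show ?thesis using that[of \<zeta>] unfolding image_Un by simp
qed

text \<open>
  The pullback of the differential to the upper half plane. The boundary value 1, which will be one
  of the omitted ones, is moved to infinity.
\<close>

definition F where "F z = g (inv_cayley z)"

definition G where "G z = poly P (F z) * deriv F z ^ 3"

lemma F_in_D: "0 < Im z \<Longrightarrow> F z \<in> D" "0 < Im z \<Longrightarrow> f (F z) = inv_cayley z"
  using gf[of "inv_cayley z"] norm_inv_cayley_less[of z] by (auto simp: F_def)

lemma F_holomorphic: "F holomorphic_on {z. 0 < Im z}"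
proof -
  have "(g \<circ> inv_cayley) holomorphic_on {z. 0 < Im z}"
    by (rule holomorphic_on_compose_gen[OF inv_cayley_holomorphic g]) (use norm_inv_cayley_less in auto)
  then show ?thesis by (simp add: F_def[abs_def] o_def)
qed

lemma F_ne: "0 < Im z \<Longrightarrow> F z \<noteq> a" "0 < Im z \<Longrightarrow> F z \<noteq> b"
  using F_in_D(1)[of z] frontier_facts(2)[of a] frontier_facts(2)[of b] by auto

lemma F_near_real:
  assumes "inv_cayley (of_real x) \<notin> bdry ` (A1 \<union> A2)" "e > 0"
  shows "\<exists>d>0. \<forall>z. 0 < Im z \<longrightarrow> dist z (of_real x) < d \<longrightarrow> dist (F z) a < e \<or> dist (F z) b < e"
proof -
  obtain d where d: "d > 0" "\<And>w. norm w < 1 \<Longrightarrow> dist w (inv_cayley (of_real x)) < d \<Longrightarrow> dist (g w) a < e \<or> dist (g w) b < e"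
    using cluster[OF norm_inv_cayley_real assms] by blast
  have "isCont inv_cayley (of_real x)" unfolding inv_cayley_def
    using plus_ii_nonzero[of "of_real x"] by (intro continuous_intros) auto
  then obtain d' where "d' > 0" "\<And>z. dist z (of_real x) < d' \<Longrightarrow> dist (inv_cayley z) (inv_cayley (of_real x)) < d"
    using d(1) unfolding continuous_at_eps_delta by blast
  then show ?thesis using d(2) norm_inv_cayley_less unfolding F_def by blast
qed

lemma F_near_infinity:
  assumes "1 \<notin> bdry ` (A1 \<union> A2)" "e > 0"
  shows "\<exists>R>0. \<forall>z. 0 < Im z \<longrightarrow> norm z > R \<longrightarrow> dist (F z) a < e \<or> dist (F z) b < e"
proof -
  obtain d where d: "d > 0" "\<And>w. norm w < 1 \<Longrightarrow> dist w 1 < d \<Longrightarrow> dist (g w) a < e \<or> dist (g w) b < e"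
    using cluster[of 1, OF _ assms] by auto
  \<comment> \<open>The radius \<open>2 / d + 1\<close> solves 2 / (|z| - 1) = d, the bound of
    \<open>dist_inv_cayley_1\<close>.\<close>
  have "dist (inv_cayley z) 1 < d" if z: "0 < Im z" "norm z > 2 / d + 1" for z
  proof -
    have "2 / d < norm z - 1" using z by simp
    moreover have "0 < 2 / d" using d(1) by simp
    ultimately have n0: "0 < norm z - 1" by linarith
    have n2: "2 < d * (norm z - 1)"
      using \<open>2 / d < norm z - 1\<close> d(1) by (simp add: pos_divide_less_eq mult.commute)
    note n1 = n0 n2
    have "dist (inv_cayley z) 1 \<le> 2 / (norm z - 1)" using dist_inv_cayley_1[OF z(1)] n1 by simp
    also have "\<dots> < d" using n1 by (simp add: pos_divide_less_eq)
    finally show ?thesis .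
  qed
  then show ?thesis using d norm_inv_cayley_less unfolding F_def
    by (intro exI[of _ "2 / d + 1"]) (auto intro: add_pos_pos)
qed

text \<open>\<open>S\<close> is the transition from the flat chart to the half plane coordinate: F
  (S w) = \<psi> w above the diameter, so the equation for \<psi> becomes G (S w) S'(w)^3 = c. The
  first hypothesis keeps \<Theta> away from the pole of the Cayley transform.\<close>

lemma G_real_cube:
  assumes one: "1 \<notin> bdry ` (A1 \<union> A2)" and x: "inv_cayley (of_real x) \<in> bdry ` (A1 \<union> A2)"
  shows "real_cube_at G x"
proof -
  obtain p where p: "p \<in> A1 \<union> A2" "inv_cayley (of_real x) = bdry p" using x by blast
  obtain \<psi> \<Theta> r c where ch: "disc_chart (A1 \<union> A2) p \<psi> \<Theta> r c"
    using disc_chart_exists[OF subset_refl straight_union[OF p(1)]] by blast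
  have r: "r > 0" "0 \<in> ball (0::complex) r" "\<psi> 0 = p" "c \<noteq> 0" "\<psi> holomorphic_on ball 0 r" "\<Theta> holomorphic_on ball 0 r"
    using ch unfolding disc_chart_def by auto
  have \<Theta>1: "\<Theta> w \<noteq> 1" if w: "w \<in> ball 0 r" for w
  proof
    assume 1: "\<Theta> w = 1"
    then have "Im w = 0" using disc_chart_norm(2)[OF ch w] by simp
    then show False using bdry_chart[OF ch subset_refl w] 1 one by force
  qed
  define S where "S w = cayley (\<Theta> w)" for w
  have "(cayley \<circ> \<Theta>) holomorphic_on ball 0 r"
    by (rule holomorphic_on_compose_gen[OF r(6) cayley_holomorphic[of "- {1}"]]) (use \<Theta>1 in auto)
  then have S: "S holomorphic_on ball 0 r" by (simp add: S_def[abs_def] o_def)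
  have S0: "S 0 = of_real x"
    using bdry_chart(2)[OF ch subset_refl r(2)] r(3) p(2) cayley_inv_cayley[of "of_real x"] by (simp add: S_def)
  have sym: "S (cnj w) = cnj (S w)" if w: "w \<in> ball 0 r" for w
  proof -
    have "\<Theta> (cnj w) = 1 / cnj (\<Theta> w)" "\<Theta> w \<noteq> 0" using ch w unfolding disc_chart_def by auto
    then show ?thesis using cayley_reflect[OF _ \<Theta>1[OF w]] by (simp add: S_def)
  qed
  have up: "0 < Im (S w)" if w: "w \<in> ball 0 r" "0 < Im w" for w
  proof -
    have "norm (\<Theta> w) < 1" using disc_chart_norm(1)[OF ch w(1)] w(2) by blast
    then have "norm (\<Theta> w) ^ 2 < 1" by (simp add: power_less_one_iff)
    then show ?thesis using \<Theta>1[OF w(1)] by (simp add: S_def Im_cayley)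
  qed
  have FS: "F (S w) = \<psi> w" if w: "w \<in> half_ball 0 r" for w
  proof -
    have "\<Theta> w = f (\<psi> w)" "\<psi> w \<in> D" using ch w unfolding disc_chart_def by auto
    then show ?thesis using inv_cayley_cayley[OF \<Theta>1[of w]] fg w by (simp add: S_def F_def)
  qed
  have GS: "G (S w) * deriv S w ^ 3 = c" if w: "w \<in> ball 0 r" "0 < Im w" for w
  proof -
    have wH: "w \<in> half_ball 0 r" using w by simp
    have "(F has_field_derivative deriv F (S w)) (at (S w))"
      by (rule holomorphic_derivI[OF F_holomorphic open_halfspace_Im_gt]) (use up[OF w] in simp)
    then have "((\<lambda>w. F (S w)) has_field_derivative deriv F (S w) * deriv S w) (at w)"
      by (rule DERIV_chain2[OF _ holomorphic_derivI[OF S open_ball w(1)]])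
    then have "(\<psi> has_field_derivative deriv F (S w) * deriv S w) (at w)"
      by (rule has_field_derivative_transform_within_open[OF _ open_half_ball wH]) (rule FS)
    then have "deriv \<psi> w = deriv F (S w) * deriv S w" by (rule DERIV_imp_deriv)
    moreover have "poly P (\<psi> w) * deriv \<psi> w ^ 3 = c" using ch w unfolding disc_chart_def by blast
    ultimately show ?thesis unfolding G_def FS[OF wH] by (simp add: power_mult_distrib mult.assoc)
  qed
  show ?thesis by (rule real_cube_at_chart[OF r(1) S S0 r(4) sym up GS])
qed

text \<open>Over an interval of omitted values \<open>F\<close> accumulates only at \<open>a\<close>
  and \<open>b\<close>, perhaps at both in turn, but the product (F - a)(F - b) tends to 0 there. It
  would vanish identically, while \<open>F\<close> omits both values.\<close>

lemma F_dense:
  assumes "u < v"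
  shows "\<exists>y. u < y \<and> y < v \<and> inv_cayley (of_real y) \<in> bdry ` (A1 \<union> A2)"
proof (rule ccontr)
  assume n: "\<not> ?thesis"
  define x where "x = (u + v) / 2"
  define r where "r = (v - u) / 2"
  have r: "r > 0" using assms by (simp add: r_def)
  have uv: "u < y \<and> y < v" if "\<bar>y - x\<bar> < r" for y
    using that unfolding x_def r_def by (auto simp: abs_less_iff field_simps)
  define h where "h z = (F z - a) * (F z - b)" for z
  have sub: "half_ball x r \<subseteq> {z. 0 < Im z}" by auto
  have "h holomorphic_on half_ball x r" unfolding h_def
    by (intro holomorphic_intros holomorphic_on_subset[OF F_holomorphic sub])
  moreover have "(h \<longlongrightarrow> 0) (at y within {z. 0 < Im z})" if y: "y \<in> ball (of_real x) r" "Im y = 0" for y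
  proof -
    have yr: "y = of_real (Re y)" using y(2) by (simp add: complex_eq_iff)
    have "\<bar>Re y - x\<bar> \<le> norm (y - of_real x)" using abs_Re_le_cmod[of "y - of_real x"] by simp
    then have "\<bar>Re y - x\<bar> < r" using y(1) by (simp add: dist_norm norm_minus_commute)
    then have nb: "inv_cayley (of_real (Re y)) \<notin> bdry ` (A1 \<union> A2)" using n uv by blast
    obtain B where B: "B > 0" "\<And>z. z \<in> D \<Longrightarrow> norm z \<le> B" using boundedD bounded_pos by blast
    \<comment> \<open>\<open>C\<close> bounds whichever factor is not the small one.\<close>
    define C where "C = B + norm a + norm b"
    have C: "C > 0" using B(1) by (simp add: C_def add_pos_nonneg)
    show ?thesis
    proof (rule tendstoI)
      fix e :: real assume e: "e > 0"
      then have "e / C > 0" using C by simp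
      then obtain d where d: "d > 0" "\<And>z. 0 < Im z \<Longrightarrow> dist z y < d \<Longrightarrow> dist (F z) a < e / C \<or> dist (F z) b < e / C"
        using F_near_real[OF nb] yr by metis
      have "norm (h z) < e" if z: "0 < Im z" "dist z y < d" for z
      proof -
        have FB: "norm (F z) \<le> B" using B(2) F_in_D(1) z(1) by blast
        have ba: "norm (F z - a) \<le> C" "norm (F z - b) \<le> C"
          using norm_triangle_ineq4[of "F z" a] norm_triangle_ineq4[of "F z" b] FB norm_ge_zero[of a] norm_ge_zero[of b]
          unfolding C_def by linarith+
        have nz: "0 < norm (F z - a)" "0 < norm (F z - b)" using F_ne[OF z(1)] by auto
        from d(2)[OF z] show ?thesis
        proof
          assume "dist (F z) a < e / C"
          then have "norm (F z - a) * norm (F z - b) < (e / C) * C"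
            using ba(2) nz C by (intro mult_less_le_imp_less) (auto simp: dist_norm)
          then show ?thesis using C by (simp add: h_def norm_mult)
        next
          assume "dist (F z) b < e / C"
          then have "norm (F z - b) * norm (F z - a) < (e / C) * C"
            using ba(1) nz C by (intro mult_less_le_imp_less) (auto simp: dist_norm)
          then show ?thesis using C by (simp add: h_def norm_mult mult.commute)
        qed
      qed
      then show "\<forall>\<^sub>F z in at y within {z. 0 < Im z}. dist (h z) 0 < e"
        unfolding eventually_at using d(1) by (intro exI[of _ d]) auto
    qed
  qed
  moreover obtain z where z: "z \<in> half_ball x r" using half_ball_nonempty[OF r] by blast
  ultimately have "h z = 0" using zero_boundary_values[OF r] by blast
  then show False using F_ne[of z] z by (simp add: h_def)
qed

end

section \<open>The two arcs on the real line\<close>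

context straight_domain
begin

text \<open>Connectedness passes through the Cayley transform, which is continuous on the boundary
  values because 1 is omitted; so an arc becomes a single open interval instead of two pieces around
  infinity.\<close>

lemma bdry_line_props:
  assumes A: "A \<subseteq> A1 \<union> A2" "connected A" "A \<noteq> {}" and straight: "\<forall>p\<in>A. straight_boundary P D A p"
    and one: "1 \<notin> bdry ` (A1 \<union> A2)"
  shows "open {x::real. inv_cayley (of_real x) \<in> bdry ` A}"
    "connected {x::real. inv_cayley (of_real x) \<in> bdry ` A}"
    "{x::real. inv_cayley (of_real x) \<in> bdry ` A} \<noteq> {}"
proof -
  let ?K = "{x::real. inv_cayley (of_real x) \<in> bdry ` A}"
  have st: "straight_boundary P D A p" if "p \<in> A" for p using straight that by blast
  have one': "1 \<notin> bdry ` A" using one A(1) by blast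
  have n1: "norm \<zeta> = 1" if "\<zeta> \<in> bdry ` A" for \<zeta>
    using that norm_bdry[OF A(1) st] by blast
  obtain U where U: "open U" "bdry ` A = sphere 0 1 \<inter> U"
    using bdry_open[OF A(1) st] unfolding openin_open by blast
  have "?K = (\<lambda>x. inv_cayley (of_real x)) -` U"
    using U(2) norm_inv_cayley_real by auto
  moreover have "continuous_on UNIV (\<lambda>x::real. inv_cayley (of_real x))"
    unfolding inv_cayley_def by (intro continuous_intros) (use plus_ii_nonzero in auto)
  ultimately show "open ?K" using U(1) open_vimage by metis
  have eq: "?K = (\<lambda>\<zeta>. Re (cayley \<zeta>)) ` (bdry ` A)"
  proof (intro equalityI subsetI)
    fix x assume "x \<in> ?K"
    then have "inv_cayley (of_real x) \<in> bdry ` A" by simp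
    moreover have "x = Re (cayley (inv_cayley (of_real x)))" by (simp add: cayley_inv_cayley)
    ultimately show "x \<in> (\<lambda>\<zeta>. Re (cayley \<zeta>)) ` (bdry ` A)" by (rule rev_image_eqI)
  next
    fix x assume "x \<in> (\<lambda>\<zeta>. Re (cayley \<zeta>)) ` (bdry ` A)"
    then obtain \<zeta> where \<zeta>: "\<zeta> \<in> bdry ` A" "x = Re (cayley \<zeta>)" by blast
    then have "\<zeta> \<noteq> 1" using one' by auto
    have "Im (cayley \<zeta>) = 0" using n1[OF \<zeta>(1)] by (simp add: Im_cayley)
    then have "of_real x = cayley \<zeta>" using \<zeta>(2) by (simp add: complex_eq_iff)
    then show "x \<in> ?K" using inv_cayley_cayley[OF \<open>\<zeta> \<noteq> 1\<close>] \<zeta>(1) by simp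
  qed
  have "continuous_on (bdry ` A) cayley"
    using cayley_holomorphic[OF one'] by (rule holomorphic_on_imp_continuous_on)
  then have "continuous_on (bdry ` A) (\<lambda>\<zeta>. Re (cayley \<zeta>))" by (intro continuous_intros)
  moreover have "connected (bdry ` A)"
    using connected_continuous_image[OF bdry_continuous[OF A(1) st] A(2)] by blast
  ultimately show "connected ?K" unfolding eq by (rule connected_continuous_image)
  show "?K \<noteq> {}" unfolding eq using A(3) by blast
qed

text \<open>The arcs become two open intervals that leave out one point \<open>s\<close>; together
  with infinity this accounts for both ends. A translation moves \<open>s\<close> to 0 and an
  inversion brings infinity to 0, so that one decay estimate serves both.\<close>

lemma one_not_omitted:
  assumes one: "1 \<notin> bdry ` (A1 \<union> A2)"
  shows False
proof -
  define K1 where "K1 = {x::real. inv_cayley (of_real x) \<in> bdry ` A1}"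
  define K2 where "K2 = {x::real. inv_cayley (of_real x) \<in> bdry ` A2}"
  have "\<forall>p\<in>A1. straight_boundary P D A1 p" "\<forall>p\<in>A2. straight_boundary P D A2 p" using str1 str2 by auto
  note k1 = bdry_line_props[OF Un_upper1 conn(1) ne(1) this(1) one, folded K1_def]
    and k2 = bdry_line_props[OF Un_upper2 conn(2) ne(2) this(2) one, folded K2_def]
  have dj: "K1 \<inter> K2 = {}"
  proof -
    have "bdry p \<noteq> bdry q" if "p \<in> A1" "q \<in> A2" for p q using bdry_inj[of p q] that disj by blast
    then have "bdry ` A1 \<inter> bdry ` A2 = {}" by blast
    then show ?thesis unfolding K1_def K2_def by auto
  qed
  have K: "y \<in> K1 \<union> K2 \<longleftrightarrow> inv_cayley (of_real y) \<in> bdry ` (A1 \<union> A2)" for y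
    unfolding K1_def K2_def by blast
  have dense: "\<exists>y. u < y \<and> y < v \<and> y \<in> K1 \<union> K2" if "u < v" for u v
    using F_dense[OF that] K by blast
  obtain x1 x2 where x: "x1 \<in> K1" "x2 \<in> K2" using k1(3) k2(3) by blast
  then have "x1 \<noteq> x2" using dj by blast
  then have "\<exists>s. \<forall>y. y \<notin> K1 \<union> K2 \<longleftrightarrow> y = s"
  proof (cases rule: linorder_neqE)
    assume "x1 < x2"
    then show ?thesis
      by (rule complement_two_intervals[OF k1(1) k2(1) k1(2) k2(2) dj x _ dense])
  next
    assume "x2 < x1"
    have "\<exists>s. \<forall>y. y \<notin> K2 \<union> K1 \<longleftrightarrow> y = s"
    proof (rule complement_two_intervals[OF k2(1) k1(1) k2(2) k1(2) _ x(2,1) \<open>x2 < x1\<close>])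
      show "\<exists>y. u < y \<and> y < v \<and> y \<in> K2 \<union> K1" if "u < v" for u v
        using dense[OF that] by (simp add: Un_commute)
    qed (use dj in blast)
    then show ?thesis by (simp add: Un_commute)
  qed
  then obtain s where s: "\<And>y. y \<notin> K1 \<union> K2 \<longleftrightarrow> y = s" by blast
  have cube: "real_cube_at G y" if "y \<noteq> s" for y
    using G_real_cube[OF one] s[of y] K[of y] that by blast
  define F2 where "F2 z = F (z + of_real s)" for z
  define G2 where "G2 z = poly P (F2 z) * deriv F2 z ^ 3" for z
  have F2D: "F2 z \<in> D" if "0 < Im z" for z using F_in_D(1) that by (simp add: F2_def)
  have F2ab: "F2 z \<noteq> a" "F2 z \<noteq> b" if "0 < Im z" for z using F_ne that by (simp_all add: F2_def)
  have F2der: "(F2 has_field_derivative deriv F (z + of_real s)) (at z)" if z: "0 < Im z" for z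
  proof -
    have "(F has_field_derivative deriv F (z + of_real s)) (at (z + of_real s))"
      by (rule holomorphic_derivI[OF F_holomorphic open_halfspace_Im_gt]) (use z in simp)
    then have "((\<lambda>z. F (z + of_real s)) has_field_derivative deriv F (z + of_real s) * 1) (at z)"
      by (rule DERIV_chain2) (auto intro!: derivative_eq_intros)
    then show ?thesis by (simp add: F2_def[abs_def])
  qed
  have F2h: "F2 holomorphic_on {z. 0 < Im z}"
    using F2der by (subst holomorphic_on_open) (auto simp: open_halfspace_Im_gt)
  have G2eq: "G2 z = G (z + of_real s)" if "0 < Im z" for z
    using DERIV_imp_deriv[OF F2der[OF that]] by (simp add: G2_def G_def F2_def)
  have cube2: "real_cube_at G2 x" if "x \<noteq> 0" for x
    using real_cube_at_cong[OF real_cube_at_shift[OF cube[of "x + s"]] G2eq] that by simp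
  have near2: "\<exists>d>0. \<forall>z. 0 < Im z \<longrightarrow> norm z < d \<longrightarrow> dist (F2 z) a < e \<or> dist (F2 z) b < e" if e: "e > 0" for e
  proof -
    obtain d where d: "d > 0" "\<And>z. 0 < Im z \<Longrightarrow> dist z (of_real s) < d \<Longrightarrow> dist (F z) a < e \<or> dist (F z) b < e"
      using F_near_real[OF _ e, of s] s[of s] K[of s] by blast
    have "dist (F2 z) a < e \<or> dist (F2 z) b < e" if "0 < Im z" "norm z < d" for z
      unfolding F2_def by (rule d(2)) (use that in \<open>auto simp: dist_norm\<close>)
    then show ?thesis using d(1) by blast
  qed
  define F3 where "F3 z = F2 (- 1 / z)" for z
  define G3 where "G3 z = poly P (F3 z) * deriv F3 z ^ 3" for z
  have F3der: "(F3 has_field_derivative deriv F2 (- 1 / z) / z ^ 2) (at z)" if z: "0 < Im z" for z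
  proof -
    have z0: "z \<noteq> 0" using z by auto
    have "(F2 has_field_derivative deriv F2 (- 1 / z)) (at (- 1 / z))"
      by (rule holomorphic_derivI[OF F2h open_halfspace_Im_gt]) (use Im_minus_inverse_pos[OF z] in simp)
    moreover have "((\<lambda>z. - 1 / z) has_field_derivative 1 / z ^ 2) (at z)"
      using z0 by (auto intro!: derivative_eq_intros simp: power2_eq_square)
    ultimately have "((\<lambda>z. F2 (- 1 / z)) has_field_derivative deriv F2 (- 1 / z) * (1 / z ^ 2)) (at z)"
      by (rule DERIV_chain2)
    then show ?thesis by (simp add: F3_def[abs_def])
  qed
  have F3h: "F3 holomorphic_on {z. 0 < Im z}"
    using F3der by (subst holomorphic_on_open) (auto simp: open_halfspace_Im_gt)
  have G3eq: "G3 z = G2 (- 1 / z) / z ^ 6" if "0 < Im z" for z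
    using DERIV_imp_deriv[OF F3der[OF that]] by (simp add: G3_def G2_def F3_def power_divide flip: power_mult)
  have cube3: "real_cube_at G3 x" if x: "x \<noteq> 0" for x
  proof -
    have "real_cube_at (\<lambda>z. G2 (- 1 / z) / z ^ 6) (- 1 / (- 1 / x))"
      by (rule real_cube_at_inversion[OF cube2]) (use x in auto)
    then show ?thesis using real_cube_at_cong[OF _ G3eq] by simp
  qed
  have F3ab: "F3 z \<noteq> a" "F3 z \<noteq> b" if "0 < Im z" for z
    using F2ab[OF Im_minus_inverse_pos[OF that]] by (simp_all add: F3_def)
  have near3: "\<exists>d>0. \<forall>z. 0 < Im z \<longrightarrow> norm z < d \<longrightarrow> dist (F3 z) a < e \<or> dist (F3 z) b < e" if e: "e > 0" for e
  proof -
    obtain R where R: "R > 0" "\<And>z. 0 < Im z \<Longrightarrow> norm z > R \<Longrightarrow> dist (F z) a < e \<or> dist (F z) b < e"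
      using F_near_infinity[OF one e] by blast
    \<comment> \<open>The translation by \<open>s\<close> may lower the modulus by |s|; hence R +
      |s|.\<close>
    define d where "d = 1 / (R + \<bar>s\<bar>)"
    have d: "d > 0" using R(1) by (simp add: d_def add_pos_nonneg)
    have "dist (F3 z) a < e \<or> dist (F3 z) b < e" if z: "0 < Im z" "norm z < d" for z
      unfolding F3_def F2_def
    proof (rule R(2))
      show "0 < Im (- 1 / z + of_real s)" using Im_minus_inverse_pos[OF z(1)] by simp
      have z0: "norm z > 0" using z(1) by auto
      have "norm z * (R + \<bar>s\<bar>) < 1"
        using z(2) R(1) unfolding d_def by (simp add: pos_less_divide_eq add_pos_nonneg)
      then have "R + \<bar>s\<bar> < 1 / norm z" using z0 by (simp add: pos_less_divide_eq mult.commute)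
      also have "\<dots> = norm (- 1 / z)" by (simp add: norm_divide)
      finally have "R + \<bar>s\<bar> < norm (- 1 / z)" .
      moreover have "norm (- 1 / z) - norm (complex_of_real s) \<le> norm (- 1 / z + of_real s)"
        by (rule norm_diff_ineq)
      ultimately show "R < norm (- 1 / z + of_real s)" by simp
    qed
    then show ?thesis using d by blast
  qed
  \<comment> \<open>Either corner may be approached at either end; c2 = c3 is not excluded at this
    stage.\<close>
  obtain c2 where c2: "c2 = a \<or> c2 = b" "(F2 \<longlongrightarrow> c2) (at 0 within {z. 0 < Im z})"
    using two_valued_limit[OF holomorphic_on_imp_continuous_on[OF F2h] near2] by blast
  obtain c3 where c3: "c3 = a \<or> c3 = b" "(F3 \<longlongrightarrow> c3) (at 0 within {z. 0 < Im z})"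
    using two_valued_limit[OF holomorphic_on_imp_continuous_on[OF F3h] near3] by blast
  have F2c: "F2 z \<noteq> c2" and F3c: "F3 z \<noteq> c3" if "0 < Im z" for z
    using c2(1) c3(1) F2ab[OF that] F3ab[OF that] by auto
  have dec2: "\<exists>d>0. \<forall>z. 0 < Im z \<longrightarrow> norm z < d \<longrightarrow> norm (G2 z * z ^ 3) < e" if "e > 0" for e
    using pullback_decay[OF P0 F2h F2c c2(2) cube2[unfolded G2_def[abs_def]] that] by (simp add: G2_def)
  have dec3: "\<exists>d>0. \<forall>z. 0 < Im z \<longrightarrow> norm z < d \<longrightarrow> norm (G3 z * z ^ 3) < e" if "e > 0" for e
    using pullback_decay[OF P0 F3h F3c c3(2) cube3[unfolded G3_def[abs_def]] that] by (simp add: G3_def)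
  have inf2: "\<exists>R>0. \<forall>z. 0 < Im z \<longrightarrow> norm z > R \<longrightarrow> norm (G2 z * z ^ 3) < e" if e: "e > 0" for e
  proof -
    obtain d where d: "d > 0" "\<And>z. 0 < Im z \<Longrightarrow> norm z < d \<Longrightarrow> norm (G3 z * z ^ 3) < e"
      using dec3[OF e] by blast
    have "norm (G2 z * z ^ 3) < e" if z: "0 < Im z" "norm z > 1 / d" for z
    proof -
      define y where "y = - 1 / z"
      have z0: "z \<noteq> 0" using z(1) by auto
      have y: "0 < Im y" unfolding y_def by (rule Im_minus_inverse_pos[OF z(1)])
      have zy: "z = - 1 / y" using z0 by (simp add: y_def)
      have "norm y = 1 / norm z" by (simp add: y_def norm_divide)
      moreover have "0 < norm z" "1 < norm z * d" using z(2) d(1) z0 by (auto simp: pos_divide_less_eq)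
      ultimately have "norm y < d" by (simp add: pos_divide_less_eq mult.commute)
      then have "norm (G3 y * y ^ 3) < e" using d(2) y by blast
      \<comment> \<open>The inversion takes the field z d/dz to -y d/dy; the sign is the cube of
        -1.\<close>
      moreover have "G3 y * y ^ 3 = - (G2 z * z ^ 3)"
      proof -
        have y0: "y \<noteq> 0" using y by auto
        have g: "G3 y = G2 z / y ^ 6" using G3eq[OF y] by (simp only: zy[symmetric])
        have z3: "z ^ 3 = - (1 / y ^ 3)" unfolding zy by (simp add: power_divide)
        have y6: "y ^ 6 = y ^ 3 * y ^ 3" by (simp flip: power_add)
        have "G3 y * y ^ 3 = G2 z / (y ^ 3 * y ^ 3) * y ^ 3" by (simp only: g y6)
        also have "\<dots> = G2 z / y ^ 3"
        proof -
          have "u / (q * q) * q = u / q" if "q \<noteq> 0" for u q :: complex using that by simp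
          then show ?thesis using y0 power_not_zero by blast
        qed
        also have "\<dots> = - (G2 z * z ^ 3)" unfolding z3 by simp
        finally show ?thesis .
      qed
      ultimately show ?thesis by (metis norm_minus_cancel)
    qed
    then show ?thesis using d(1) by (intro exI[of _ "1 / d"]) auto
  qed
  have G2h: "G2 holomorphic_on {z. 0 < Im z}"
    unfolding G2_def by (intro holomorphic_intros F2h open_halfspace_Im_gt)
  show False
  proof -
    \<comment> \<open>A boundary point with \<open>real_cube_at\<close> supplies points where
      \<open>G2\<close> is not zero.\<close>
    have c: "real_cube_at G2 1" by (rule cube2) simp
    obtain \<rho> c' e where \<rho>: "\<rho> > 0" "c' \<noteq> 0" "\<And>z. z \<in> ball (of_real 1) \<rho> \<Longrightarrow> e z \<noteq> 0"
      "\<And>z. z \<in> half_ball 1 \<rho> \<Longrightarrow> G2 z = c' * e z ^ 3"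
      using c unfolding real_cube_at_def by metis
    obtain z0 where z0: "z0 \<in> half_ball 1 \<rho>" using half_ball_nonempty[OF \<rho>(1)] by blast
    have "G2 z0 \<noteq> 0" using \<rho>(4)[OF z0] \<rho>(3)[of z0] \<rho>(2) z0 by auto
    then show False
      using no_flat_half_plane[OF G2h cube2 dec2 inf2 _ \<open>G2 z0 \<noteq> 0\<close>] z0 by blast
  qed
qed

end

text \<open>
  After a rotation of the disc, the point 1 is not a boundary value on the two arcs.
\<close>

theorem no_straight_domain:
  fixes P :: "complex poly"
  assumes P0: "P \<noteq> 0" and D: "open D" "bounded D" "simply_connected D" "D \<noteq> {}"
    and frD: "frontier D = A1 \<union> A2 \<union> {a, b}" and disj: "A1 \<inter> A2 = {}"
    and conn: "connected A1" "connected A2" and ne: "A1 \<noteq> {}" "A2 \<noteq> {}"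
    and str1: "\<And>p. p \<in> A1 \<Longrightarrow> straight_boundary P D A1 p"
    and str2: "\<And>p. p \<in> A2 \<Longrightarrow> straight_boundary P D A2 p"
  shows False
proof -
  have "D \<noteq> UNIV" using D(2) not_bounded_UNIV by metis
  then obtain f g where fg: "f holomorphic_on D" "g holomorphic_on ball 0 1"
    "\<And>z. z \<in> D \<Longrightarrow> f z \<in> ball 0 1 \<and> g (f z) = z" "\<And>w. w \<in> ball 0 1 \<Longrightarrow> g w \<in> D \<and> f (g w) = w"
    using simply_connected_eq_biholomorphic_to_disc[OF D(1)] D(3,4) by blast
  interpret S: straight_domain P D A1 A2 a b f g
    by unfold_locales (use assms fg in auto)
  obtain \<zeta> where \<zeta>: "norm \<zeta> = 1" "\<zeta> \<notin> S.bdry ` (A1 \<union> A2)" by (rule S.omitted_point)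
  have \<zeta>0: "\<zeta> \<noteq> 0" using \<zeta>(1) by auto
  define f' where "f' z = f z / \<zeta>" for z
  define g' where "g' w = g (\<zeta> * w)" for w
  have f': "f' holomorphic_on D" unfolding f'_def using \<zeta>0 by (intro holomorphic_intros fg(1)) auto
  have "(g \<circ> (\<lambda>w. \<zeta> * w)) holomorphic_on ball 0 1"
    by (rule holomorphic_on_compose_gen[OF _ fg(2)]) (auto intro!: holomorphic_intros simp: norm_mult \<zeta>(1))
  then have g': "g' holomorphic_on ball 0 1" by (simp add: g'_def[abs_def] o_def)
  have fg': "f' z \<in> ball 0 1 \<and> g' (f' z) = z" if "z \<in> D" for z
    using fg(3)[OF that] \<zeta>0 \<zeta>(1) by (simp add: f'_def g'_def norm_divide)
  have gf': "g' w \<in> D \<and> f' (g' w) = w" if "w \<in> ball 0 1" for w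
    using fg(4)[of "\<zeta> * w"] that \<zeta>0 \<zeta>(1) by (simp add: f'_def g'_def norm_mult)
  interpret S': straight_domain P D A1 A2 a b f' g'
    by unfold_locales (use assms f' g' fg' gf' in auto)
  have "S'.bdry p = S.bdry p / \<zeta>" if p: "p \<in> A1 \<union> A2" for p
  proof -
    obtain \<psi> \<Theta> r c where ch: "S.disc_chart (A1 \<union> A2) p \<psi> \<Theta> r c"
      using S.disc_chart_exists[OF subset_refl S.straight_union[OF p]] by blast
    then have r: "0 \<in> ball (0::complex) r" "\<psi> 0 = p" unfolding S.disc_chart_def by auto
    have "(f \<longlongrightarrow> S.bdry p) (at p within D)"
      using S.disc_chart_tendsto[OF ch subset_refl r(1)] S.bdry_chart(2)[OF ch subset_refl r(1)] r(2) by simp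
    then have "(f' \<longlongrightarrow> S.bdry p / \<zeta>) (at p within D)"
      unfolding f'_def using \<zeta>0 by (intro tendsto_intros)
    then show ?thesis by (rule S'.bdry_eqI[OF _ p])
  qed
  then have "1 \<notin> S'.bdry ` (A1 \<union> A2)" using \<zeta>(2) \<zeta>0 by force
  then show False by (rule S'.one_not_omitted)
qed

section \<open>Trajectories and Jordan curves\<close>

text \<open>The arc A is straight at p, and K is the remaining part of the curve.\<close>

definition straight_arc_at :: "complex poly \<Rightarrow> complex set \<Rightarrow> complex set \<Rightarrow> complex \<Rightarrow> bool" where
  "straight_arc_at P A K p \<longleftrightarrow>
     (\<exists>\<psi> r c. r > 0 \<and> \<psi> holomorphic_on ball 0 r \<and> inj_on \<psi> (ball 0 r) \<and> \<psi> 0 = p \<and> c \<noteq> 0 \<and>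
        (\<forall>w\<in>ball 0 r. poly P (\<psi> w) * deriv \<psi> w ^ 3 = c \<and> (\<psi> w \<in> A \<longleftrightarrow> Im w = 0) \<and> \<psi> w \<notin> K))"

text \<open>The chart takes \<open>g\<close> near \<tau> to a segment, which an affine map puts on
  the real axis. The rest of the curve and \<open>K\<close> are closed and miss
  \<open>g \<tau>\<close>, so in a small disc the diameter is all that is seen of the arc.\<close>

lemma trajectory_straight_arc_at:
  assumes tr: "trajectory P g" and st: "0 \<le> s" "t \<le> 1" and \<tau>: "\<tau> \<in> {s<..<t}"
    and inj: "\<And>u. u \<in> {s..t} \<Longrightarrow> g u = g \<tau> \<Longrightarrow> u = \<tau>" and K: "closed K" "g \<tau> \<notin> K"
  shows "straight_arc_at P (g ` {s<..<t}) K (g \<tau>)"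
proof -
  have pg: "continuous_on {0..1} g" using tr unfolding trajectory_def path_def by blast
  have \<tau>01: "\<tau> \<in> {0<..<1}" using \<tau> st by auto
  then obtain U w e \<alpha> \<beta> where fc: "flat_chart P U w" and e: "e > 0" "{\<tau> - e<..<\<tau> + e} \<subseteq> {0<..<1}"
    "g ` {\<tau> - e<..<\<tau> + e} \<subseteq> U" and bij: "bij_betw (w \<circ> g) {\<tau> - e<..<\<tau> + e} (open_segment \<alpha> \<beta>)"
    using tr unfolding trajectory_def locally_straight_at_def by metis
  let ?J = "{\<tau> - e<..<\<tau> + e}"
  have U: "open U" "w holomorphic_on U" "inj_on w U" "\<And>z. z \<in> U \<Longrightarrow> deriv w z ^ 3 = poly P z"
    using fc unfolding flat_chart_def by auto
  have \<tau>J: "\<tau> \<in> ?J" using e(1) by simp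
  have img: "(w \<circ> g) ` ?J = open_segment \<alpha> \<beta>" using bij by (rule bij_betw_imp_surj_on)
  have \<alpha>\<beta>: "\<alpha> \<noteq> \<beta>" using img \<tau>J by auto
  define q where "q u = Re ((w (g u) - \<alpha>) / (\<beta> - \<alpha>))" for u
  have q: "w (g u) = \<alpha> + (\<beta> - \<alpha>) * of_real (q u)" "0 < q u" "q u < 1" if "u \<in> ?J" for u
  proof -
    have "w (g u) \<in> open_segment \<alpha> \<beta>" using img that by auto
    then obtain k where k: "0 < k" "k < 1" "w (g u) = (1 - k) *\<^sub>R \<alpha> + k *\<^sub>R \<beta>" unfolding in_segment by blast
    then have "w (g u) - \<alpha> = of_real k * (\<beta> - \<alpha>)" by (simp add: scaleR_conv_of_real algebra_simps)
    then have "(w (g u) - \<alpha>) / (\<beta> - \<alpha>) = of_real k" using \<alpha>\<beta> by simp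
    then have "q u = k" by (simp add: q_def)
    then show "w (g u) = \<alpha> + (\<beta> - \<alpha>) * of_real (q u)" "0 < q u" "q u < 1"
      using k by (auto simp: scaleR_conv_of_real algebra_simps)
  qed
  have gJ: "continuous_on ?J g" by (rule continuous_on_subset[OF pg]) (use e(2) in auto)
  have "continuous_on (g ` ?J) w"
    by (rule continuous_on_subset[OF holomorphic_on_imp_continuous_on[OF U(2)] e(3)])
  then have "continuous_on ?J (\<lambda>u. w (g u))" using continuous_on_compose[OF gJ] by (simp add: o_def)
  then have qc: "continuous_on ?J q" unfolding q_def by (intro continuous_intros) (use \<alpha>\<beta> in auto)
  have qinj: "inj_on q ?J"
  proof (rule inj_onI)
    fix u v assume uv: "u \<in> ?J" "v \<in> ?J" "q u = q v"
    then have "w (g u) = w (g v)" using q(1) by simp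
    then show "u = v" using bij uv(1,2) unfolding bij_betw_def inj_on_def by auto
  qed
  have qimg: "q ` ?J = {0<..<1}"
  proof (intro equalityI subsetI)
    fix x assume x: "x \<in> {0<..<1::real}"
    then have "(1 - x) *\<^sub>R \<alpha> + x *\<^sub>R \<beta> \<in> open_segment \<alpha> \<beta>" using \<alpha>\<beta> unfolding in_segment by auto
    then have "(1 - x) *\<^sub>R \<alpha> + x *\<^sub>R \<beta> \<in> (w \<circ> g) ` ?J" by (simp only: img)
    then obtain u where u: "u \<in> ?J" "(1 - x) *\<^sub>R \<alpha> + x *\<^sub>R \<beta> = (w \<circ> g) u" by blast
    then have "w (g u) = (1 - x) *\<^sub>R \<alpha> + x *\<^sub>R \<beta>" by simp
    then have "w (g u) - \<alpha> = of_real x * (\<beta> - \<alpha>)"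
      by (simp add: scaleR_conv_of_real algebra_simps)
    then have "q u = x" using \<alpha>\<beta> by (simp add: q_def)
    then show "x \<in> q ` ?J" using u(1) by blast
  qed (use q in auto)
  \<comment> \<open>The local parameter \<open>q\<close> has a continuous inverse, so points of the
    segment close to \<open>w (g \<tau>)\<close> come from parameters in
    \<open>{s<..<t}\<close>.\<close>
  obtain k where k: "homeomorphism ?J {0<..<1} q k"
    using homeomorphism_into_1d[OF _ qc qimg qinj] by (auto simp: convex_imp_path_connected)
  have kc: "continuous_on {0<..<1} k" "\<And>x. x \<in> {0<..<1} \<Longrightarrow> k x \<in> ?J \<and> q (k x) = x" "\<And>u. u \<in> ?J \<Longrightarrow> k (q u) = u"
    using k unfolding homeomorphism_def by auto
  define x0 where "x0 = q \<tau>"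
  have x0: "x0 \<in> {0<..<1}" using q(2,3)[OF \<tau>J] by (simp add: x0_def)
  have "open ({0<..<1} \<inter> k -` {s<..<t})" by (rule continuous_open_preimage[OF kc(1)]) auto
  moreover have "x0 \<in> {0<..<1} \<inter> k -` {s<..<t}" using x0 kc(3)[OF \<tau>J] \<tau> by (simp add: x0_def)
  ultimately obtain \<eta> where \<eta>: "\<eta> > 0" "ball x0 \<eta> \<subseteq> {0<..<1} \<inter> k -` {s<..<t}" using openE by blast
  obtain h where h: "h holomorphic_on (w ` U)" "\<And>z. z \<in> U \<Longrightarrow> deriv w z * deriv h (w z) = 1" "\<And>z. z \<in> U \<Longrightarrow> h (w z) = z"
    using holomorphic_has_inverse[OF U(2,1,3)] by blast
  have wU: "open (w ` U)" by (rule open_mapping_thm3[OF U(2,1,3)])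
  \<comment> \<open>The origin goes to the position of \<open>g \<tau>\<close> on the segment and
    the real axis along it; the slope \<beta> - \<alpha> is the source of the constant (\<beta> -
    \<alpha>)^3.\<close>
  define aff where "aff x = \<alpha> + (\<beta> - \<alpha>) * (of_real x0 + x)" for x
  have aff0: "aff 0 = w (g \<tau>)" using q(1)[OF \<tau>J] by (simp add: aff_def x0_def)
  have gU: "g \<tau> \<in> U" using e(3) \<tau>J by blast
  define \<psi> where "\<psi> x = h (aff x)" for x
  have \<psi>0: "\<psi> 0 = g \<tau>" using h(3)[OF gU] by (simp add: \<psi>_def aff0)
  have affc: "continuous_on UNIV aff" unfolding aff_def by (intro continuous_intros)
  have "open (aff -` (w ` U))" using open_vimage[OF wU affc] .
  moreover have "0 \<in> aff -` (w ` U)" using gU aff0 by simp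
  ultimately obtain r1 where r1: "r1 > 0" "ball 0 r1 \<subseteq> aff -` (w ` U)" using openE by blast
  have inU: "aff x = w (\<psi> x)" "\<psi> x \<in> U" if x: "x \<in> ball 0 r1" for x
  proof -
    obtain z where z: "z \<in> U" "aff x = w z" using r1(2) x by blast
    then show "aff x = w (\<psi> x)" "\<psi> x \<in> U" using h(3) by (simp_all add: \<psi>_def)
  qed
  have affh: "aff holomorphic_on A" for A unfolding aff_def by (intro holomorphic_intros)
  have "(h \<circ> aff) holomorphic_on ball 0 r1"
    by (rule holomorphic_on_compose_gen[OF affh h(1)]) (use r1(2) in blast)
  then have \<psi>h: "\<psi> holomorphic_on ball 0 r1" by (simp add: \<psi>_def[abs_def] o_def)
  \<comment> \<open>The part of the curve outside the chart interval, which might return close to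
    \<open>g \<tau>\<close>.\<close>
  define R where "R = g ` ({s..t} - ?J)"
  have "compact ({s..t} - ?J)" by (intro compact_diff compact_Icc open_greaterThanLessThan)
  then have "compact R" unfolding R_def
    by (intro compact_continuous_image continuous_on_subset[OF pg]) (use st in auto)
  then have "closed (K \<union> R)" by (intro closed_Un K(1) compact_imp_closed)
  then have "open (ball 0 r1 \<inter> \<psi> -` (- (K \<union> R)))"
    by (intro continuous_open_preimage[OF holomorphic_on_imp_continuous_on[OF \<psi>h]] open_ball open_Compl)
  moreover have "g \<tau> \<notin> K \<union> R" using K(2) inj \<tau>J unfolding R_def by force
  then have "0 \<in> ball 0 r1 \<inter> \<psi> -` (- (K \<union> R))" using r1(1) \<psi>0 by simp
  ultimately obtain r2 where r2: "r2 > 0" "ball 0 r2 \<subseteq> ball 0 r1 \<inter> \<psi> -` (- (K \<union> R))" using openE by blast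
  define r where "r = min r2 \<eta>"
  have r: "r > 0" using r2(1) \<eta>(1) by (simp add: r_def)
  have rr1: "ball 0 r \<subseteq> ball (0::complex) r1" using r2(2) by (auto simp: r_def)
  have avoid: "\<psi> x \<notin> K" "\<psi> x \<notin> R" if "x \<in> ball 0 r" for x
    using r2(2) that by (auto simp: r_def)
  have eqn: "poly P (\<psi> x) * deriv \<psi> x ^ 3 = (\<beta> - \<alpha>) ^ 3" if x: "x \<in> ball 0 r" for x
  proof -
    have x1: "x \<in> ball 0 r1" using x rr1 by blast
    have "(h has_field_derivative deriv h (aff x)) (at (aff x))"
      by (rule holomorphic_derivI[OF h(1) wU]) (use r1(2) x1 in blast)
    moreover have "(aff has_field_derivative (\<beta> - \<alpha>)) (at x)"
      unfolding aff_def by (auto intro!: derivative_eq_intros)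
    ultimately have "((\<lambda>x. h (aff x)) has_field_derivative deriv h (aff x) * (\<beta> - \<alpha>)) (at x)"
      by (rule DERIV_chain2)
    then have d: "deriv \<psi> x = deriv h (aff x) * (\<beta> - \<alpha>)" unfolding \<psi>_def by (rule DERIV_imp_deriv)
    have "poly P (\<psi> x) = deriv w (\<psi> x) ^ 3" using U(4)[OF inU(2)[OF x1]] by simp
    then have "poly P (\<psi> x) * deriv \<psi> x ^ 3 = (deriv w (\<psi> x) * deriv h (w (\<psi> x))) ^ 3 * (\<beta> - \<alpha>) ^ 3"
      unfolding d inU(1)[OF x1] by (simp add: power_mult_distrib)
    then show ?thesis using h(2)[OF inU(2)[OF x1]] by simp
  qed
  have real_in: "\<psi> x \<in> g ` {s<..<t}" if x: "x \<in> ball 0 r" "Im x = 0" for x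
  proof -
    define y where "y = x0 + Re x"
    have "\<bar>Re x\<bar> < \<eta>" using x(1) abs_Re_le_cmod[of x] by (simp add: r_def)
    then have "y \<in> ball x0 \<eta>" by (simp add: y_def dist_real_def)
    then have y: "y \<in> {0<..<1}" "k y \<in> {s<..<t}" using \<eta>(2) by auto
    have ky: "k y \<in> ?J" "q (k y) = y" using kc(2)[OF y(1)] by auto
    have "of_real x0 + x = of_real y" using x(2) by (simp add: y_def complex_eq_iff)
    then have "aff x = w (g (k y))" using q(1)[OF ky(1)] ky(2) by (simp add: aff_def)
    moreover have "g (k y) \<in> U" using e(3) ky(1) by blast
    ultimately have "\<psi> x = g (k y)" using h(3) by (simp add: \<psi>_def)
    then show ?thesis using y(2) by blast
  qed
  have in_real: "Im x = 0" if x: "x \<in> ball 0 r" "\<psi> x \<in> g ` {s<..<t}" for x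
  proof -
    obtain u where u: "u \<in> {s<..<t}" "\<psi> x = g u" using x(2) by blast
    have "u \<in> ?J" using avoid(2)[OF x(1)] u unfolding R_def by force
    then have "aff x = \<alpha> + (\<beta> - \<alpha>) * of_real (q u)" using inU(1)[of x] rr1 x(1) q(1) u(2) by auto
    then have "of_real x0 + x = of_real (q u)" using \<alpha>\<beta> by (simp add: aff_def)
    then have "Im (of_real x0 + x) = Im (of_real (q u))" by (rule arg_cong)
    then show ?thesis by simp
  qed
  have "inj_on \<psi> (ball 0 r)"
  proof (rule inj_onI)
    fix x y assume xy: "x \<in> ball 0 r" "y \<in> ball 0 r" "\<psi> x = \<psi> y"
    then have "aff x = aff y" using inU(1) rr1 by (metis subsetD)
    then show "x = y" using \<alpha>\<beta> by (simp add: aff_def)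
  qed
  moreover have "\<psi> holomorphic_on ball 0 r" by (rule holomorphic_on_subset[OF \<psi>h rr1])
  moreover have "(\<beta> - \<alpha>) ^ 3 \<noteq> 0" using \<alpha>\<beta> by simp
  ultimately show ?thesis
    unfolding straight_arc_at_def using r \<psi>0 eqn real_in in_real avoid(1) by blast
qed

lemma trajectory_locally_inj:
  assumes "trajectory P g" "\<tau> \<in> {0<..<1}"
  obtains e where "e > 0" "inj_on g {\<tau> - e<..<\<tau> + e}"
proof -
  have "locally_straight_at P g \<tau>" using assms unfolding trajectory_def by blast
  then obtain w :: "complex \<Rightarrow> complex" and e \<alpha> \<beta>
    where "e > 0" and bij: "bij_betw (w \<circ> g) {\<tau> - e<..<\<tau> + e} (open_segment \<alpha> \<beta>)"
    unfolding locally_straight_at_def by blast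
  then show ?thesis using that inj_on_imageI2[OF bij_betw_imp_inj_on[OF bij]] by blast
qed

text \<open>Exactly one of the two sides of a boundary arc lies inside the Jordan curve.\<close>

lemma straight_boundary_inside:
  assumes c: "simple_path c" "pathfinish c = pathstart c" and im: "path_image c = A \<union> K"
    and st: "straight_arc_at P A K p"
  shows "straight_boundary P (inside (path_image c)) A p"
proof -
  let ?C = "path_image c"
  obtain \<psi> r k where r: "r > 0" and \<psi>: "\<psi> holomorphic_on ball 0 r" "inj_on \<psi> (ball 0 r)" "\<psi> 0 = p" "k \<noteq> 0"
    and eqn: "\<And>w. w \<in> ball 0 r \<Longrightarrow> poly P (\<psi> w) * deriv \<psi> w ^ 3 = k"
    and on: "\<And>w. w \<in> ball 0 r \<Longrightarrow> \<psi> w \<in> A \<longleftrightarrow> Im w = 0"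
    and off: "\<And>w. w \<in> ball 0 r \<Longrightarrow> \<psi> w \<notin> K"
    using st unfolding straight_arc_at_def by metis
  note J = Jordan_inside_outside[OF c]
  have CI: "\<psi> w \<in> ?C \<longleftrightarrow> Im w = 0" if "w \<in> ball 0 r" for w using on off im that by blast
  define Bp where "Bp = ball 0 r \<inter> {w::complex. 0 < Im w}"
  define Bm where "Bm = ball 0 r \<inter> {w::complex. Im w < 0}"
  have conn: "connected (\<psi> ` Bp)" "connected (\<psi> ` Bm)"
    unfolding Bp_def Bm_def
    by (intro connected_continuous_image convex_connected convex_Int convex_ball convex_halfspace_Im_gt convex_halfspace_Im_lt
         continuous_on_subset[OF holomorphic_on_imp_continuous_on[OF \<psi>(1)]]; blast)+
  have sub: "\<psi> ` Bp \<subseteq> inside ?C \<union> outside ?C" "\<psi> ` Bm \<subseteq> inside ?C \<union> outside ?C"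
    using CI inside_Un_outside[of ?C] unfolding Bp_def Bm_def by fastforce+
  have dich: "X \<subseteq> inside ?C \<or> X \<subseteq> outside ?C" if "connected X" "X \<subseteq> inside ?C \<union> outside ?C" for X
  proof -
    have "open (inside ?C)" "open (outside ?C)" using J by auto
    moreover have "inside ?C \<inter> outside ?C \<inter> X = {}" by simp
    ultimately have "inside ?C \<inter> X = {} \<or> outside ?C \<inter> X = {}"
      using connectedD[OF that(1)] that(2) by metis
    then show ?thesis using that(2) by fast
  qed
  have op: "open (\<psi> ` ball 0 r)" by (rule open_mapping_thm3[OF \<psi>(1) open_ball \<psi>(2)])
  have pin: "p \<in> \<psi> ` ball 0 r" using \<psi>(3) r by force
  have "p \<in> ?C" using CI[of 0] r \<psi>(3) by simp
  then have fr: "p \<in> frontier (inside ?C)" "p \<in> frontier (outside ?C)" using J by auto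
  have meets: "\<psi> ` ball 0 r \<inter> inside ?C \<noteq> {}" "\<psi> ` ball 0 r \<inter> outside ?C \<noteq> {}"
  proof -
    have "p \<in> closure (inside ?C)" "p \<in> closure (outside ?C)" using fr by (auto simp: frontier_def)
    then show "\<psi> ` ball 0 r \<inter> inside ?C \<noteq> {}" "\<psi> ` ball 0 r \<inter> outside ?C \<noteq> {}"
      using pin open_Int_closure_eq_empty[OF op] by (metis IntI empty_iff)+
  qed
  have split: "\<psi> ` ball 0 r \<subseteq> ?C \<union> \<psi> ` Bp \<union> \<psi> ` Bm"
  proof
    fix z assume "z \<in> \<psi> ` ball 0 r"
    then obtain w where w: "w \<in> ball 0 r" "z = \<psi> w" by blast
    consider "Im w = 0" | "Im w > 0" | "Im w < 0" by linarith
    then show "z \<in> ?C \<union> \<psi> ` Bp \<union> \<psi> ` Bm"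
      by cases (use w CI[OF w(1)] in \<open>auto simp: Bp_def Bm_def\<close>)
  qed
  have Cio: "?C \<inter> inside ?C = {}" "?C \<inter> outside ?C = {}"
    using inside_no_overlap outside_no_overlap by (auto simp: Int_commute)
  have clos: "z \<notin> closure (inside ?C)" if "z \<in> outside ?C" for z
  proof -
    have "open (outside ?C)" using J by auto
    moreover have "outside ?C \<inter> inside ?C = {}" by (simp add: Int_commute)
    ultimately have "outside ?C \<inter> closure (inside ?C) = {}" by (simp add: open_Int_closure_eq_empty)
    then show ?thesis using that by blast
  qed
  have inB: "0 < Im w \<Longrightarrow> \<psi> w \<in> \<psi> ` Bp" "Im w < 0 \<Longrightarrow> \<psi> w \<in> \<psi> ` Bm" if "w \<in> ball 0 r" for w
    using that by (auto simp: Bp_def Bm_def)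
  have io: "inside ?C \<inter> outside ?C = {}" by simp
  \<comment> \<open>Were both sides inside, a neighbourhood of \<open>p\<close> would miss the
    outside, whose frontier contains \<open>p\<close>.\<close>
  have n1: "\<not> (\<psi> ` Bp \<subseteq> inside ?C \<and> \<psi> ` Bm \<subseteq> inside ?C)"
  proof
    assume "\<psi> ` Bp \<subseteq> inside ?C \<and> \<psi> ` Bm \<subseteq> inside ?C"
    then have "\<psi> ` ball 0 r \<subseteq> ?C \<union> inside ?C" using split by fast
    then show False using meets(2) Cio(2) io by fast
  qed
  have n2: "\<not> (\<psi> ` Bp \<subseteq> outside ?C \<and> \<psi> ` Bm \<subseteq> outside ?C)"
  proof
    assume "\<psi> ` Bp \<subseteq> outside ?C \<and> \<psi> ` Bm \<subseteq> outside ?C"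
    then have "\<psi> ` ball 0 r \<subseteq> ?C \<union> outside ?C" using split by fast
    then show False using meets(1) Cio(1) io by fast
  qed
  consider "\<psi> ` Bp \<subseteq> inside ?C" "\<psi> ` Bm \<subseteq> outside ?C" | "\<psi> ` Bp \<subseteq> outside ?C" "\<psi> ` Bm \<subseteq> inside ?C"
    using dich[OF conn(1) sub(1)] dich[OF conn(2) sub(2)] n1 n2 by metis
  then show ?thesis
  proof cases
    case 1
    show ?thesis unfolding straight_boundary_def
    proof (intro exI[of _ \<psi>] exI[of _ r] exI[of _ k] conjI ballI impI r \<psi> eqn)
      fix w assume w: "w \<in> ball (0::complex) r"
      show "\<psi> w \<in> inside ?C" if "0 < Im w" using 1(1) inB(1)[OF w that] by blast
      show "\<psi> w \<in> A" if "Im w = 0" using on[OF w] that by simp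
      show "\<psi> w \<notin> closure (inside ?C)" if "Im w < 0"
        using 1(2) inB(2)[OF w that] by (intro clos) blast
    qed
  next
    case 2
    \<comment> \<open>The half turn w -> -w exchanges the two sides and changes the sign of the
      cubed derivative; hence the constant -k.\<close>
    have neg: "- w \<in> ball 0 r" if "w \<in> ball (0::complex) r" for w using that by simp
    have "(\<psi> \<circ> uminus) holomorphic_on ball 0 r"
      by (rule holomorphic_on_compose_gen[OF _ \<psi>(1)]) (use neg in \<open>auto intro!: holomorphic_intros\<close>)
    then have h: "(\<lambda>w. \<psi> (- w)) holomorphic_on ball 0 r" by (simp add: o_def)
    have i: "inj_on (\<lambda>w. \<psi> (- w)) (ball 0 r)"
    proof (rule inj_onI)
      fix x y assume "x \<in> ball (0::complex) r" "y \<in> ball 0 r" "\<psi> (- x) = \<psi> (- y)"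
      then have "- x = - y" using inj_onD[OF \<psi>(2)] neg by blast
      then show "x = y" by simp
    qed
    have e: "poly P (\<psi> (- w)) * deriv (\<lambda>w. \<psi> (- w)) w ^ 3 = - k" if w: "w \<in> ball 0 r" for w
    proof -
      have "((\<lambda>w. \<psi> (- w)) has_field_derivative deriv \<psi> (- w) * (- 1)) (at w)"
        by (rule DERIV_chain2[where f = \<psi> and g = uminus, OF holomorphic_derivI[OF \<psi>(1) open_ball neg[OF w]]])
           (auto intro!: derivative_eq_intros)
      then have "deriv (\<lambda>w. \<psi> (- w)) w = - deriv \<psi> (- w)" by (simp add: DERIV_imp_deriv)
      then show ?thesis using eqn[OF neg[OF w]] by simp
    qed
    show ?thesis unfolding straight_boundary_def
    proof (intro exI[of _ "\<lambda>w. \<psi> (- w)"] exI[of _ r] exI[of _ "- k"] conjI ballI impI r h i e)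
      fix w assume w: "w \<in> ball (0::complex) r"
      show "\<psi> (- w) \<in> inside ?C" if "0 < Im w" using 2(2) inB(2)[OF neg[OF w]] that by auto
      show "\<psi> (- w) \<in> A" if "Im w = 0" using on[OF neg[OF w]] that by simp
      show "\<psi> (- w) \<notin> closure (inside ?C)" if "Im w < 0"
        using 2(1) inB(1)[OF neg[OF w]] that by (intro clos) auto
    qed (use \<psi> in auto)
  qed
qed

section \<open>Jordan curves with two straight sides\<close>

lemma no_straight_jordan_curve:
  fixes P :: "complex poly"
  assumes P0: "P \<noteq> 0" and c: "simple_path c" "pathfinish c = pathstart c"
    and im: "path_image c = A1 \<union> A2 \<union> {a, b}" and disj: "A1 \<inter> A2 = {}"
    and conn: "connected A1" "connected A2" and ne: "A1 \<noteq> {}" "A2 \<noteq> {}"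
    and K: "path_image c = A1 \<union> K1" "path_image c = A2 \<union> K2"
    and st1: "\<And>p. p \<in> A1 \<Longrightarrow> straight_arc_at P A1 K1 p"
    and st2: "\<And>p. p \<in> A2 \<Longrightarrow> straight_arc_at P A2 K2 p"
  shows False
proof -
  note J = Jordan_inside_outside[OF c]
  show False
  proof (rule no_straight_domain[OF P0, of "inside (path_image c)" A1 A2 a b])
    show "simply_connected (inside (path_image c))" by (rule simply_connected_inside_simple_path[OF c(1)])
    show "straight_boundary P (inside (path_image c)) A1 p" if "p \<in> A1" for p
      by (rule straight_boundary_inside[OF c K(1) st1[OF that]])
    show "straight_boundary P (inside (path_image c)) A2 p" if "p \<in> A2" for p
      by (rule straight_boundary_inside[OF c K(2) st2[OF that]])
  qed (use J im disj conn ne in auto)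
qed

text \<open>Local injectivity and compactness give a \<delta> such that no loop has parameter length
  below it. The pairs that close a loop thus form a compact set, and a pair of least length contains
  no smaller loop.\<close>

lemma minimal_loop:
  fixes g :: "real \<Rightarrow> complex"
  assumes cont: "continuous_on {x..y} g" and xy: "x < y" "g x = g y"
    and loc: "\<And>\<tau>. \<tau> \<in> {x..y} \<Longrightarrow> \<exists>e>0. inj_on g {\<tau> - e<..<\<tau> + e}"
  obtains s t where "x \<le> s" "s < t" "t \<le> y" "g s = g t" "inj_on g {s..<t}"
proof -
  define \<G> where "\<G> = {S. open S \<and> inj_on g S}"
  have "{x..y} \<subseteq> \<Union>\<G>"
  proof
    fix \<tau> assume "\<tau> \<in> {x..y}"
    then obtain e where "e > 0" "inj_on g {\<tau> - e<..<\<tau> + e}" using loc by blast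
    then have "{\<tau> - e<..<\<tau> + e} \<in> \<G>" "\<tau> \<in> {\<tau> - e<..<\<tau> + e}" by (auto simp: \<G>_def)
    then show "\<tau> \<in> \<Union>\<G>" by blast
  qed
  moreover have "open S" if "S \<in> \<G>" for S using that by (simp add: \<G>_def)
  ultimately obtain \<delta> where \<delta>: "\<delta> > 0" "\<And>u. u \<in> {x..y} \<Longrightarrow> \<exists>S\<in>\<G>. ball u \<delta> \<subseteq> S"
    using Heine_Borel_lemma[OF compact_Icc] by metis
  have sep: "u = v" if uv: "u \<in> {x..y}" "\<bar>u - v\<bar> < \<delta>" "g u = g v" for u v
  proof -
    obtain S where S: "inj_on g S" "ball u \<delta> \<subseteq> S" using \<delta>(2)[OF uv(1)] unfolding \<G>_def by blast
    have "u \<in> S" "v \<in> S" using S(2) uv(2) \<delta>(1) by (auto simp: dist_real_def)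
    then show ?thesis using S(1) uv(3) by (meson inj_onD)
  qed
  define T where "T = {p \<in> {x..y} \<times> {x..y}. g (fst p) - g (snd p) = 0} \<inter> {p. \<delta> \<le> snd p - fst p}"
  have "closed {p \<in> {x..y} \<times> {x..y}. g (fst p) - g (snd p) = 0}"
  proof (rule continuous_closed_preimage_constant)
    show "continuous_on ({x..y} \<times> {x..y}) (\<lambda>p. g (fst p) - g (snd p))"
      by (intro continuous_intros continuous_on_compose2[OF cont]) auto
  qed (intro closed_Times closed_atLeastAtMost)
  moreover have "closed {p::real\<times>real. \<delta> \<le> snd p - fst p}"
    by (intro closed_Collect_le continuous_intros)
  ultimately have "closed T" unfolding T_def by (rule closed_Int)
  moreover have "T \<subseteq> {x..y} \<times> {x..y}" unfolding T_def by blast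
  ultimately have "compact T"
    by (metis compact_Icc compact_Int_closed compact_Times inf.absorb_iff2)
  moreover have "(x, y) \<in> T"
  proof -
    have "\<not> \<bar>x - y\<bar> < \<delta>" using sep[of x y] xy by auto
    then show ?thesis using xy by (auto simp: T_def)
  qed
  moreover have "continuous_on T (\<lambda>p. snd p - fst p)" by (intro continuous_intros)
  ultimately obtain p where p: "p \<in> T" "\<And>p'. p' \<in> T \<Longrightarrow> snd p - fst p \<le> snd p' - fst p'"
    using continuous_attains_inf[of T "\<lambda>p. snd p - fst p"] by blast
  obtain s t where st: "p = (s, t)" by fastforce
  have st': "x \<le> s" "t \<le> y" "g s = g t" "\<delta> \<le> t - s" using p(1) by (auto simp: T_def st)
  have "inj_on g {s..<t}"
  proof (rule linorder_inj_onI')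
    fix u v assume uv: "u \<in> {s..<t}" "v \<in> {s..<t}" "u < v"
    show "g u \<noteq> g v"
    proof
      assume eq: "g u = g v"
      have "u \<in> {x..y}" "v \<in> {x..y}" using uv st' by auto
      moreover have "\<not> \<bar>u - v\<bar> < \<delta>" using sep[of u v] eq uv(3) calculation by auto
      ultimately have "(u, v) \<in> T" using eq uv(3) by (auto simp: T_def)
      then have "t - s \<le> v - u" using p(2)[of "(u, v)"] by (simp add: st)
      then show False using uv by auto
    qed
  qed
  moreover have "s < t" using st'(4) \<delta>(1) by linarith
  ultimately show ?thesis using that st' by blast
qed

text \<open>The loop has a single corner, at \<open>g s\<close>. The midpoint \<open>g m\<close>,
  where the loop is straight, serves as the second corner, and the two halves as the two
  sides.\<close>

lemma no_trajectory_loop: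
  assumes P0: "P \<noteq> 0" and tr: "trajectory P g" and st: "0 \<le> s" "s < t" "t \<le> 1"
    and eq: "g s = g t" and inj: "inj_on g {s..<t}"
  shows False
proof -
  define m where "m = (s + t) / 2"
  have m: "s < m" "m < t" using st(2) by (auto simp: m_def)
  have pg: "path g" using tr unfolding trajectory_def by blast
  then have cg: "continuous_on {0..1} g" by (simp add: path_def)
  define c where "c = subpath s t g"
  have inj': "u = v \<or> {u, v} = {s, t}" if uv: "u \<in> {s..t}" "v \<in> {s..t}" "g u = g v" for u v
  proof -
    have i: "u = v" if "u \<in> {s..<t}" "v \<in> {s..<t}" "g u = g v" for u v
      using inj that by (meson inj_onD)
    have "u = t \<or> u \<in> {s..<t}" "v = t \<or> v \<in> {s..<t}" using uv by auto
    then show ?thesis using i[of u v] i[of s v] i[of u s] uv(3) eq st(2) by auto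
  qed
  have uniq: "u = \<tau>" if "\<tau> \<in> {s<..<t}" "u \<in> {s..t}" "g u = g \<tau>" for u \<tau>
    using inj'[of u \<tau>] that by (auto simp: doubleton_eq_iff)
  have off: "g \<tau> \<notin> g ` B" if \<tau>: "\<tau> \<in> {s<..<t}" "B \<subseteq> {s..t}" "\<tau> \<notin> B" for \<tau> B
  proof
    assume "g \<tau> \<in> g ` B"
    then obtain u where "u \<in> B" "g u = g \<tau>" by (metis imageE)
    then show False using uniq[of \<tau> u] \<tau> by blast
  qed
  have path_c: "path c" unfolding c_def using pg st by (intro path_subpath) auto
  have loop: "pathfinish c = pathstart c" unfolding c_def using eq by simp
  have "simple_path c"
    unfolding c_def simple_path_subpath_eq
    using path_c inj' st(2) unfolding c_def closed_segment_eq_real_ivl by (auto simp: doubleton_eq_iff)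
  have im: "path_image c = g ` {s..t}" using st by (simp add: c_def path_image_subpath)
  have sub: "A \<subseteq> {s..t} \<Longrightarrow> continuous_on A g" for A
    using st by (rule_tac continuous_on_subset[OF cg]) auto
  show False
  proof (rule no_straight_jordan_curve[OF P0 \<open>simple_path c\<close> loop, of "g ` {s<..<m}" "g ` {m<..<t}" "g s" "g m"
        "g ` {m..t}" "g ` {s..m}"])
    have "{s..t} = {s<..<m} \<union> {m<..<t} \<union> {s, m} \<union> {t}" using m by auto
    then show "path_image c = g ` {s<..<m} \<union> g ` {m<..<t} \<union> {g s, g m}" unfolding im using eq by auto
    show "g ` {s<..<m} \<inter> g ` {m<..<t} = {}"
    proof -
      have "g u \<noteq> g v" if "u \<in> {s<..<m}" "v \<in> {m<..<t}" for u v using uniq[of v u] that m by force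
      then show ?thesis by blast
    qed
    show "connected (g ` {s<..<m})" "connected (g ` {m<..<t})"
      by (intro connected_continuous_image sub; use m in auto)+
    have dec: "{s..t} = {s<..<m} \<union> {m..t} \<union> {s}" "{s..t} = {m<..<t} \<union> {s..m} \<union> {t}" using m by auto
    have "g t \<in> g ` {m..t}" "g s \<in> g ` {s..m}" using m by auto
    then have mem: "g s \<in> g ` {m..t}" "g t \<in> g ` {s..m}" by (simp_all only: eq)
    show "path_image c = g ` {s<..<m} \<union> g ` {m..t}"
      unfolding im dec(1) image_Un using mem(1) by blast
    show "path_image c = g ` {m<..<t} \<union> g ` {s..m}"
      unfolding im dec(2) image_Un using mem(2) by blast
    have cl: "closed (g ` {m..t})" "closed (g ` {s..m})"
      by (intro compact_imp_closed compact_continuous_image sub compact_Icc; use m in auto)+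
    show "straight_arc_at P (g ` {s<..<m}) (g ` {m..t}) p" if pin: "p \<in> g ` {s<..<m}" for p
    proof -
      obtain \<tau> where \<tau>: "\<tau> \<in> {s<..<m}" "p = g \<tau>" using pin by blast
      have "g \<tau> \<notin> g ` {m..t}" by (rule off) (use \<tau> m in auto)
      then show ?thesis unfolding \<tau>(2)
        using \<tau> m st cl by (intro trajectory_straight_arc_at[OF tr]) (auto intro: uniq)
    qed
    show "straight_arc_at P (g ` {m<..<t}) (g ` {s..m}) p" if pin: "p \<in> g ` {m<..<t}" for p
    proof -
      obtain \<tau> where \<tau>: "\<tau> \<in> {m<..<t}" "p = g \<tau>" using pin by blast
      have "g \<tau> \<notin> g ` {s..m}" by (rule off) (use \<tau> m in auto)
      then show ?thesis unfolding \<tau>(2)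
        using \<tau> m st cl by (intro trajectory_straight_arc_at[OF tr]) (auto intro: uniq)
    qed
  qed (use m in auto)
qed

text \<open>Interior points are not zeros, so a self-intersection away from the ends stays in the open interval.\<close>

lemma saddle_connection_arc:
  assumes P0: "P \<noteq> 0" and g: "saddle_connection P g"
  shows "arc g"
proof (rule ccontr)
  assume na: "\<not> arc g"
  have tr: "trajectory P g" and ends: "poly P (g 0) = 0" "poly P (g 1) = 0"
    using g unfolding saddle_connection_def pathstart_def pathfinish_def by auto
  have inner: "poly P (g u) \<noteq> 0" if "u \<in> {0<..<1}" for u using tr that unfolding trajectory_def by blast
  have pg: "path g" using tr unfolding trajectory_def by blast
  \<comment> \<open>Interior points have flat neighbourhoods in which \<open>g\<close> is locally
    injective, so an interior self-intersection contains a minimal loop.\<close>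
  have no_inner: False if x: "0 < x" "x < y" "y < 1" "g x = g y" for x y
  proof -
    have "\<exists>e>0. inj_on g {\<tau> - e<..<\<tau> + e}" if "\<tau> \<in> {x..y}" for \<tau>
    proof -
      have "\<tau> \<in> {0<..<1}" using that x by auto
      then obtain e where "e > 0" "inj_on g {\<tau> - e<..<\<tau> + e}" by (rule trajectory_locally_inj[OF tr])
      then show ?thesis by blast
    qed
    note loc = this
    have cxy: "continuous_on {x..y} g"
      using pg x unfolding path_def by (rule_tac continuous_on_subset[of "{0..1}" g]) auto
    obtain s t where "x \<le> s" "s < t" "t \<le> y" "g s = g t" "inj_on g {s..<t}"
      by (rule minimal_loop[OF cxy x(2,4) loc])
    then show False using no_trajectory_loop[OF P0 tr, of s t] x by auto
  qed
  obtain u v where "u \<in> {0..1}" "v \<in> {0..1}" "u \<noteq> v" "g u = g v"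
    using na pg unfolding arc_def inj_on_def by blast
  then obtain x y where xy: "0 \<le> x" "x < y" "y \<le> 1" "g x = g y"
    by (metis atLeastAtMost_iff linorder_neqE_linordered_idom)
  have "x = 0 \<and> y = 1"
  proof -
    have "x = 0 \<or> y = 1" using no_inner[of x y] xy by fastforce
    then show ?thesis using inner[of x] inner[of y] ends xy by fastforce
  qed
  then have eq: "g 0 = g 1" using xy by simp
  have "inj_on g {0..<1}"
  proof (rule linorder_inj_onI')
    fix u v :: real assume uv: "u \<in> {0..<1}" "v \<in> {0..<1}" "u < v"
    show "g u \<noteq> g v"
      using no_inner[of u v] inner[of v] ends uv by (cases "u = 0") auto
  qed
  then show False using no_trajectory_loop[OF P0 tr, of 0 1] eq by simp
qed

text \<open>A point of \<open>g2\<close> off \<open>g1\<close> lies in an excursion of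
  \<open>g2\<close> between two consecutive meeting points. Closed up by the stretch of
  \<open>g1\<close> between these points, it bounds a domain with two straight sides; the corners
  may be crossings instead of zeros.\<close>

lemma saddle_connection_subset:
  assumes P0: "P \<noteq> 0" and g1: "saddle_connection P g1" and g2: "saddle_connection P g2"
    and ends: "{pathstart g2, pathfinish g2} \<subseteq> path_image g1"
  shows "path_image g2 \<subseteq> path_image g1"
proof (rule ccontr)
  assume "\<not> ?thesis"
  then obtain x where x: "x \<in> {0..1}" "g2 x \<notin> path_image g1" unfolding path_image_def by blast
  have tr: "trajectory P g1" "trajectory P g2" using g1 g2 unfolding saddle_connection_def by auto
  have arc: "arc g1" "arc g2" using saddle_connection_arc[OF P0] g1 g2 by auto
  have inj: "inj_on g1 {0..1}" "inj_on g2 {0..1}" and cont: "continuous_on {0..1} g1" "continuous_on {0..1} g2"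
    using arc by (auto simp: arc_def path_def)
  define Z where "Z = {0..1} \<inter> g2 -` path_image g1"
  have "closed Z" unfolding Z_def
    by (intro continuous_closed_preimage cont closed_atLeastAtMost compact_imp_closed compact_path_image arc_imp_path arc)
  then have cZ: "compact (Z \<inter> {0..x})" "compact (Z \<inter> {x..1})" by (auto intro: closed_Int_compact)
  \<comment> \<open>The ends of \<open>g2\<close> lie on \<open>g1\<close>, so there are meeting
    points on both sides of \<open>x\<close>.\<close>
  have Z01: "0 \<in> Z" "1 \<in> Z" using ends by (auto simp: Z_def pathstart_def pathfinish_def)
  define s where "s = Sup (Z \<inter> {0..x})"
  define t where "t = Inf (Z \<inter> {x..1})"
  have n1: "Z \<inter> {0..x} \<noteq> {}" and n2: "Z \<inter> {x..1} \<noteq> {}" using Z01 x(1) by auto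
  have s: "s \<in> Z \<inter> {0..x}" unfolding s_def
    by (rule closed_contains_Sup[OF n1 _ compact_imp_closed[OF cZ(1)]]) (auto intro: bdd_aboveI[of _ x])
  have t: "t \<in> Z \<inter> {x..1}" unfolding t_def
    by (rule closed_contains_Inf[OF n2 _ compact_imp_closed[OF cZ(2)]]) (auto intro: bdd_belowI[of _ x])
  have xZ: "x \<notin> Z" using x by (simp add: Z_def)
  have st: "0 \<le> s" "s < x" "x < t" "t \<le> 1" using s t xZ by (auto simp: order.order_iff_strict)
  have off: "g2 u \<notin> path_image g1" if u: "u \<in> {s<..<t}" for u
  proof
    assume "g2 u \<in> path_image g1"
    then have uZ: "u \<in> Z" using u st by (simp add: Z_def)
    show False
    proof (cases "u \<le> x")
      case True
      have "u \<le> s" unfolding s_def by (rule cSup_upper) (use uZ u st True in \<open>auto intro: bdd_aboveI[of _ x]\<close>)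
      then show False using u by simp
    next
      case False
      have "t \<le> u" unfolding t_def by (rule cInf_lower) (use uZ u st False in \<open>auto intro: bdd_belowI[of _ x]\<close>)
      then show False using u by simp
    qed
  qed
  obtain u where u: "u \<in> {0..1}" "g1 u = g2 t" using t unfolding Z_def path_image_def by auto
  obtain v where v: "v \<in> {0..1}" "g1 v = g2 s" using s unfolding Z_def path_image_def by auto
  have uv: "u \<noteq> v"
  proof
    assume "u = v"
    then have "g2 s = g2 t" using u v by simp
    then have "s = t" using inj(2) st by (auto simp: inj_on_def)
    then show False using st by simp
  qed
  \<comment> \<open>\<open>g1\<close> may pass the two points in either order:
    \<open>subpath u v g1\<close> runs backwards if u > v, while images are described by the ordered
    pair l < h.\<close>
  define l where "l = min u v"
  define h where "h = max u v"
  have lh: "0 \<le> l" "l < h" "h \<le> 1" "{g1 l, g1 h} = {g2 s, g2 t}" using u v uv by (auto simp: l_def h_def min_def max_def)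
  define c where "c = subpath s t g2 +++ subpath u v g1"
  have s01: "s \<in> {0..1}" "t \<in> {0..1}" using st by auto
  have im2: "path_image (subpath s t g2) = g2 ` {s..t}" using st by (simp add: path_image_subpath)
  have im1: "path_image (subpath u v g1) = g1 ` {l..h}"
    by (simp add: path_image_subpath_gen closed_segment_eq_real_ivl l_def h_def min_def max_def)
  have g1sub: "g1 ` {l..h} \<subseteq> path_image g1" unfolding path_image_def using lh by auto
  have sc: "simple_path c" unfolding c_def
  proof (rule simple_path_join_loop)
    show "arc (subpath s t g2)" by (rule arc_subpath_arc[OF arc(2) s01]) (use st in auto)
    show "arc (subpath u v g1)" by (rule arc_subpath_arc[OF arc(1) u(1) v(1) uv])
    show "path_image (subpath s t g2) \<inter> path_image (subpath u v g1) \<subseteq> {pathstart (subpath s t g2), pathstart (subpath u v g1)}"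
    proof
      fix z assume z: "z \<in> path_image (subpath s t g2) \<inter> path_image (subpath u v g1)"
      then obtain w where w: "w \<in> {s..t}" "z = g2 w" unfolding im2 by blast
      have "z \<in> g1 ` {l..h}" using z im1 by (metis IntD2)
      then have "g2 w \<in> path_image g1" using g1sub w(2) by auto
      then have "w \<notin> {s<..<t}" using off by blast
      then have "w = s \<or> w = t" using w(1) by auto
      then show "z \<in> {pathstart (subpath s t g2), pathstart (subpath u v g1)}" using w(2) u(2) by auto
    qed
  qed (use u v in auto)
  have loop: "pathfinish c = pathstart c" using v by (simp add: c_def)
  have imc: "path_image c = g2 ` {s..t} \<union> g1 ` {l..h}"
    unfolding c_def using u by (subst path_image_join) (auto simp: im1 im2)
  have sub2: "A \<subseteq> {s..t} \<Longrightarrow> continuous_on A g2" and sub1: "B \<subseteq> {l..h} \<Longrightarrow> continuous_on B g1" for A B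
    using st lh by (rule_tac continuous_on_subset[OF cont(2)], force, rule_tac continuous_on_subset[OF cont(1)], force)
  have i2: "{s..t} = {s<..<t} \<union> {s, t}" and i1: "{l..h} = {l<..<h} \<union> {l, h}" using st lh by auto
  have e1: "g1 ` {l..h} = g1 ` {l<..<h} \<union> {g2 s, g2 t}" unfolding i1 image_Un using lh(4) by simp
  have e2: "g2 ` {s..t} = g2 ` {s<..<t} \<union> {g2 s, g2 t}" unfolding i2 image_Un by simp
  have d12: "g2 w \<notin> g1 ` {l..h}" if "w \<in> {s<..<t}" for w using off[OF that] g1sub by blast
  have d21: "g1 w \<notin> g2 ` {s..t}" if w: "w \<in> {l<..<h}" for w
  proof
    assume "g1 w \<in> g2 ` {s..t}"
    moreover have "g1 w \<notin> g2 ` {s<..<t}" using d12 w by (metis atLeastAtMost_iff greaterThanLessThan_iff imageE imageI less_imp_le)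
    ultimately have "g1 w \<in> {g1 l, g1 h}" unfolding e2 lh(4) by blast
    then have "w = l \<or> w = h" using inj_onD[OF inj(1), of w l] inj_onD[OF inj(1), of w h] w lh(1-3) by auto
    then show False using w by simp
  qed
  show False
  proof (rule no_straight_jordan_curve[OF P0 sc loop, of "g2 ` {s<..<t}" "g1 ` {l<..<h}" "g2 s" "g2 t" "g1 ` {l..h}" "g2 ` {s..t}"])
    show "path_image c = g2 ` {s<..<t} \<union> g1 ` {l<..<h} \<union> {g2 s, g2 t}" unfolding imc e1 e2 by blast
    show "path_image c = g2 ` {s<..<t} \<union> g1 ` {l..h}" "path_image c = g1 ` {l<..<h} \<union> g2 ` {s..t}"
      unfolding imc e1 e2 by blast+
    show "g2 ` {s<..<t} \<inter> g1 ` {l<..<h} = {}" using d12 unfolding e1 by blast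
    show "connected (g2 ` {s<..<t})" by (intro connected_continuous_image sub2) auto
    show "connected (g1 ` {l<..<h})" by (intro connected_continuous_image sub1) auto
    have cl: "closed (g1 ` {l..h})" "closed (g2 ` {s..t})"
      by (intro compact_imp_closed compact_continuous_image sub1 sub2 compact_Icc subset_refl)+
    show "straight_arc_at P (g2 ` {s<..<t}) (g1 ` {l..h}) p" if "p \<in> g2 ` {s<..<t}" for p
    proof -
      from that obtain \<tau> where \<tau>: "\<tau> \<in> {s<..<t}" "p = g2 \<tau>" by blast
      show ?thesis unfolding \<tau>(2)
        by (rule trajectory_straight_arc_at[OF tr(2) st(1,4) \<tau>(1) _ cl(1) d12[OF \<tau>(1)]])
           (use inj_onD[OF inj(2), of _ \<tau>] \<tau>(1) st in auto)
    qed
    show "straight_arc_at P (g1 ` {l<..<h}) (g2 ` {s..t}) p" if "p \<in> g1 ` {l<..<h}" for p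
    proof -
      from that obtain \<tau> where \<tau>: "\<tau> \<in> {l<..<h}" "p = g1 \<tau>" by blast
      show ?thesis unfolding \<tau>(2)
        by (rule trajectory_straight_arc_at[OF tr(1) lh(1,3) \<tau>(1) _ cl(2) d21[OF \<tau>(1)]])
           (use inj_onD[OF inj(1), of _ \<tau>] \<tau>(1) lh(1-3) in auto)
    qed
  qed (use st lh in auto)
qed

section \<open>Uniqueness and counting\<close>

lemma same_unoriented_arc_arcs:
  assumes "arc g1" "arc g2" "path_image g1 = path_image g2"
  shows "same_unoriented_arc g1 g2"
proof -
  obtain k1 where k1: "homeomorphism {0..1} (path_image g1) g1 k1" using homeomorphism_arc[OF assms(1)] .
  obtain k2 where k2: "homeomorphism {0..1} (path_image g2) g2 k2" using homeomorphism_arc[OF assms(2)] .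
  have "homeomorphism {0..1} {0..1} (k1 \<circ> g2) (k2 \<circ> g1)"
    using homeomorphism_compose[OF k2 homeomorphism_symD[OF k1[unfolded assms(3)]]] .
  moreover have "g2 t = g1 ((k1 \<circ> g2) t)" if "t \<in> {0..1}" for t
  proof -
    have "g2 t \<in> path_image g1" using that assms(3) by (simp add: path_image_def)
    then show ?thesis using k1 unfolding homeomorphism_def by simp
  qed
  ultimately show ?thesis unfolding same_unoriented_arc_def by blast
qed

lemma saddle_connection_unique:
  assumes P0: "P \<noteq> 0" and g: "saddle_connection P g1" "saddle_connection P g2"
    and ends: "{pathstart g1, pathfinish g1} = {pathstart g2, pathfinish g2}"
  shows "same_unoriented_arc g1 g2"
proof (rule same_unoriented_arc_arcs)
  have "{pathstart g, pathfinish g} \<subseteq> path_image g" for g :: "real \<Rightarrow> complex" by auto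
  then have "{pathstart g2, pathfinish g2} \<subseteq> path_image g1" "{pathstart g1, pathfinish g1} \<subseteq> path_image g2"
    using ends by metis+
  then show "path_image g1 = path_image g2"
    using saddle_connection_subset[OF P0] g by blast
qed (use saddle_connection_arc[OF P0] g in auto)

text \<open>The ends of a representative determine its class by uniqueness, and they are distinct
  because saddle connections are arcs. So the classes inject into the two-element sets of zeros;
  multiple zeros only lower the count.\<close>

lemma finite_card_saddle_connections:
  assumes P0: "P \<noteq> 0"
  shows "finite (unoriented_saddle_connections P) \<and>
    card (unoriented_saddle_connections P) \<le> degree P choose 2"
proof -
  define A where "A = {g. saddle_connection P g}"
  define R where "R = {(g1, g2). saddle_connection P g1 \<and> saddle_connection P g2 \<and> same_unoriented_arc g1 g2}"
  have Q: "unoriented_saddle_connections P = A // R"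
    by (simp add: unoriented_saddle_connections_def A_def R_def)
  have eqS: "equiv UNIV {(g1, g2). same_unoriented_arc g1 g2}" by (rule equiv_same_unoriented_arc)
  have eqR: "equiv A R"
  proof (rule equivI)
    show "refl_on A R" using saddle_connection_unique[OF P0] by (auto simp: refl_on_def A_def R_def)
    show "sym R" using equivE[OF eqS] by (auto simp: R_def sym_def)
    have tr: "trans {(g1, g2). same_unoriented_arc g1 g2}" using eqS by (rule equivE)
    show "trans R"
    proof (rule transI)
      fix g1 g2 g3 assume "(g1, g2) \<in> R" "(g2, g3) \<in> R"
      then show "(g1, g3) \<in> R" using tr by (auto simp: R_def dest: transD)
    qed
    show "R \<subseteq> A \<times> A" by (auto simp: A_def R_def)
  qed
  define Z where "Z = {z. poly P z = 0}"
  have Z: "finite Z" "card Z \<le> degree P"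
    using poly_roots_finite[OF P0] card_poly_roots_bound[OF P0] by (auto simp: Z_def)
  define ends where "ends g = {pathstart g, pathfinish g}" for g :: "real \<Rightarrow> complex"
  define rep where "rep X = (SOME g. g \<in> X)" for X :: "(real \<Rightarrow> complex) set"
  have rep: "rep X \<in> X" "saddle_connection P (rep X)" if "X \<in> A // R" for X
  proof -
    show "rep X \<in> X" unfolding rep_def
      using in_quotient_imp_non_empty[OF eqR that] by (metis some_in_eq)
    then show "saddle_connection P (rep X)"
      using in_quotient_imp_subset[OF eqR that] by (auto simp: A_def)
  qed
  have "(\<lambda>X. ends (rep X)) ` (A // R) \<subseteq> {B. B \<subseteq> Z \<and> card B = 2}"
  proof (intro image_subsetI CollectI conjI)
    fix X assume X: "X \<in> A // R"
    show "ends (rep X) \<subseteq> Z"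
      using rep(2)[OF X] by (auto simp: ends_def Z_def saddle_connection_def)
    show "card (ends (rep X)) = 2"
      using arc_distinct_ends[OF saddle_connection_arc[OF P0 rep(2)[OF X]]] by (auto simp: ends_def)
  qed
  moreover have "inj_on (\<lambda>X. ends (rep X)) (A // R)"
  proof (rule inj_onI)
    fix X Y assume XY: "X \<in> A // R" "Y \<in> A // R" "ends (rep X) = ends (rep Y)"
    have "same_unoriented_arc (rep X) (rep Y)"
      by (rule saddle_connection_unique[OF P0 rep(2)[OF XY(1)] rep(2)[OF XY(2)]])
         (use XY(3) in \<open>simp add: ends_def\<close>)
    then have "(rep X, rep Y) \<in> R" using rep(2) XY by (simp add: R_def)
    then show "X = Y" using quotient_eq_iff[OF eqR XY(1,2) rep(1)[OF XY(1)] rep(1)[OF XY(2)]] by blast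
  qed
  moreover have fin: "finite {B. B \<subseteq> Z \<and> card B = 2}" using Z(1) by simp
  ultimately have "finite (A // R)" "card (A // R) \<le> card {B. B \<subseteq> Z \<and> card B = 2}"
    by (meson inj_on_finite, meson card_inj_on_le)
  moreover have "card {B. B \<subseteq> Z \<and> card B = 2} = card Z choose 2" by (rule n_subsets[OF Z(1)])
  moreover have "card Z choose 2 \<le> degree P choose 2" by (rule binomial_right_mono[OF Z(2)])
  ultimately show ?thesis unfolding Q by simp
qed

theorem corollary5p3:
  fixes P :: "complex poly" and d :: nat
  assumes "P \<noteq> 0" and "degree P = d"
  shows "(\<nexists>g. closed_saddle_connection P g) \<and>
    (\<forall>a b. poly P a = 0 \<longrightarrow> poly P b = 0 \<longrightarrow> a \<noteq> b \<longrightarrow>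
       (\<forall>g1 g2. saddle_connection P g1 \<longrightarrow> saddle_connection P g2 \<longrightarrow>
          {pathstart g1, pathfinish g1} = {a, b} \<longrightarrow> {pathstart g2, pathfinish g2} = {a, b} \<longrightarrow>
          same_unoriented_arc g1 g2)) \<and>
    finite (unoriented_saddle_connections P) \<and>
    real (card (unoriented_saddle_connections P)) \<le> real d * (real d - 1) / 2"
proof (intro conjI allI impI)
  show "\<nexists>g. closed_saddle_connection P g"
    using saddle_connection_arc[OF assms(1)] arc_distinct_ends
    unfolding closed_saddle_connection_def by metis
  show "same_unoriented_arc g1 g2"
    if "saddle_connection P g1" "saddle_connection P g2"
      "{pathstart g1, pathfinish g1} = {a, b}" "{pathstart g2, pathfinish g2} = {a, b}" for a b g1 g2
    using saddle_connection_unique[OF assms(1)] that by simp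
  show "finite (unoriented_saddle_connections P)"
    using finite_card_saddle_connections[OF assms(1)] by blast
  have "card (unoriented_saddle_connections P) \<le> d choose 2"
    using finite_card_saddle_connections[OF assms(1)] assms(2) by blast
  then have "real (card (unoriented_saddle_connections P)) \<le> real (d choose 2)" by simp
  \<comment> \<open>\<open>real d - 1\<close> is a true subtraction, whereas
    \<open>d choose 2\<close> expands to d (d - 1) div 2 with truncated subtraction; at d = 0 both
    sides are 0.\<close>
  also have "\<dots> = real d * (real d - 1) / 2"
    by (cases d) (simp_all add: choose_two real_of_nat_div algebra_simps)
  finally show "real (card (unoriented_saddle_connections P)) \<le> real d * (real d - 1) / 2" .
qed

end
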